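(* Under the standing assumptions below, for every Nash equilibrium $\hat u^N=(\hat u^{1,N},\dots,\hat u^{N,N})\in\mathcal U^N$ of the $N$-player game, the operators $\overline{\boldsymbol D}_t$ ($t\in[0,T]$) and $\mathrm{id}-\overline{\boldsymbol B}$ are invertible and the average $\bar u^N:=\frac1N\sum_{j=1}^N\hat u^{j,N}$ satisfies $$\bar u^N_t=\big((\mathrm{id}-\overline{\boldsymbol B})^{-1}\overline a\big)(t),\qquad 0\le t\le T,$$ where $\overline{\boldsymbol B}$ is the integral operator with kernel $\overline B$ and $$\overline a_t:=\frac1{2\lambda}\Big(\bar b_t+\tfrac1N b^0_t-\Big\langle 1_{\{t\le\cdot\}}\overline K(\cdot,t),\ \overline{\boldsymbol D}_t^{-1}\,1_{\{t\le\cdot\}}\mathbb E_t\big[\bar b_\cdot+\tfrac1N b^0_\cdot\big]\Big\rangle_{L^2}\Big),$$ $$\overline B(t,s):=1_{\{s<t\}}\frac1{2\lambda}\Big(\big\langle 1_{\{t\le\cdot\}}\overline K(\cdot,t),\ \overline{\boldsymbol D}_t^{-1}1_{\{t\le\cdot\}}\overline K(\cdot,s)\big\rangle_{L^2}-\overline K(t,s)\Big),$$ $$\overline K(t,s):=\tfrac{N-1}{N}H(t,s)+G(t,s),\qquad \overline{\boldsymbol D}_t:=2\lambda\,\mathrm{id}+\tfrac{N-1}{N}(\boldsymbol H_t+\boldsymbol H_t^* )+\boldsymbol G_t+\boldsymbol G_t^*.$$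
   Context: Fix $T>0$, an integer $N\ge2$ and a filtered probability space $(\Omega,\mathcal F,\mathbb F=(\mathcal F_t)_{0\le t\le T},\mathbb P)$ satisfying the usual conditions; $\mathbb E_t[\cdot]:=\mathbb E[\cdot\mid\mathcal F_t]$. On $L^2([0,T],\mathbb R)$, $\langle f,g\rangle_{L^2}=\int_0^Tf(s)g(s)\,ds$. A kernel $G\in L^2([0,T]^2,\mathbb R)$ induces the integral operator $(\boldsymbol Gf)(s)=\int_0^TG(s,u)f(u)\,du$; $G^*(s,u):=G(u,s)$ and $\boldsymbol G^*$ is the adjoint operator; $\mathrm{id}$ is the identity operator. A measurable kernel $G$ is Volterra if $G(t,s)=0$ whenever $s\ge t$; it is nonnegative definite if $\int_0^T\int_0^T(G(t,s)+G(s,t))f(s)f(t)\,ds\,dt\ge0$ for all $f\in L^2([0,T],\mathbb R)$. The class $\mathcal G$ consists of the nonnegative definite Volterra kernels $G:[0,T]^2\to\mathbb R_+$ with $\sup_{t\le T}\int_0^T|G(t,s)|^2ds+\sup_{s\le T}\int_0^T|G(t,s)|^2dt<\infty$; an admissible Volterra operator is an integral operator induced by a kernel in $\mathcal G$. For $G\in\mathcal G$ and $t\in[0,T]$, $G_t(s,r):=G(s,r)1_{\{r\ge t\}}$, $\boldsymbol G_t$ is its integral operator and $\boldsymbol G_t^*$ the adjoint of $\boldsymbol G_t$. $\mathcal U$ is the set of $\mathbb F$-progressively measurable real processes $u$ with $\int_0^T\mathbb E[u_s^2]ds<\infty$. Standing assumptions (N-player game): $b^0,b^1,\dots,b^N$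 are progressively measurable processes with $\int_0^T\mathbb E[(b^i_s)^2]ds<\infty$, and $c^1,\dots,c^N$ are integrable random variables. $\boldsymbol A_1,\boldsymbol A_3$ are admissible Volterra operators with kernels $A_1,A_3\in\mathcal G$, and $\boldsymbol A_2=\lambda\,\mathrm{id}+\hat{\boldsymbol A}_2$ with a constant $\lambda>0$ and $\hat{\boldsymbol A}_2$ an admissible Volterra operator with kernel $\hat A_2\in\mathcal G$. For $u^{1,N},\dots,u^{N,N}\in\mathcal U$ set $u^{-i,N}=(u^{j,N})_{j\ne i}$ and $\bar u^N=\frac1N\sum_{j=1}^Nu^{j,N}$. Player $i$'s objective is $$J^{i,N}(u^{i,N};u^{-i,N})=\mathbb E\Big[-\langle\bar u^N,\boldsymbol A_1\bar u^N\rangle_{L^2}-\langle u^{i,N},\boldsymbol A_2u^{i,N}\rangle_{L^2}-\langle u^{i,N},(\boldsymbol A_3+\boldsymbol A_3^* )\bar u^N\rangle_{L^2}+\langle b^i,u^{i,N}\rangle_{L^2}+\langle b^0,\bar u^N\rangle_{L^2}+c^i\Big].$$ A Nash equilibrium is $\hat u^N=(\hat u^{1,N},\dots,\hat u^{N,N})\in\mathcal U^N$ with $J^{i,N}(\hat u^{i,N};\hat u^{-i,N})\ge J^{i,N}(v;\hat u^{-i,N})$ for all $i$ and all $v\in\mathcal U$. Define $\boldsymbol G:=\frac{\boldsymbol A_1}{N^2}+\frac{2\boldsymbol A_3}{N}+\hat{\boldsymbol A}_2$ and $\boldsymbol H:=\frac{\boldsymbol A_1}{N}+\boldsymbol A_3$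 with kernels $G=\frac{A_1}{N^2}+\frac{2A_3}N+\hat A_2$, $H=\frac{A_1}N+A_3$, and $\bar b_t:=\frac1N\sum_{i=1}^Nb^i_t$. *)

theory Defs
  imports "HOL-Probability.Probability"
begin

definition is_filtration :: "'a measure \<Rightarrow> (real \<Rightarrow> 'a measure) \<Rightarrow> real \<Rightarrow> bool" where
  "is_filtration M F T \<longleftrightarrow>
     (\<forall>t\<in>{0..T}. subalgebra M (F t)) \<and>
     (\<forall>s t. 0 \<le> s \<longrightarrow> s \<le> t \<longrightarrow> t \<le> T \<longrightarrow> sets (F s) \<subseteq> sets (F t))"

definition usual_conditions :: "'a measure \<Rightarrow> (real \<Rightarrow> 'a measure) \<Rightarrow> real \<Rightarrow> bool" where
  "usual_conditions M F T \<longleftrightarrow>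
     (\<forall>A\<in>null_sets M. \<forall>B. B \<subseteq> A \<longrightarrow> B \<in> sets (F 0)) \<and>
     (\<forall>t\<in>{0..<T}. sets (F t) = (\<Inter>s\<in>{t<..T}. sets (F s)))"

definition prog_measurable :: "'a measure \<Rightarrow> (real \<Rightarrow> 'a measure) \<Rightarrow> real \<Rightarrow> (real \<Rightarrow> 'a \<Rightarrow> real) \<Rightarrow> bool" where
  "prog_measurable M F T u \<longleftrightarrow>
     (\<forall>t\<in>{0..T}. (\<lambda>(s,\<omega>). u s \<omega>) \<in> borel_measurable (restrict_space borel {0..t} \<Otimes>\<^sub>M F t))"

definition admissible :: "'a measure \<Rightarrow> (real \<Rightarrow> 'a measure) \<Rightarrow> real \<Rightarrow> (real \<Rightarrow> 'a \<Rightarrow> real) \<Rightarrow> bool" where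
  "admissible M F T u \<longleftrightarrow> prog_measurable M F T u \<and>
     (\<integral>\<^sup>+ s. (\<integral>\<^sup>+ \<omega>. ennreal ((u s \<omega>)\<^sup>2) \<partial>M) * indicator {0..T} s \<partial>lborel) < \<infinity>"

definition L2 :: "real \<Rightarrow> (real \<Rightarrow> real) \<Rightarrow> bool" where
  "L2 T f \<longleftrightarrow> set_borel_measurable lborel {0..T} f \<and> set_integrable lborel {0..T} (\<lambda>s. (f s)\<^sup>2)"

definition L2_eq :: "real \<Rightarrow> (real \<Rightarrow> real) \<Rightarrow> (real \<Rightarrow> real) \<Rightarrow> bool" where
  "L2_eq T f g \<longleftrightarrow> (AE s in lborel. s \<in> {0..T} \<longrightarrow> f s = g s)"

definition l2inner :: "real \<Rightarrow> (real \<Rightarrow> real) \<Rightarrow> (real \<Rightarrow> real) \<Rightarrow> real" where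
  "l2inner T f g = (LINT s:{0..T}|lborel. f s * g s)"

definition kop :: "real \<Rightarrow> (real \<Rightarrow> real \<Rightarrow> real) \<Rightarrow> (real \<Rightarrow> real) \<Rightarrow> (real \<Rightarrow> real)" where
  "kop T K f = (\<lambda>t. LINT s:{0..T}|lborel. K t s * f s)"

definition adj :: "(real \<Rightarrow> real \<Rightarrow> real) \<Rightarrow> (real \<Rightarrow> real \<Rightarrow> real)" where
  "adj K = (\<lambda>s u. K u s)"

definition cut :: "(real \<Rightarrow> real \<Rightarrow> real) \<Rightarrow> real \<Rightarrow> (real \<Rightarrow> real \<Rightarrow> real)" where
  "cut K t = (\<lambda>s r. if t \<le> r then K s r else 0)"

definition op_invertible :: "real \<Rightarrow> ((real \<Rightarrow> real) \<Rightarrow> (real \<Rightarrow> real)) \<Rightarrow> bool" where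
  "op_invertible T A \<longleftrightarrow>
     (\<forall>f. L2 T f \<longrightarrow> L2 T (A f)) \<and>
     (\<forall>g. L2 T g \<longrightarrow> (\<exists>f. L2 T f \<and> L2_eq T (A f) g)) \<and>
     (\<forall>f g. L2 T f \<longrightarrow> L2 T g \<longrightarrow> L2_eq T (A f) (A g) \<longrightarrow> L2_eq T f g)"

definition op_inv :: "real \<Rightarrow> ((real \<Rightarrow> real) \<Rightarrow> (real \<Rightarrow> real)) \<Rightarrow> (real \<Rightarrow> real) \<Rightarrow> (real \<Rightarrow> real)" where
  "op_inv T A g = (SOME f. L2 T f \<and> L2_eq T (A f) g)"

definition volterra :: "real \<Rightarrow> (real \<Rightarrow> real \<Rightarrow> real) \<Rightarrow> bool" where
  "volterra T G \<longleftrightarrow> (\<forall>t\<in>{0..T}. \<forall>s\<in>{0..T}. t \<le> s \<longrightarrow> G t s = 0)"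

definition nonneg_definite :: "real \<Rightarrow> (real \<Rightarrow> real \<Rightarrow> real) \<Rightarrow> bool" where
  "nonneg_definite T G \<longleftrightarrow> (\<forall>f. L2 T f \<longrightarrow>
     0 \<le> (LINT t:{0..T}|lborel. LINT s:{0..T}|lborel. (G t s + G s t) * f s * f t))"

definition admissible_kernel :: "real \<Rightarrow> (real \<Rightarrow> real \<Rightarrow> real) \<Rightarrow> bool" where
  "admissible_kernel T G \<longleftrightarrow>
     set_borel_measurable borel ({0..T} \<times> {0..T}) (\<lambda>(t,s). G t s) \<and>
     set_integrable lborel ({0..T} \<times> {0..T}) (\<lambda>(t,s). (G t s)\<^sup>2) \<and>
     volterra T G \<and> nonneg_definite T G \<and>
     (\<forall>t\<in>{0..T}. \<forall>s\<in>{0..T}. 0 \<le> G t s) \<and>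
     (\<exists>C::real. \<forall>t\<in>{0..T}. (\<integral>\<^sup>+ s. ennreal ((G t s)\<^sup>2) * indicator {0..T} s \<partial>lborel) \<le> ennreal C) \<and>
     (\<exists>C::real. \<forall>s\<in>{0..T}. (\<integral>\<^sup>+ t. ennreal ((G t s)\<^sup>2) * indicator {0..T} t \<partial>lborel) \<le> ennreal C)"

definition avg :: "nat \<Rightarrow> (nat \<Rightarrow> real \<Rightarrow> 'a \<Rightarrow> real) \<Rightarrow> real \<Rightarrow> 'a \<Rightarrow> real" where
  "avg N U = (\<lambda>t \<omega>. (\<Sum>j=1..N. U j t \<omega>) / real N)"

text \<open>Pathwise payoff of player i under strategy profile U (players 1..N);
  A_2 = lam id + A2h.\<close>
definition payoff :: "nat \<Rightarrow> real \<Rightarrow> (real \<Rightarrow> real \<Rightarrow> real) \<Rightarrow> real \<Rightarrow> (real \<Rightarrow> real \<Rightarrow> real)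
    \<Rightarrow> (real \<Rightarrow> real \<Rightarrow> real) \<Rightarrow> (real \<Rightarrow> 'a \<Rightarrow> real) \<Rightarrow> (nat \<Rightarrow> real \<Rightarrow> 'a \<Rightarrow> real)
    \<Rightarrow> (nat \<Rightarrow> 'a \<Rightarrow> real) \<Rightarrow> nat \<Rightarrow> (nat \<Rightarrow> real \<Rightarrow> 'a \<Rightarrow> real) \<Rightarrow> 'a \<Rightarrow> real" where
  "payoff N T A1 lam A2h A3 b0 b c i U \<omega> =
    (let ub = (\<lambda>t. avg N U t \<omega>); ui = (\<lambda>t. U i t \<omega>) in
      - l2inner T ub (kop T A1 ub)
      - l2inner T ui (\<lambda>t. lam * ui t + kop T A2h ui t)
      - l2inner T ui (\<lambda>t. kop T A3 ub t + kop T (adj A3) ub t)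
      + l2inner T (\<lambda>t. b i t \<omega>) ui
      + l2inner T (\<lambda>t. b0 t \<omega>) ub
      + c i \<omega>)"

definition objective :: "'a measure \<Rightarrow> nat \<Rightarrow> real \<Rightarrow> (real \<Rightarrow> real \<Rightarrow> real) \<Rightarrow> real \<Rightarrow> (real \<Rightarrow> real \<Rightarrow> real)
    \<Rightarrow> (real \<Rightarrow> real \<Rightarrow> real) \<Rightarrow> (real \<Rightarrow> 'a \<Rightarrow> real) \<Rightarrow> (nat \<Rightarrow> real \<Rightarrow> 'a \<Rightarrow> real)
    \<Rightarrow> (nat \<Rightarrow> 'a \<Rightarrow> real) \<Rightarrow> nat \<Rightarrow> (nat \<Rightarrow> real \<Rightarrow> 'a \<Rightarrow> real) \<Rightarrow> real" where
  "objective M N T A1 lam A2h A3 b0 b c i U =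
     (\<integral>\<omega>. payoff N T A1 lam A2h A3 b0 b c i U \<omega> \<partial>M)"

definition nash_equilibrium :: "'a measure \<Rightarrow> (real \<Rightarrow> 'a measure) \<Rightarrow> nat \<Rightarrow> real \<Rightarrow> (real \<Rightarrow> real \<Rightarrow> real) \<Rightarrow> real
    \<Rightarrow> (real \<Rightarrow> real \<Rightarrow> real) \<Rightarrow> (real \<Rightarrow> real \<Rightarrow> real) \<Rightarrow> (real \<Rightarrow> 'a \<Rightarrow> real)
    \<Rightarrow> (nat \<Rightarrow> real \<Rightarrow> 'a \<Rightarrow> real) \<Rightarrow> (nat \<Rightarrow> 'a \<Rightarrow> real) \<Rightarrow> (nat \<Rightarrow> real \<Rightarrow> 'a \<Rightarrow> real) \<Rightarrow> bool" where
  "nash_equilibrium M F N T A1 lam A2h A3 b0 b c U \<longleftrightarrow>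
     (\<forall>i\<in>{1..N}. admissible M F T (U i)) \<and>
     (\<forall>i\<in>{1..N}. \<forall>v. admissible M F T v \<longrightarrow>
        objective M N T A1 lam A2h A3 b0 b c i (U(i := v))
          \<le> objective M N T A1 lam A2h A3 b0 b c i U)"

definition Gk :: "nat \<Rightarrow> (real \<Rightarrow> real \<Rightarrow> real) \<Rightarrow> (real \<Rightarrow> real \<Rightarrow> real) \<Rightarrow> (real \<Rightarrow> real \<Rightarrow> real) \<Rightarrow> (real \<Rightarrow> real \<Rightarrow> real)" where
  "Gk N A1 A2h A3 = (\<lambda>t s. A1 t s / (real N)\<^sup>2 + 2 * A3 t s / real N + A2h t s)"

definition Hk :: "nat \<Rightarrow> (real \<Rightarrow> real \<Rightarrow> real) \<Rightarrow> (real \<Rightarrow> real \<Rightarrow> real) \<Rightarrow> (real \<Rightarrow> real \<Rightarrow> real)" where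
  "Hk N A1 A3 = (\<lambda>t s. A1 t s / real N + A3 t s)"

definition Kbar :: "nat \<Rightarrow> (real \<Rightarrow> real \<Rightarrow> real) \<Rightarrow> (real \<Rightarrow> real \<Rightarrow> real) \<Rightarrow> (real \<Rightarrow> real \<Rightarrow> real) \<Rightarrow> (real \<Rightarrow> real \<Rightarrow> real)" where
  "Kbar N A1 A2h A3 = (\<lambda>t s. (real N - 1) / real N * Hk N A1 A3 t s + Gk N A1 A2h A3 t s)"

definition Dbar :: "nat \<Rightarrow> real \<Rightarrow> (real \<Rightarrow> real \<Rightarrow> real) \<Rightarrow> real \<Rightarrow> (real \<Rightarrow> real \<Rightarrow> real)
    \<Rightarrow> (real \<Rightarrow> real \<Rightarrow> real) \<Rightarrow> real \<Rightarrow> (real \<Rightarrow> real) \<Rightarrow> (real \<Rightarrow> real)" where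
  "Dbar N T A1 lam A2h A3 t f = (\<lambda>r.
      2 * lam * f r
      + (real N - 1) / real N * (kop T (cut (Hk N A1 A3) t) f r + kop T (adj (cut (Hk N A1 A3) t)) f r)
      + kop T (cut (Gk N A1 A2h A3) t) f r + kop T (adj (cut (Gk N A1 A2h A3) t)) f r)"

definition Bbar :: "nat \<Rightarrow> real \<Rightarrow> (real \<Rightarrow> real \<Rightarrow> real) \<Rightarrow> real \<Rightarrow> (real \<Rightarrow> real \<Rightarrow> real)
    \<Rightarrow> (real \<Rightarrow> real \<Rightarrow> real) \<Rightarrow> (real \<Rightarrow> real \<Rightarrow> real)" where
  "Bbar N T A1 lam A2h A3 = (\<lambda>t s. if s < t then
      1 / (2 * lam) * (l2inner T (\<lambda>r. if t \<le> r then Kbar N A1 A2h A3 r t else 0)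
          (op_inv T (Dbar N T A1 lam A2h A3 t) (\<lambda>r. if t \<le> r then Kbar N A1 A2h A3 r s else 0))
        - Kbar N A1 A2h A3 t s)
    else 0)"

text \<open>E_t[X_.] as a process in r: conditional expectation on [0,T] x Omega (w.r.t.
  Lebesgue x P) of (r,w) |-> X r w given the sigma-algebra B([0,T]) x F_t.\<close>
definition cond_exp_proc :: "'a measure \<Rightarrow> (real \<Rightarrow> 'a measure) \<Rightarrow> real \<Rightarrow> real \<Rightarrow> (real \<Rightarrow> 'a \<Rightarrow> real) \<Rightarrow> real \<Rightarrow> 'a \<Rightarrow> real" where
  "cond_exp_proc M F T t X = (\<lambda>r \<omega>.
     real_cond_exp (restrict_space lborel {0..T} \<Otimes>\<^sub>M M) (restrict_space lborel {0..T} \<Otimes>\<^sub>M F t)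
       (\<lambda>(r,\<omega>). X r \<omega>) (r, \<omega>))"

definition abar_formula :: "'a measure \<Rightarrow> (real \<Rightarrow> 'a measure) \<Rightarrow> nat \<Rightarrow> real \<Rightarrow> (real \<Rightarrow> real \<Rightarrow> real) \<Rightarrow> real
    \<Rightarrow> (real \<Rightarrow> real \<Rightarrow> real) \<Rightarrow> (real \<Rightarrow> real \<Rightarrow> real) \<Rightarrow> (real \<Rightarrow> 'a \<Rightarrow> real)
    \<Rightarrow> (nat \<Rightarrow> real \<Rightarrow> 'a \<Rightarrow> real) \<Rightarrow> real \<Rightarrow> 'a \<Rightarrow> real" where
  "abar_formula M F N T A1 lam A2h A3 b0 b t \<omega> =
    (let X = (\<lambda>r \<omega>'. avg N b r \<omega>' + b0 r \<omega>' / real N) in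
     1 / (2 * lam) * (X t \<omega>
       - l2inner T (\<lambda>r. if t \<le> r then Kbar N A1 A2h A3 r t else 0)
           (op_inv T (Dbar N T A1 lam A2h A3 t)
              (\<lambda>r. if t \<le> r then cond_exp_proc M F T t X r \<omega> else 0))))"

end

theory Submission
  imports Defs
begin

text \<open>Let \<open>m\<close> be the average control, \<open>X\<close> the average of the \<open>b i\<close> plus \<open>b0 / N\<close>, and \<open>K = Kbar\<close> with adjoint \<open>K*\<close>.
  The objectives are quadratic in a player's own control, so averaging the \<open>N\<close> first-order conditions
  gives \<open>E \<langle>v, \<Theta>\<rangle> = 0\<close> for all admissible \<open>v\<close>, where \<open>\<Theta> = X - 2 lam m - K m - K* m\<close> (\<open>foc\<close> below).

  Let \<open>z\<close> (\<open>dual_col\<close>) solve \<open>Dbar t z = K(\<cdot>, t)\<close> on \<open>[t, T]\<close>. It vanishes before \<open>t\<close>, so \<open>z\<close> times the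
  indicator of \<open>A \<in> F t\<close> is admissible and \<open>E (1\<^sub>A \<langle>z, \<Theta>\<rangle>) = 0\<close>; as \<open>Dbar t\<close> is self-adjoint,
  \<open>\<langle>z, (2 lam + K + K*) m\<rangle> = (K* m)(t) + 2 lam (B m)(t) + (K m)(t)\<close> with \<open>B = Bbar\<close> (\<open>volterra_resolvent\<close>).
  Testing instead with the indicator of \<open>[t, t + h] \<times> A\<close> and letting \<open>h\<close> tend to 0 gives
  \<open>E (1\<^sub>A \<Theta> t) = 0\<close> for almost every \<open>t\<close>. In the difference of the two identities the anticipating term
  \<open>(K* m)(t)\<close> cancels, and what is left is the conditional form of \<open>m - B m = abar\<close> at time \<open>t\<close>.\<close>

subsection \<open>Square-integrable functions and kernels on a finite measure space\<close>

text \<open>What survives the cancellation at a fixed \<open>t\<close> is measurable for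
  \<open>F t\<close>: it consists of \<open>m t\<close>, \<open>X t\<close>, the past of
  \<open>m\<close> seen through \<open>Bbar\<close>, and a conditional expectation taken once on the
  product of time and sample space. Orthogonality to all events of \<open>F t\<close> therefore
  forces it to vanish, without ever conditioning the anticipating term.

  Two obstacles shape the rest. \<open>op_inv\<close> picks an arbitrary representative for each
  right-hand side, so nothing built from it is visibly measurable in \<open>t\<close>.
  Self-adjointness of \<open>Dbar t\<close> moves the inverse onto the fixed column of
  \<open>K\<close>, where an everywhere convergent series with jointly measurable terms replaces it.
  This makes the kernel of \<open>Bbar\<close> measurable with uniformly bounded rows, and
  \<open>id - Bbar\<close> invertible by Picard iteration. Secondly, the exceptional set of times
  must serve all events of \<open>F t\<close> at once, a family that moves with \<open>t\<close>;
  differentiation in time is therefore done in the \<open>L1\<close> norm over the sample space,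
  which controls all events together.\<close>

definition l2 :: "'b measure \<Rightarrow> ('b \<Rightarrow> real) \<Rightarrow> bool" where
  "l2 L f \<longleftrightarrow> f \<in> borel_measurable L \<and> integrable L (\<lambda>x. (f x)\<^sup>2)"

definition kint :: "'b measure \<Rightarrow> ('b \<Rightarrow> 'b \<Rightarrow> real) \<Rightarrow> ('b \<Rightarrow> real) \<Rightarrow> 'b \<Rightarrow> real" where
  "kint L K f t = (\<integral>s. K t s * f s \<partial>L)"

text \<open>A uniform bound on the rows, on a finite measure space stronger than square
  integrability on the product: \<open>kint L K f\<close> is then defined and bounded at every
  point, so that later identities hold pointwise and not only almost everywhere.\<close>

definition l2_rows :: "'b measure \<Rightarrow> real \<Rightarrow> ('b \<Rightarrow> 'b \<Rightarrow> real) \<Rightarrow> bool" where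
  "l2_rows L C K \<longleftrightarrow> (\<lambda>(t, s). K t s) \<in> borel_measurable (L \<Otimes>\<^sub>M L) \<and>
     (\<forall>t\<in>space L. l2 L (K t) \<and> (\<integral>s. (K t s)\<^sup>2 \<partial>L) \<le> C)"

lemma l2_measurable: "l2 L f \<Longrightarrow> f \<in> borel_measurable L"
  by (simp add: l2_def)

lemma l2_square: "l2 L f \<Longrightarrow> integrable L (\<lambda>x. (f x)\<^sup>2)"
  by (simp add: l2_def)

lemma l2_mult_integrable:
  assumes "l2 L f" "l2 L g"
  shows "integrable L (\<lambda>x. f x * g x)"
proof (rule Bochner_Integration.integrable_bound)
  show "integrable L (\<lambda>x. (f x)\<^sup>2 + (g x)\<^sup>2)"
    using assms by (intro Bochner_Integration.integrable_add) (auto simp: l2_def)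
  show "(\<lambda>x. f x * g x) \<in> borel_measurable L"
    using assms by (auto simp: l2_def)
  have "\<bar>a * b\<bar> \<le> a\<^sup>2 + b\<^sup>2" for a b :: real
  proof -
    have "\<bar>a\<bar> * \<bar>b\<bar> * 2 \<le> \<bar>a\<bar>\<^sup>2 + \<bar>b\<bar>\<^sup>2"
      using sum_squares_bound[of "\<bar>a\<bar>" "\<bar>b\<bar>"] by (simp add: algebra_simps)
    moreover have "0 \<le> \<bar>a\<bar> * \<bar>b\<bar>" by simp
    ultimately have "\<bar>a\<bar> * \<bar>b\<bar> \<le> \<bar>a\<bar>\<^sup>2 + \<bar>b\<bar>\<^sup>2" by linarith
    then show ?thesis by (simp add: abs_mult)
  qed
  then show "AE x in L. norm (f x * g x) \<le> norm ((f x)\<^sup>2 + (g x)\<^sup>2)" by simp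
qed

lemma l2_cmult: "l2 L f \<Longrightarrow> l2 L (\<lambda>x. c * f x)"
  by (auto simp: l2_def power_mult_distrib)

lemma l2_add:
  assumes "l2 L f" "l2 L g"
  shows "l2 L (\<lambda>x. f x + g x)"
proof -
  have "integrable L (\<lambda>x. (f x)\<^sup>2 + (g x)\<^sup>2 + 2 * (f x * g x))"
    using assms l2_mult_integrable[OF assms] by (auto simp: l2_def)
  then show ?thesis
    using assms by (auto simp: l2_def power2_sum algebra_simps)
qed

lemma l2_diff: "l2 L f \<Longrightarrow> l2 L g \<Longrightarrow> l2 L (\<lambda>x. f x - g x)"
  using l2_add[of L f "\<lambda>x. (-1) * g x"] l2_cmult[of L g "-1"] by simp

lemma l2_zero: "l2 L (\<lambda>x. 0)"
  by (simp add: l2_def)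

lemma l2_sum: "(\<And>i. i \<in> I \<Longrightarrow> l2 L (f i)) \<Longrightarrow> l2 L (\<lambda>x. \<Sum>i\<in>I. f i x)"
  by (induction I rule: infinite_finite_induct) (auto intro: l2_add l2_zero)

lemma l2_bound:
  assumes "l2 L g" "f \<in> borel_measurable L" "\<And>x. x \<in> space L \<Longrightarrow> \<bar>f x\<bar> \<le> \<bar>g x\<bar>"
  shows "l2 L f"
  unfolding l2_def
proof
  show "integrable L (\<lambda>x. (f x)\<^sup>2)"
    by (rule Bochner_Integration.integrable_bound[OF l2_square[OF assms(1)]])
      (use assms in \<open>auto simp: abs_le_square_iff intro!: AE_I2\<close>)
qed fact

lemma (in finite_measure) l2_const: "l2 M (\<lambda>x. c)"
  by (auto simp: l2_def)

lemma l2_abs: "l2 L f \<Longrightarrow> l2 L (\<lambda>x. \<bar>f x\<bar>)"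
  by (auto simp: l2_def)

lemma (in finite_measure) l2_integrable: "l2 M f \<Longrightarrow> integrable M f"
  using l2_mult_integrable[OF _ l2_const[of 1], of f] by simp

lemma l2_cauchy_schwarz:
  assumes "l2 L f" "l2 L g"
  shows "(\<integral>x. f x * g x \<partial>L)\<^sup>2 \<le> (\<integral>x. (f x)\<^sup>2 \<partial>L) * (\<integral>x. (g x)\<^sup>2 \<partial>L)"
proof -
  define a b c where "a = (\<integral>x. (f x)\<^sup>2 \<partial>L)" and "b = (\<integral>x. f x * g x \<partial>L)"
    and "c = (\<integral>x. (g x)\<^sup>2 \<partial>L)"
  have fg: "integrable L (\<lambda>x. f x * g x)" by (rule l2_mult_integrable[OF assms])
  have quad: "0 \<le> u\<^sup>2 * a + 2 * u * v * b + v\<^sup>2 * c" for u v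
  proof -
    have "0 \<le> (\<integral>x. (u * f x + v * g x)\<^sup>2 \<partial>L)" by simp
    also have "\<dots> = (\<integral>x. u\<^sup>2 * (f x)\<^sup>2 + 2 * u * v * (f x * g x) + v\<^sup>2 * (g x)\<^sup>2 \<partial>L)"
      by (intro Bochner_Integration.integral_cong) (auto simp: power2_eq_square algebra_simps)
    also have "\<dots> = u\<^sup>2 * a + 2 * u * v * b + v\<^sup>2 * c"
      using assms fg unfolding a_def b_def c_def by (subst Bochner_Integration.integral_add | simp add: l2_def)+
    finally show ?thesis .
  qed
  have "0 \<le> a" "0 \<le> c" unfolding a_def c_def by auto
  have "b\<^sup>2 \<le> a * c"
  proof (cases "c = 0")
    case True
    have "b = 0"
    proof (rule ccontr)
      assume "b \<noteq> 0"
      \<comment> \<open>With \<open>c = 0\<close> the form is affine in \<open>v\<close>; at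
        \<open>u = 1\<close> this \<open>v\<close> gives it the value
        \<open>- a - 2 < 0\<close>.\<close>
      define v where "v = - (a + 1) / b"
      have "v * b = - (a + 1)" using \<open>b \<noteq> 0\<close> by (simp add: v_def)
      then show False using quad[of 1 v] True \<open>0 \<le> a\<close> by (simp add: mult.assoc)
    qed
    then show ?thesis using True by simp
  next
    case False
    then have "c > 0" using \<open>0 \<le> c\<close> by simp
    have "0 \<le> c * (a * c - b\<^sup>2)"
      using quad[of c "- b"] by (simp add: power2_eq_square algebra_simps)
    then show ?thesis using \<open>c > 0\<close> by (simp add: zero_le_mult_iff)
  qed
  then show ?thesis by (simp add: a_def b_def c_def)
qed

lemma l2_rows_l2: "l2_rows L C K \<Longrightarrow> t \<in> space L \<Longrightarrow> l2 L (K t)"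
  by (simp add: l2_rows_def)

lemma l2_rows_bound: "l2_rows L C K \<Longrightarrow> t \<in> space L \<Longrightarrow> (\<integral>s. (K t s)\<^sup>2 \<partial>L) \<le> C"
  by (simp add: l2_rows_def)

lemma l2_rows_measurable: "l2_rows L C K \<Longrightarrow> (\<lambda>(t, s). K t s) \<in> borel_measurable (L \<Otimes>\<^sub>M L)"
  by (simp add: l2_rows_def)

lemma kint_square_le:
  assumes "l2_rows L C K" "l2 L f" "t \<in> space L"
  shows "(kint L K f t)\<^sup>2 \<le> C * (\<integral>s. (f s)\<^sup>2 \<partial>L)"
proof -
  have "(kint L K f t)\<^sup>2 \<le> (\<integral>s. (K t s)\<^sup>2 \<partial>L) * (\<integral>s. (f s)\<^sup>2 \<partial>L)"
    unfolding kint_def by (rule l2_cauchy_schwarz[OF l2_rows_l2[OF assms(1,3)] assms(2)])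
  also have "\<dots> \<le> C * (\<integral>s. (f s)\<^sup>2 \<partial>L)"
    using l2_rows_bound[OF assms(1,3)] by (intro mult_right_mono) auto
  finally show ?thesis .
qed

lemma kint_measurable:
  assumes "sigma_finite_measure L" "(\<lambda>(t, s). K t s) \<in> borel_measurable (L \<Otimes>\<^sub>M L)"
    "f \<in> borel_measurable L"
  shows "kint L K f \<in> borel_measurable L"
proof -
  interpret sigma_finite_measure L by fact
  note [measurable] = assms(2,3)
  show ?thesis unfolding kint_def by measurable
qed

lemma kint_integrable:
  assumes "l2_rows L C K" "l2 L f" "t \<in> space L"
  shows "integrable L (\<lambda>s. K t s * f s)"
  by (rule l2_mult_integrable[OF l2_rows_l2[OF assms(1,3)] assms(2)])

lemma kint_add:
  assumes "l2_rows L C K" "l2 L f" "l2 L g" "t \<in> space L"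
  shows "kint L K (\<lambda>s. f s + g s) t = kint L K f t + kint L K g t"
  using kint_integrable[OF assms(1,2,4)] kint_integrable[OF assms(1,3,4)]
  by (simp add: kint_def distrib_left)

lemma kint_cmult: "kint L K (\<lambda>s. c * f s) t = c * kint L K f t"
proof -
  have "(\<lambda>s. K t s * (c * f s)) = (\<lambda>s. c * (K t s * f s))" by (auto simp: ac_simps)
  then show ?thesis by (simp add: kint_def)
qed

lemma kint_diff:
  assumes "l2_rows L C K" "l2 L f" "l2 L g" "t \<in> space L"
  shows "kint L K (\<lambda>s. f s - g s) t = kint L K f t - kint L K g t"
  using kint_integrable[OF assms(1,2,4)] kint_integrable[OF assms(1,3,4)]
  by (simp add: kint_def right_diff_distrib)

lemma l2_kint:
  assumes "finite_measure L" "l2_rows L C K" "l2 L f"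
  shows "l2 L (kint L K f)"
proof -
  interpret finite_measure L by fact
  show ?thesis
  proof (rule l2_bound)
    show "l2 L (\<lambda>_. sqrt (C * (\<integral>s. (f s)\<^sup>2 \<partial>L)))" by (rule l2_const)
    show "kint L K f \<in> borel_measurable L"
      using assms by (intro kint_measurable sigma_finite_measure_axioms) (auto simp: l2_def l2_rows_def)
    show "\<bar>kint L K f t\<bar> \<le> \<bar>sqrt (C * (\<integral>s. (f s)\<^sup>2 \<partial>L))\<bar>" if "t \<in> space L" for t
      using kint_square_le[OF assms(2,3) that] real_le_rsqrt real_sqrt_le_mono real_sqrt_abs
      by (smt (verit))
  qed
qed

lemma integral_square_kint_le:
  assumes "finite_measure L" "l2_rows L C K" "l2 L f"
  shows "(\<integral>t. (kint L K f t)\<^sup>2 \<partial>L) \<le> C * measure L (space L) * (\<integral>s. (f s)\<^sup>2 \<partial>L)"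
proof -
  interpret finite_measure L by fact
  have "(\<integral>t. (kint L K f t)\<^sup>2 \<partial>L) \<le> (\<integral>t. C * (\<integral>s. (f s)\<^sup>2 \<partial>L) \<partial>L)"
    using l2_square[OF l2_kint[OF assms]] kint_square_le[OF assms(2,3)]
    by (intro integral_mono) auto
  then show ?thesis by (simp add: ac_simps)
qed

text \<open>Fubini for \<open>f t * K t s * g s\<close>; absolute integrability follows from the row
  bound, which the absolute value of \<open>K\<close> inherits.\<close>

lemma integral_mult_kint:
  assumes "finite_measure L" "l2_rows L C K" "l2 L f" "l2 L g"
  shows "(\<integral>t. f t * kint L K g t \<partial>L) = (\<integral>t. kint L (\<lambda>t s. K s t) f t * g t \<partial>L)"
proof -
  interpret finite_measure L by fact
  interpret P: pair_sigma_finite L L ..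
  note [measurable] = l2_rows_measurable[OF assms(2)] l2_measurable[OF assms(3)] l2_measurable[OF assms(4)]
  have abs_rows: "l2_rows L C (\<lambda>t s. \<bar>K t s\<bar>)"
    using assms(2) by (auto simp: l2_rows_def intro: l2_abs)
  have int: "integrable (L \<Otimes>\<^sub>M L) (\<lambda>(t, s). f t * (K t s * g s))"
  proof (rule P.Fubini_integrable)
    have "integrable L (\<lambda>t. \<bar>f t\<bar> * kint L (\<lambda>t s. \<bar>K t s\<bar>) (\<lambda>s. \<bar>g s\<bar>) t)"
      using assms abs_rows by (intro l2_mult_integrable l2_kint[of _ C] l2_abs)
    then show "integrable L (\<lambda>t. \<integral>s. norm (case (t, s) of (t, s) \<Rightarrow> f t * (K t s * g s)) \<partial>L)"
      by (simp add: kint_def abs_mult)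
    show "AE t in L. integrable L (\<lambda>s. case (t, s) of (t, s) \<Rightarrow> f t * (K t s * g s))"
      using kint_integrable[OF assms(2,4)] by auto
  qed measurable
  have "(\<integral>t. f t * kint L K g t \<partial>L) = (\<integral>t. (\<integral>s. f t * (K t s * g s) \<partial>L) \<partial>L)"
    by (simp add: kint_def)
  also have "\<dots> = (\<integral>s. (\<integral>t. f t * (K t s * g s) \<partial>L) \<partial>L)"
    using P.Fubini_integral[OF int] by simp
  also have "\<dots> = (\<integral>s. kint L (\<lambda>t s. K s t) f s * g s \<partial>L)"
  proof (rule Bochner_Integration.integral_cong[OF refl])
    fix s
    have "(\<integral>t. f t * (K t s * g s) \<partial>L) = (\<integral>t. (K t s * f t) * g s \<partial>L)"
      by (simp add: ac_simps)
    then show "(\<integral>t. f t * (K t s * g s) \<partial>L) = kint L (\<lambda>t s. K s t) f s * g s"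
      by (simp add: kint_def)
  qed
  finally show ?thesis .
qed

section \<open>Neumann series for \<open>z = g + a z + R z\<close>\<close>

primrec neumann_term :: "'b measure \<Rightarrow> real \<Rightarrow> ('b \<Rightarrow> 'b \<Rightarrow> real) \<Rightarrow> ('b \<Rightarrow> real) \<Rightarrow> nat \<Rightarrow> 'b \<Rightarrow> real" where
  "neumann_term L a R g 0 = g"
| "neumann_term L a R g (Suc n) =
     (\<lambda>r. a * neumann_term L a R g n r + kint L R (neumann_term L a R g n) r)"

definition neumann_sum :: "'b measure \<Rightarrow> real \<Rightarrow> ('b \<Rightarrow> 'b \<Rightarrow> real) \<Rightarrow> ('b \<Rightarrow> real) \<Rightarrow> 'b \<Rightarrow> real" where
  "neumann_sum L a R g r = (\<Sum>n. neumann_term L a R g n r)"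

lemma l2_neumann_term:
  assumes "finite_measure L" "l2_rows L C R" "l2 L g"
  shows "l2 L (neumann_term L a R g n)"
proof (induction n)
  case (Suc n)
  then show ?case using l2_add[OF l2_cmult[OF Suc] l2_kint[OF assms(1,2) Suc]] by simp
qed (use assms in simp)

text \<open>The scalar part \<open>a\<close> is kept apart from \<open>R\<close> because the
  identity is not an integral operator. Decay in \<open>L2\<close> becomes pointwise convergence:
  bounded rows turn \<open>L2\<close> bounds on the terms into pointwise bounds on their images
  under \<open>R\<close>, and \<open>\<bar>a\<bar> < 1\<close> damps what is left. Hence the
  equation holds at every point of the space.\<close>

lemma neumann_sum:
  assumes fin: "finite_measure L" and R: "l2_rows L C R" and g: "l2 L g"
    and a: "\<bar>a\<bar> < 1" and q: "0 \<le> q" "q < 1"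
    and decay: "\<And>n. (\<integral>s. (neumann_term L a R g n s)\<^sup>2 \<partial>L) \<le> D * q ^ n"
  shows "l2 L (neumann_sum L a R g)"
    and "\<And>r. r \<in> space L \<Longrightarrow>
      neumann_sum L a R g r = g r + a * neumann_sum L a R g r + kint L R (neumann_sum L a R g) r"
proof -
  interpret finite_measure L by fact
  define d where "d = neumann_term L a R g"
  have d: "l2 L (d n)" for n unfolding d_def by (rule l2_neumann_term[OF fin R g])
  have "sqrt q < 1" using q by simp
  \<comment> \<open>The midpoint between 1 and the larger of the two rates strictly dominates
    both.\<close>
  define p where "p = (max \<bar>a\<bar> (sqrt q) + 1) / 2"
  have p: "\<bar>a\<bar> < p" "sqrt q < p" "p < 1" "0 < p"
    using a \<open>sqrt q < 1\<close> q unfolding p_def by (auto simp: max_def)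
  \<comment> \<open>Chosen so that \<open>\<kappa> * (p - \<bar>a\<bar>)\<close> equals the constant
    in the pointwise bound \<open>kd\<close>; this closes the induction for the majorant
    \<open>p ^ n * (\<bar>g r\<bar> + \<kappa>)\<close>.\<close>
  define \<kappa> where "\<kappa> = sqrt (\<bar>C\<bar> * \<bar>D\<bar>) / (p - \<bar>a\<bar>)"
  have "0 \<le> \<kappa>" using p by (auto simp: \<kappa>_def)
  have kd: "\<bar>kint L R (d n) r\<bar> \<le> sqrt (\<bar>C\<bar> * \<bar>D\<bar>) * p ^ n" if "r \<in> space L" for n r
  proof -
    have "(kint L R (d n) r)\<^sup>2 \<le> C * (\<integral>s. (d n s)\<^sup>2 \<partial>L)"
      by (rule kint_square_le[OF R d that])
    also have "\<dots> \<le> \<bar>C\<bar> * (\<integral>s. (d n s)\<^sup>2 \<partial>L)"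
      by (intro mult_right_mono) auto
    also have "\<dots> \<le> \<bar>C\<bar> * (\<bar>D\<bar> * q ^ n)"
    proof (intro mult_left_mono)
      have "D * q ^ n \<le> \<bar>D\<bar> * q ^ n" using q by (intro mult_right_mono) auto
      then show "(\<integral>s. (d n s)\<^sup>2 \<partial>L) \<le> \<bar>D\<bar> * q ^ n" using decay[of n] by (simp add: d_def)
    qed simp
    finally have "sqrt ((kint L R (d n) r)\<^sup>2) \<le> sqrt (\<bar>C\<bar> * (\<bar>D\<bar> * q ^ n))"
      by (rule real_sqrt_le_mono)
    then have "\<bar>kint L R (d n) r\<bar> \<le> sqrt (\<bar>C\<bar> * (\<bar>D\<bar> * q ^ n))"
      by (simp only: real_sqrt_abs)
    also have "\<dots> = sqrt (\<bar>C\<bar> * \<bar>D\<bar>) * sqrt q ^ n"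
      by (simp add: real_sqrt_mult real_sqrt_power)
    also have "\<dots> \<le> sqrt (\<bar>C\<bar> * \<bar>D\<bar>) * p ^ n"
      using p q by (intro mult_left_mono power_mono) auto
    finally show ?thesis .
  qed
  have bnd: "\<bar>d n r\<bar> \<le> p ^ n * (\<bar>g r\<bar> + \<kappa>)" if "r \<in> space L" for n r
  proof (induction n)
    case 0
    then show ?case using \<open>0 \<le> \<kappa>\<close> by (simp add: d_def)
  next
    case (Suc n)
    have "\<bar>d (Suc n) r\<bar> \<le> \<bar>a\<bar> * \<bar>d n r\<bar> + \<bar>kint L R (d n) r\<bar>"
      unfolding d_def neumann_term.simps by (metis abs_mult abs_triangle_ineq)
    also have "\<dots> \<le> \<bar>a\<bar> * (p ^ n * (\<bar>g r\<bar> + \<kappa>)) + sqrt (\<bar>C\<bar> * \<bar>D\<bar>) * p ^ n"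
      using Suc kd[OF that, of n] by (intro add_mono mult_left_mono) auto
    also have "sqrt (\<bar>C\<bar> * \<bar>D\<bar>) = \<kappa> * (p - \<bar>a\<bar>)" using p by (simp add: \<kappa>_def)
    also have "\<bar>a\<bar> * (p ^ n * (\<bar>g r\<bar> + \<kappa>)) + \<kappa> * (p - \<bar>a\<bar>) * p ^ n
        = p ^ Suc n * (\<bar>g r\<bar> + \<kappa>) - (p - \<bar>a\<bar>) * p ^ n * \<bar>g r\<bar>"
      by (simp add: algebra_simps)
    also have "\<dots> \<le> p ^ Suc n * (\<bar>g r\<bar> + \<kappa>)" using p by simp
    finally show ?case .
  qed
  have geo: "summable (\<lambda>n. p ^ n)" using p by simp
  have summ: "summable (\<lambda>n. \<bar>d n r\<bar>)" if "r \<in> space L" for r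
    by (rule summable_comparison_test'[OF summable_mult2[OF geo, of "\<bar>g r\<bar> + \<kappa>"], of 0])
      (use bnd[OF that] in auto)
  have S_def: "neumann_sum L a R g r = (\<Sum>n. d n r)" for r
    by (simp add: neumann_sum_def d_def)
  have Smeas: "neumann_sum L a R g \<in> borel_measurable L"
    unfolding neumann_sum_def[abs_def] using l2_measurable[OF d] by (auto simp: d_def)
  have Sl2: "l2 L (neumann_sum L a R g)"
  proof (rule l2_bound)
    show "l2 L (\<lambda>r. 1 / (1 - p) * (\<bar>g r\<bar> + \<kappa>))"
      by (intro l2_cmult l2_add l2_abs g l2_const)
    fix r assume r: "r \<in> space L"
    have "\<bar>neumann_sum L a R g r\<bar> \<le> (\<Sum>n. \<bar>d n r\<bar>)"
      unfolding S_def using summ[OF r] by (rule summable_rabs)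
    also have "\<dots> \<le> (\<Sum>n. p ^ n * (\<bar>g r\<bar> + \<kappa>))"
      using bnd[OF r] summ[OF r] geo by (intro suminf_le summable_mult2) auto
    also have "\<dots> = 1 / (1 - p) * (\<bar>g r\<bar> + \<kappa>)"
      using p geo by (subst suminf_mult2[symmetric]) (auto simp: suminf_geometric)
    also have "\<dots> \<le> \<bar>1 / (1 - p) * (\<bar>g r\<bar> + \<kappa>)\<bar>" by (rule abs_ge_self)
    finally show "\<bar>neumann_sum L a R g r\<bar> \<le> \<bar>1 / (1 - p) * (\<bar>g r\<bar> + \<kappa>)\<bar>" .
  qed (rule Smeas)
  then show "l2 L (neumann_sum L a R g)" .
  fix r assume r: "r \<in> space L"
  have Rr: "l2 L (R r)" by (rule l2_rows_l2[OF R r])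
  have gk: "l2 L (\<lambda>s. \<bar>g s\<bar> + \<kappa>)" by (intro l2_add l2_abs g l2_const)
  have "(\<lambda>n. \<integral>s. R r s * d n s \<partial>L) sums (\<integral>s. (\<Sum>n. R r s * d n s) \<partial>L)"
  proof (rule sums_integral)
    show "integrable L (\<lambda>s. R r s * d n s)" for n by (rule l2_mult_integrable[OF Rr d])
    show "AE s in L. summable (\<lambda>n. norm (R r s * d n s))"
      using summ by (auto simp: abs_mult intro!: summable_mult AE_I2)
    show "summable (\<lambda>n. \<integral>s. norm (R r s * d n s) \<partial>L)"
    proof (rule summable_comparison_test'[OF summable_mult2[OF geo, of "\<integral>s. \<bar>R r s\<bar> * (\<bar>g s\<bar> + \<kappa>) \<partial>L"], of 0])
      fix n
      have "(\<integral>s. norm (R r s * d n s) \<partial>L) \<le> (\<integral>s. p ^ n * (\<bar>R r s\<bar> * (\<bar>g s\<bar> + \<kappa>)) \<partial>L)"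
      proof (rule integral_mono)
        show "integrable L (\<lambda>s. norm (R r s * d n s))"
          by (intro integrable_norm l2_mult_integrable[OF Rr d])
        show "integrable L (\<lambda>s. p ^ n * (\<bar>R r s\<bar> * (\<bar>g s\<bar> + \<kappa>)))"
          by (intro integrable_mult_right l2_mult_integrable l2_abs Rr gk)
        fix s assume "s \<in> space L"
        from mult_left_mono[OF bnd[OF this, of n], of "\<bar>R r s\<bar>"]
        show "norm (R r s * d n s) \<le> p ^ n * (\<bar>R r s\<bar> * (\<bar>g s\<bar> + \<kappa>))"
          by (simp add: abs_mult algebra_simps)
      qed
      then show "norm (\<integral>s. norm (R r s * d n s) \<partial>L) \<le> p ^ n * (\<integral>s. \<bar>R r s\<bar> * (\<bar>g s\<bar> + \<kappa>) \<partial>L)"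
        by simp
    qed
  qed
  moreover have "(\<integral>s. (\<Sum>n. R r s * d n s) \<partial>L) = kint L R (neumann_sum L a R g) r"
    unfolding kint_def S_def
  proof (rule Bochner_Integration.integral_cong[OF refl])
    fix s assume "s \<in> space L"
    from suminf_mult[OF summable_rabs_cancel[OF summ[OF this]]]
    show "(\<Sum>n. R r s * d n s) = R r s * (\<Sum>n. d n s)" .
  qed
  ultimately have ksum: "(\<lambda>n. kint L R (d n) r) sums kint L R (neumann_sum L a R g) r"
    by (simp add: kint_def)
  have dsum: "(\<lambda>n. d n r) sums neumann_sum L a R g r"
    unfolding S_def using summable_rabs_cancel[OF summ[OF r]] by (rule summable_sums)
  have "(\<lambda>n. d (Suc n) r) sums (a * neumann_sum L a R g r + kint L R (neumann_sum L a R g) r)"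
    using sums_add[OF sums_mult[OF dsum, of a] ksum] by (simp add: d_def)
  then have "(\<lambda>n. d n r) sums (a * neumann_sum L a R g r + kint L R (neumann_sum L a R g) r + d 0 r)"
    by (rule sums_Suc)
  from sums_unique2[OF dsum this] have
    "neumann_sum L a R g r = a * neumann_sum L a R g r + kint L R (neumann_sum L a R g) r + d 0 r" .
  moreover have "d 0 r = g r" by (simp add: d_def)
  ultimately show
    "neumann_sum L a R g r = g r + a * neumann_sum L a R g r + kint L R (neumann_sum L a R g) r"
    by linarith
qed

subsection \<open>Coercive and Volterra equations\<close>

text \<open>Pairing the equation with \<open>f\<close> itself bounds \<open>2 * lam\<close> times
  the squared norm of \<open>f\<close> by the inner product of \<open>f\<close> and
  \<open>k\<close>; Cauchy-Schwarz does the rest. This yields uniqueness for the coercive equation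
  and a bound on \<open>dual_col\<close> that is uniform in \<open>t\<close>.\<close>

lemma coercive_bound:
  assumes "l2_rows L C S" "finite_measure L" "lam > 0" "l2 L f" "l2 L k"
    and pos: "0 \<le> (\<integral>r. f r * kint L S f r \<partial>L)"
    and eq: "AE r in L. 2 * lam * f r + kint L S f r = k r"
  shows "4 * lam\<^sup>2 * (\<integral>r. (f r)\<^sup>2 \<partial>L) \<le> (\<integral>r. (k r)\<^sup>2 \<partial>L)"
proof -
  let ?F = "\<integral>r. (f r)\<^sup>2 \<partial>L" and ?K = "\<integral>r. (k r)\<^sup>2 \<partial>L"
  have Sf: "l2 L (kint L S f)" by (rule l2_kint) fact+
  have "(\<integral>r. f r * k r \<partial>L) = (\<integral>r. 2 * lam * (f r)\<^sup>2 + f r * kint L S f r \<partial>L)"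
  proof (rule integral_cong_AE)
    show "AE r in L. f r * k r = 2 * lam * (f r)\<^sup>2 + f r * kint L S f r"
      using eq
    proof eventually_elim
      fix r assume "2 * lam * f r + kint L S f r = k r"
      from this[symmetric] show "f r * k r = 2 * lam * (f r)\<^sup>2 + f r * kint L S f r"
        by (simp add: power2_eq_square algebra_simps)
    qed
  qed (use assms Sf in \<open>auto simp: l2_def\<close>)
  also have "\<dots> = 2 * lam * ?F + (\<integral>r. f r * kint L S f r \<partial>L)"
    using l2_mult_integrable[OF assms(4) Sf] l2_square[OF assms(4)] by simp
  finally have "2 * lam * ?F \<le> (\<integral>r. f r * k r \<partial>L)" using pos by simp
  moreover have "0 \<le> 2 * lam * ?F" using \<open>lam > 0\<close> by simp
  ultimately have "(2 * lam * ?F)\<^sup>2 \<le> (\<integral>r. f r * k r \<partial>L)\<^sup>2" by (intro power_mono)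
  also have "\<dots> \<le> ?F * ?K" by (rule l2_cauchy_schwarz) fact+
  finally have le: "?F * (4 * lam\<^sup>2 * ?F) \<le> ?F * ?K" by (simp add: power2_eq_square algebra_simps)
  show ?thesis
  proof (cases "?F = 0")
    case False
    then have "0 < ?F" by (simp add: order_less_le)
    with le show ?thesis by (simp add: mult_le_cancel_left)
  qed simp
qed

lemma l2_null_AE:
  assumes "l2 L f" "(\<integral>r. (f r)\<^sup>2 \<partial>L) \<le> 0"
  shows "AE r in L. f r = 0"
proof -
  have "(\<integral>r. (f r)\<^sup>2 \<partial>L) = 0" using assms(2) by (intro antisym) auto
  then have "AE r in L. (f r)\<^sup>2 = 0"
    using l2_square[OF assms(1)] by (subst (asm) integral_nonneg_eq_0_iff_AE) auto
  then show ?thesis by simp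
qed

lemma l2_rows_cmult:
  assumes "l2_rows L C K" shows "l2_rows L (c\<^sup>2 * C) (\<lambda>t s. c * K t s)"
proof -
  have [measurable]: "(\<lambda>(t, s). K t s) \<in> borel_measurable (L \<Otimes>\<^sub>M L)" by (rule l2_rows_measurable) fact
  have "(\<lambda>(t, s). c * K t s) \<in> borel_measurable (L \<Otimes>\<^sub>M L)" by measurable
  then show ?thesis
    using assms unfolding l2_rows_def by (auto simp: l2_cmult power_mult_distrib mult_left_mono)
qed

lemma kint_kernel_cmult: "kint L (\<lambda>t s. c * K t s) f t = c * kint L K f t"
  by (simp add: kint_def mult.assoc)

text \<open>Richardson iteration \<open>z = z - \<rho> ((2 lam id + S) z - k)\<close>; this \<open>\<rho>\<close> makes it a contraction
  of ratio \<open>C / (4 lam\<^sup>2 + C)\<close> when \<open>C\<close> bounds the squared operator norm of the monotone \<open>S\<close>.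
  The limit is an explicit pointwise series, hence measurable in any parameter.\<close>

definition coercive_inverse ::
    "'b measure \<Rightarrow> real \<Rightarrow> real \<Rightarrow> ('b \<Rightarrow> 'b \<Rightarrow> real) \<Rightarrow> ('b \<Rightarrow> real) \<Rightarrow> 'b \<Rightarrow> real" where
  "coercive_inverse L lam C S k =
     (let \<rho> = 2 * lam / (4 * lam\<^sup>2 + C)
      in neumann_sum L (C / (4 * lam\<^sup>2 + C)) (\<lambda>t s. (- \<rho>) * S t s) (\<lambda>r. \<rho> * k r))"

lemma coercive_inverse:
  assumes fin: "finite_measure L" and S: "l2_rows L C S" and "lam > 0" and k: "l2 L k"
    and C': "C * measure L (space L) \<le> C'" "0 \<le> C'"
    and pos: "\<And>f. l2 L f \<Longrightarrow> 0 \<le> (\<integral>r. f r * kint L S f r \<partial>L)"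
  defines "z \<equiv> coercive_inverse L lam C' S k"
  shows "l2 L z" "\<And>r. r \<in> space L \<Longrightarrow> 2 * lam * z r + kint L S z r = k r"
proof -
  define E where "E = 4 * lam\<^sup>2 + C'"
  have "E > 0" using \<open>lam > 0\<close> C' unfolding E_def by (intro add_pos_nonneg) auto
  define \<rho> where "\<rho> = 2 * lam / E"
  have "\<rho> > 0" using \<open>lam > 0\<close> \<open>E > 0\<close> by (simp add: \<rho>_def)
  define a where "a = C' / E"
  have a: "0 \<le> a" "a < 1" using \<open>lam > 0\<close> \<open>E > 0\<close> C' by (auto simp: a_def E_def)
  have a_eq: "a = 1 - 2 * lam * \<rho>"
    using \<open>E > 0\<close> by (simp add: a_def \<rho>_def field_simps) (simp add: E_def power2_eq_square)
  \<comment> \<open>After the nonnegative cross term is dropped, one step multiplies the squared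
    norm by at most \<open>(1 - 2 lam \<rho>)^2 + \<rho>^2 C'\<close>. The chosen
    \<open>\<rho>\<close> minimises this expression, and the minimum is \<open>a\<close>
    itself.\<close>
  have contr: "a\<^sup>2 + \<rho>\<^sup>2 * C' = a"
  proof -
    have "\<rho>\<^sup>2 * C' = a * (4 * lam\<^sup>2 / E)"
      using \<open>E > 0\<close> by (simp add: a_def \<rho>_def field_simps power2_eq_square)
    also have "4 * lam\<^sup>2 / E = 1 - a"
      using \<open>E > 0\<close> by (simp add: a_def field_simps) (simp add: E_def)
    finally show ?thesis by (simp add: power2_eq_square algebra_simps)
  qed
  define R where "R = (\<lambda>t s. (- \<rho>) * S t s)"
  define g where "g = (\<lambda>r. \<rho> * k r)"
  have z_eq: "z = neumann_sum L a R g"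
    by (simp add: z_def coercive_inverse_def Let_def a_def R_def g_def \<rho>_def E_def)
  have R: "l2_rows L ((- \<rho>)\<^sup>2 * C) R" unfolding R_def by (rule l2_rows_cmult[OF S])
  have g: "l2 L g" unfolding g_def by (rule l2_cmult[OF k])
  define d where "d = neumann_term L a R g"
  have d: "l2 L (d n)" for n unfolding d_def by (rule l2_neumann_term[OF fin R g])
  have decay: "(\<integral>s. (d n s)\<^sup>2 \<partial>L) \<le> (\<integral>s. (d 0 s)\<^sup>2 \<partial>L) * a ^ n" for n
  proof (induction n)
    case (Suc n)
    let ?N = "\<integral>s. (d n s)\<^sup>2 \<partial>L"
    have Sd: "l2 L (kint L S (d n))" by (rule l2_kint[OF fin S d])
    have dS: "d (Suc n) s = a * d n s - \<rho> * kint L S (d n) s" for s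
      using kint_kernel_cmult[of L "- \<rho>" S] by (simp add: d_def R_def)
    have "(\<integral>s. (d (Suc n) s)\<^sup>2 \<partial>L)
        = (\<integral>s. a\<^sup>2 * (d n s)\<^sup>2 - 2 * a * \<rho> * (d n s * kint L S (d n) s) + \<rho>\<^sup>2 * (kint L S (d n) s)\<^sup>2 \<partial>L)"
      unfolding dS
      by (intro Bochner_Integration.integral_cong refl) (simp add: power2_eq_square algebra_simps)
    also have "\<dots> = a\<^sup>2 * ?N - 2 * a * \<rho> * (\<integral>s. d n s * kint L S (d n) s \<partial>L)
        + \<rho>\<^sup>2 * (\<integral>s. (kint L S (d n) s)\<^sup>2 \<partial>L)"
      using l2_mult_integrable[OF d[of n] Sd] l2_square[OF d[of n]] l2_square[OF Sd] by simp
    also have "\<dots> \<le> a\<^sup>2 * ?N + \<rho>\<^sup>2 * (C' * ?N)"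
    proof -
      have "0 \<le> 2 * a * \<rho> * (\<integral>s. d n s * kint L S (d n) s \<partial>L)"
        using a \<open>\<rho> > 0\<close> pos[OF d[of n]] by simp
      moreover have "(\<integral>s. (kint L S (d n) s)\<^sup>2 \<partial>L) \<le> C' * ?N"
        using integral_square_kint_le[OF fin S d[of n]] mult_right_mono[OF C'(1), of ?N] by simp
      then have "\<rho>\<^sup>2 * (\<integral>s. (kint L S (d n) s)\<^sup>2 \<partial>L) \<le> \<rho>\<^sup>2 * (C' * ?N)"
        by (intro mult_left_mono) auto
      ultimately show ?thesis by linarith
    qed
    also have "\<dots> = (a\<^sup>2 + \<rho>\<^sup>2 * C') * ?N" by (simp add: algebra_simps)
    also have "\<dots> = a * ?N" by (simp add: contr)
    also have "\<dots> \<le> a * ((\<integral>s. (d 0 s)\<^sup>2 \<partial>L) * a ^ n)" using Suc a by (intro mult_left_mono)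
    finally show ?case by (simp add: ac_simps)
  qed simp
  have "\<bar>a\<bar> < 1" using a by simp
  note ns = neumann_sum[OF fin R g this a decay[unfolded d_def], folded z_eq]
  show "l2 L z" by (rule ns(1))
  fix r assume "r \<in> space L"
  from ns(2)[OF this] have "z r = \<rho> * k r + (1 - 2 * lam * \<rho>) * z r - \<rho> * kint L S z r"
    using kint_kernel_cmult[of L "- \<rho>" S] by (simp add: R_def g_def a_eq)
  then have "\<rho> * (2 * lam * z r + kint L S z r) = \<rho> * k r" by (simp add: algebra_simps)
  then show "2 * lam * z r + kint L S z r = k r" using \<open>\<rho> > 0\<close> by simp
qed

lemma coercive_inverse_measurable:
  assumes "sigma_finite_measure L"
    and [measurable]: "(\<lambda>(t, r, s). S t r s) \<in> borel_measurable (N \<Otimes>\<^sub>M L \<Otimes>\<^sub>M L)"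
      "(\<lambda>(t, r). k t r) \<in> borel_measurable (N \<Otimes>\<^sub>M L)"
  shows "(\<lambda>(t, r). coercive_inverse L lam C (S t) (k t) r) \<in> borel_measurable (N \<Otimes>\<^sub>M L)"
proof -
  interpret sigma_finite_measure L by fact
  define \<rho> where "\<rho> = 2 * lam / (4 * lam\<^sup>2 + C)"
  define a where "a = C / (4 * lam\<^sup>2 + C)"
  define d where "d n t = neumann_term L a (\<lambda>r s. (- \<rho>) * S t r s) (\<lambda>r. \<rho> * k t r) n" for n t
  have [measurable]: "(\<lambda>(t, r). d n t r) \<in> borel_measurable (N \<Otimes>\<^sub>M L)" for n
  proof (induction n)
    case 0
    then show ?case by (simp add: d_def)
  next
    case (Suc n)
    have [measurable]: "(\<lambda>p. S (fst (fst p)) (snd (fst p)) (snd p)) \<in> borel_measurable ((N \<Otimes>\<^sub>M L) \<Otimes>\<^sub>M L)"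
      using measurable_compose[OF _ assms(2), of "\<lambda>p. (fst (fst p), snd (fst p), snd p)" "(N \<Otimes>\<^sub>M L) \<Otimes>\<^sub>M L"]
      by simp
    have [measurable]: "(\<lambda>p. d n (fst (fst p)) (snd p)) \<in> borel_measurable ((N \<Otimes>\<^sub>M L) \<Otimes>\<^sub>M L)"
      using measurable_compose[OF _ Suc, of "\<lambda>p. (fst (fst p), snd p)" "(N \<Otimes>\<^sub>M L) \<Otimes>\<^sub>M L"] by simp
    note [measurable] = Suc
    have "(\<lambda>(t, r). d (Suc n) t r)
      = (\<lambda>(t, r). a * d n t r + (\<integral>s. (- \<rho>) * S t r s * d n t s \<partial>L))"
      by (simp add: d_def kint_def fun_eq_iff)
    also have "\<dots> \<in> borel_measurable (N \<Otimes>\<^sub>M L)" by measurable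
    finally show ?case .
  qed
  have "(\<lambda>(t, r). coercive_inverse L lam C (S t) (k t) r) = (\<lambda>(t, r). \<Sum>n. d n t r)"
    by (auto simp: coercive_inverse_def neumann_sum_def Let_def d_def a_def \<rho>_def fun_eq_iff)
  also have "\<dots> \<in> borel_measurable (N \<Otimes>\<^sub>M L)" by measurable
  finally show ?thesis .
qed

section \<open>Lebesgue measure on \<open>[0, T]\<close> and Volterra equations\<close>

abbreviation leb :: "real \<Rightarrow> real measure" where
  "leb T \<equiv> restrict_space lborel {0..T}"

lemma space_leb [simp]: "space (leb T) = {0..T}"
  by (simp add: space_restrict_space)

lemma sets_leb [measurable_cong]: "sets (leb T) = sets (restrict_space borel {0..T})"
  by (simp add: sets_restrict_space)

lemma finite_measure_leb: "finite_measure (leb T)"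
  by (intro finite_measureI) (simp add: emeasure_restrict_space emeasure_lborel_Icc_eq)

lemma leb_borel_measurable [measurable (raw)]:
  "f \<in> borel_measurable borel \<Longrightarrow> f \<in> borel_measurable (leb T)"
  by (simp add: measurable_restrict_space1)

lemma L2_iff: "L2 T = l2 (leb T)"
  by (auto simp: fun_eq_iff L2_def l2_def set_borel_measurable_def set_integrable_def
      borel_measurable_restrict_space_iff integrable_restrict_space)

lemma L2_eq_iff: "L2_eq T f g \<longleftrightarrow> (AE s in leb T. f s = g s)"
  by (simp add: L2_eq_def AE_restrict_space_iff)

lemma l2inner_eq: "l2inner T f g = (\<integral>s. f s * g s \<partial>leb T)"
  by (simp add: l2inner_def set_lebesgue_integral_def integral_restrict_space)

lemma kop_eq: "kop T = kint (leb T)"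
  by (simp add: fun_eq_iff kop_def kint_def set_lebesgue_integral_def integral_restrict_space)

lemma exp_integral_le:
  fixes t :: real
  assumes "0 < \<gamma>" "t \<in> {0..T}"
  shows "(\<integral>s. indicator {..t} s * exp (\<gamma> * s) \<partial>leb T) \<le> exp (\<gamma> * t) / \<gamma>"
proof -
  have "(\<integral>s. indicator {..t} s * exp (\<gamma> * s) \<partial>leb T) = (\<integral>s. exp (\<gamma> * s) * indicator {0..t} s \<partial>lborel)"
    unfolding integral_restrict_space[OF , of "{0..T}" lborel, simplified]
    using assms by (intro Bochner_Integration.integral_cong) (auto simp: indicator_def)
  also have "\<dots> = exp (\<gamma> * t) / \<gamma> - exp (\<gamma> * 0) / \<gamma>"
  proof (rule integral_FTC_Icc_real)
    show "0 \<le> t" using assms by simp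
    show "DERIV (\<lambda>s. exp (\<gamma> * s) / \<gamma>) x :> exp (\<gamma> * x)" for x
      using assms by (auto intro!: derivative_eq_intros)
    show "isCont (\<lambda>s. exp (\<gamma> * s)) x" for x by (intro continuous_intros)
  qed
  also have "\<dots> \<le> exp (\<gamma> * t) / \<gamma>" using assms by simp
  finally show ?thesis .
qed

lemma l2_leb_exp: "l2 (leb T) (\<lambda>s. exp (\<gamma> * s))"
proof -
  interpret finite_measure "leb T" by (rule finite_measure_leb)
  have "\<bar>exp (\<gamma> * s)\<bar> \<le> \<bar>exp (\<bar>\<gamma>\<bar> * \<bar>T\<bar>)\<bar>" if "s \<in> {0..T}" for s
  proof -
    have "\<gamma> * s \<le> \<bar>\<gamma>\<bar> * \<bar>s\<bar>" by (metis abs_ge_self abs_mult)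
    also have "\<dots> \<le> \<bar>\<gamma>\<bar> * \<bar>T\<bar>" using that by (intro mult_left_mono) auto
    finally show ?thesis by simp
  qed
  then show ?thesis by (intro l2_bound[OF l2_const[of "exp (\<bar>\<gamma>\<bar> * \<bar>T\<bar>)"]] leb_borel_measurable) auto
qed

text \<open>Picard iteration with an exponential weight: the integral of
  \<open>C * exp (2 * C * s)\<close> over \<open>[0, t]\<close> is at most half of
  \<open>exp (2 * C * t)\<close>, so each iteration gains a factor 1/2 whatever the length
  \<open>T\<close>. The induction runs over the norms truncated to \<open>[0, t]\<close>, which is
  all that a Volterra kernel sees at time \<open>t\<close>.\<close>

lemma volterra_decay:
  assumes B: "l2_rows (leb T) C B" and "C > 0"
    and volterra: "\<And>t s. t \<in> {0..T} \<Longrightarrow> s \<in> {0..T} \<Longrightarrow> t \<le> s \<Longrightarrow> B t s = 0"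
    and g: "l2 (leb T) g"
  shows "(\<integral>s. (neumann_term (leb T) 0 B g n s)\<^sup>2 \<partial>leb T)
    \<le> (\<integral>s. (g s)\<^sup>2 \<partial>leb T) * exp (2 * C * T) * (1 / 2) ^ n"
proof (cases "0 \<le> T")
  case False
  then show ?thesis by (simp add: integral_restrict_space)
next
  case True
  interpret finite_measure "leb T" by (rule finite_measure_leb)
  let ?L = "leb T"
  define d where "d = neumann_term ?L 0 B g"
  have d: "l2 ?L (d n)" for n unfolding d_def by (rule l2_neumann_term[OF finite_measure_leb B g])
  define G where "G = (\<integral>s. (g s)\<^sup>2 \<partial>?L)"
  have "G \<ge> 0" by (simp add: G_def)
  have cut_l2: "l2 ?L (\<lambda>s. indicator {..t} s * d n s)" for n t
    by (rule l2_bound[OF d[of n]]) (use l2_measurable[OF d[of n]] in \<open>auto simp: indicator_def intro!: borel_measurable_times leb_borel_measurable\<close>)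
  have bound: "(\<integral>s. (indicator {..t} s * d n s)\<^sup>2 \<partial>?L) \<le> G * (1 / 2) ^ n * exp (2 * C * t)"
    if "t \<in> {0..T}" for n t
    using that
  proof (induction n arbitrary: t)
    case 0
    have "(\<integral>s. (indicator {..t} s * d 0 s)\<^sup>2 \<partial>?L) \<le> G"
      unfolding G_def d_def neumann_term.simps
      using l2_square[OF cut_l2[of t 0]] l2_square[OF g]
      by (intro integral_mono) (auto simp: d_def indicator_def)
    also have "\<dots> \<le> G * exp (2 * C * t)"
      using \<open>G \<ge> 0\<close> \<open>C > 0\<close> 0 mult_left_mono[of 1 "exp (2 * C * t)" G] by simp
    finally show ?case by simp
  next
    case (Suc n)
    have pt: "(d (Suc n) r)\<^sup>2 \<le> C * (G * (1 / 2) ^ n * exp (2 * C * r))" if r: "r \<in> {0..T}" for r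
    proof -
      have "d (Suc n) r = kint ?L B (\<lambda>s. indicator {..r} s * d n s) r"
        unfolding d_def neumann_term.simps kint_def
        using volterra r by (simp, intro Bochner_Integration.integral_cong) (auto simp: indicator_def)
      then have "(d (Suc n) r)\<^sup>2 \<le> C * (\<integral>s. (indicator {..r} s * d n s)\<^sup>2 \<partial>?L)"
        using kint_square_le[OF B cut_l2] r by simp
      also have "\<dots> \<le> C * (G * (1 / 2) ^ n * exp (2 * C * r))"
        using Suc.IH[OF r] \<open>C > 0\<close> by (intro mult_left_mono) auto
      finally show ?thesis .
    qed
    have "(\<integral>s. (indicator {..t} s * d (Suc n) s)\<^sup>2 \<partial>?L)
      \<le> (\<integral>s. C * G * (1 / 2) ^ n * (indicator {..t} s * exp (2 * C * s)) \<partial>?L)"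
    proof (rule integral_mono)
      show "integrable ?L (\<lambda>s. (indicator {..t} s * d (Suc n) s)\<^sup>2)" by (rule l2_square[OF cut_l2])
      have "integrable ?L (\<lambda>s. indicator {..t} s * exp (2 * C * s))"
        by (intro l2_mult_integrable l2_leb_exp l2_bound[OF l2_const[of 1]]) auto
      then show "integrable ?L (\<lambda>s. C * G * (1 / 2) ^ n * (indicator {..t} s * exp (2 * C * s)))"
        by simp
      show "(indicator {..t} s * d (Suc n) s)\<^sup>2 \<le> C * G * (1 / 2) ^ n * (indicator {..t} s * exp (2 * C * s))"
        if "s \<in> space ?L" for s
        using pt[of s] that by (auto simp: indicator_def mult.assoc)
    qed
    also have "\<dots> = C * G * (1 / 2) ^ n * (\<integral>s. indicator {..t} s * exp (2 * C * s) \<partial>?L)" by simp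
    also have "\<dots> \<le> C * G * (1 / 2) ^ n * (exp (2 * C * t) / (2 * C))"
      using \<open>C > 0\<close> \<open>G \<ge> 0\<close> Suc.prems by (intro mult_left_mono exp_integral_le) auto
    also have "\<dots> = G * (1 / 2) ^ Suc n * exp (2 * C * t)" using \<open>C > 0\<close> by simp
    finally show ?case .
  qed
  have "(\<integral>s. (d n s)\<^sup>2 \<partial>?L) = (\<integral>s. (indicator {..T} s * d n s)\<^sup>2 \<partial>?L)"
    by (intro Bochner_Integration.integral_cong) auto
  also have "\<dots> \<le> G * (1 / 2) ^ n * exp (2 * C * T)" using True by (intro bound) auto
  finally show ?thesis by (simp add: d_def G_def ac_simps)
qed

lemma kint_cong_AE:
  assumes "l2_rows L C K" "t \<in> space L" "f \<in> borel_measurable L" "g \<in> borel_measurable L"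
    "AE s in L. f s = g s"
  shows "kint L K f t = kint L K g t"
  unfolding kint_def
  using assms l2_measurable[OF l2_rows_l2[OF assms(1,2)]] by (intro integral_cong_AE) auto

text \<open>Existence is the Neumann series with \<open>a = 0\<close>. For uniqueness, the
  difference \<open>h\<close> of two solutions satisfies \<open>h = B h\<close> almost everywhere,
  hence coincides almost everywhere with each of its own iterates, whose norms tend to 0.\<close>

lemma op_invertible_id_minus_volterra:
  assumes B: "l2_rows (leb T) C B" and "C > 0"
    and volterra: "\<And>t s. t \<in> {0..T} \<Longrightarrow> s \<in> {0..T} \<Longrightarrow> t \<le> s \<Longrightarrow> B t s = 0"
  shows "op_invertible T (\<lambda>f r. f r - kop T B f r)"
  unfolding op_invertible_def L2_iff L2_eq_iff kop_eq
proof (intro conjI allI impI)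
  let ?L = "leb T"
  note fin = finite_measure_leb[of T]
  show "l2 ?L (\<lambda>r. f r - kint ?L B f r)" if "l2 ?L f" for f
    by (intro l2_diff that l2_kint[OF fin B])
  show "\<exists>f. l2 ?L f \<and> (AE s in ?L. f s - kint ?L B f s = g s)" if g: "l2 ?L g" for g
  proof (intro exI conjI)
    note ns = neumann_sum[OF fin B g _ _ _ volterra_decay[OF B \<open>C > 0\<close> volterra g]]
    show "l2 ?L (neumann_sum ?L 0 B g)" by (rule ns(1)) auto
    have "neumann_sum ?L 0 B g r - kint ?L B (neumann_sum ?L 0 B g) r = g r" if "r \<in> space ?L" for r
    proof -
      have "neumann_sum ?L 0 B g r = g r + 0 * neumann_sum ?L 0 B g r + kint ?L B (neumann_sum ?L 0 B g) r"
        by (rule ns(2)) (use that in auto)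
      then show ?thesis by linarith
    qed
    then show "AE s in ?L. neumann_sum ?L 0 B g s - kint ?L B (neumann_sum ?L 0 B g) s = g s" by auto
  qed
  fix f g assume f: "l2 ?L f" and g: "l2 ?L g"
    and eq: "AE s in ?L. f s - kint ?L B f s = g s - kint ?L B g s"
  define h where "h = (\<lambda>s. f s - g s)"
  have h: "l2 ?L h" unfolding h_def by (intro l2_diff f g)
  have hB: "AE s in ?L. h s = kint ?L B h s"
    using eq AE_space
  proof eventually_elim
    case (elim s)
    have "kint ?L B h s = kint ?L B f s - kint ?L B g s"
      unfolding h_def by (rule kint_diff[OF B f g elim(2)])
    then show ?case using elim(1) by (simp add: h_def)
  qed
  have iter: "AE s in ?L. h s = neumann_term ?L 0 B h n s" for n
  proof (induction n)
    case (Suc n)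
    have "kint ?L B h s = kint ?L B (neumann_term ?L 0 B h n) s" if "s \<in> space ?L" for s
      by (rule kint_cong_AE[OF B that _ _ Suc]) (intro l2_measurable h l2_neumann_term[OF fin B h])+
    note kk = this
    from hB AE_space show ?case
    proof eventually_elim
      case (elim s)
      then show ?case using kk[OF elim(2)] by simp
    qed
  qed simp
  have "(\<integral>s. (h s)\<^sup>2 \<partial>?L) \<le> (\<integral>s. (h s)\<^sup>2 \<partial>?L) * exp (2 * C * T) * (1 / 2) ^ n" for n
  proof -
    have "(\<integral>s. (h s)\<^sup>2 \<partial>?L) = (\<integral>s. (neumann_term ?L 0 B h n s)\<^sup>2 \<partial>?L)"
    proof (rule integral_cong_AE)
      show "AE s in ?L. (h s)\<^sup>2 = (neumann_term ?L 0 B h n s)\<^sup>2"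
        using iter[of n] by eventually_elim simp
    qed (use l2_measurable[OF h] l2_measurable[OF l2_neumann_term[OF fin B h]] in auto)
    then show ?thesis using volterra_decay[OF B \<open>C > 0\<close> volterra h, of n] by simp
  qed
  moreover have "(\<lambda>n. (\<integral>s. (h s)\<^sup>2 \<partial>?L) * exp (2 * C * T) * (1 / 2) ^ n) \<longlonglongrightarrow>
      (\<integral>s. (h s)\<^sup>2 \<partial>?L) * exp (2 * C * T) * 0"
    by (intro tendsto_intros LIMSEQ_realpow_zero) auto
  ultimately have "(\<integral>s. (h s)\<^sup>2 \<partial>?L) \<le> 0"
    by (intro LIMSEQ_le_const[where X = "\<lambda>n. (\<integral>s. (h s)\<^sup>2 \<partial>?L) * exp (2 * C * T) * (1 / 2) ^ n"]) auto
  from l2_null_AE[OF h this] show "AE s in ?L. f s = g s" by (simp add: h_def)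
qed

subsection \<open>Monotone Volterra kernels\<close>

lemma l2_rows_add:
  assumes "l2_rows L C1 K1" "l2_rows L C2 K2"
  shows "l2_rows L (2 * C1 + 2 * C2) (\<lambda>t s. K1 t s + K2 t s)"
  unfolding l2_rows_def
proof (intro conjI ballI)
  note [measurable] = l2_rows_measurable[OF assms(1)] l2_rows_measurable[OF assms(2)]
  show "(\<lambda>(t, s). K1 t s + K2 t s) \<in> borel_measurable (L \<Otimes>\<^sub>M L)" by measurable
  fix t assume t: "t \<in> space L"
  note K1 = l2_rows_l2[OF assms(1) t] and K2 = l2_rows_l2[OF assms(2) t]
  show sum: "l2 L (\<lambda>s. K1 t s + K2 t s)" by (rule l2_add[OF K1 K2])
  have "(\<integral>s. (K1 t s + K2 t s)\<^sup>2 \<partial>L) \<le> (\<integral>s. 2 * (K1 t s)\<^sup>2 + 2 * (K2 t s)\<^sup>2 \<partial>L)"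
  proof (rule integral_mono[OF l2_square[OF sum]])
    show "integrable L (\<lambda>s. 2 * (K1 t s)\<^sup>2 + 2 * (K2 t s)\<^sup>2)"
      using l2_square[OF K1] l2_square[OF K2] by auto
    show "(K1 t s + K2 t s)\<^sup>2 \<le> 2 * (K1 t s)\<^sup>2 + 2 * (K2 t s)\<^sup>2" for s
      using sum_squares_bound[of "K1 t s" "K2 t s"] by (simp add: power2_sum)
  qed
  also have "\<dots> = 2 * (\<integral>s. (K1 t s)\<^sup>2 \<partial>L) + 2 * (\<integral>s. (K2 t s)\<^sup>2 \<partial>L)"
    using l2_square[OF K1] l2_square[OF K2] by simp
  also have "\<dots> \<le> 2 * C1 + 2 * C2"
    using l2_rows_bound[OF assms(1) t] l2_rows_bound[OF assms(2) t] by simp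
  finally show "(\<integral>s. (K1 t s + K2 t s)\<^sup>2 \<partial>L) \<le> 2 * C1 + 2 * C2" .
qed

lemma l2_rows_dominated:
  assumes "l2_rows L C K" "(\<lambda>(t, s). G t s) \<in> borel_measurable (L \<Otimes>\<^sub>M L)"
    "\<And>t s. t \<in> space L \<Longrightarrow> s \<in> space L \<Longrightarrow> \<bar>G t s\<bar> \<le> \<bar>K t s\<bar>"
  shows "l2_rows L C G"
  unfolding l2_rows_def
proof (intro conjI ballI)
  fix t assume t: "t \<in> space L"
  have "G t \<in> borel_measurable L"
    using measurable_compose[OF measurable_Pair1'[OF t] assms(2)] by simp
  then show G: "l2 L (G t)"
    by (rule l2_bound[OF l2_rows_l2[OF assms(1) t]]) (rule assms(3)[OF t])
  have "(\<integral>s. (G t s)\<^sup>2 \<partial>L) \<le> (\<integral>s. (K t s)\<^sup>2 \<partial>L)"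
    using assms(3)[OF t] l2_square[OF G] l2_square[OF l2_rows_l2[OF assms(1) t]]
    by (intro integral_mono) (auto simp: abs_le_square_iff)
  also have "\<dots> \<le> C" by (rule l2_rows_bound[OF assms(1) t])
  finally show "(\<integral>s. (G t s)\<^sup>2 \<partial>L) \<le> C" .
qed fact

lemma l2_rows_const:
  assumes "finite_measure L" shows "l2_rows L (c\<^sup>2 * measure L (space L)) (\<lambda>t s. c)"
proof -
  interpret finite_measure L by fact
  show ?thesis unfolding l2_rows_def by (auto simp: l2_const)
qed

lemma kint_kernel_add:
  assumes "l2_rows L C1 K1" "l2_rows L C2 K2" "l2 L f" "t \<in> space L"
  shows "kint L (\<lambda>t s. K1 t s + K2 t s) f t = kint L K1 f t + kint L K2 f t"
  using kint_integrable[OF assms(1,3,4)] kint_integrable[OF assms(2,3,4)]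
  by (simp add: kint_def distrib_right)

lemma op_inv_L2:
  assumes "op_invertible T A" "L2 T g"
  shows "L2 T (op_inv T A g)" "L2_eq T (A (op_inv T A g)) g"
proof -
  have "\<exists>f. L2 T f \<and> L2_eq T (A f) g" using assms by (auto simp: op_invertible_def)
  from someI_ex[OF this] show "L2 T (op_inv T A g)" "L2_eq T (A (op_inv T A g)) g"
    unfolding op_inv_def by auto
qed

lemma L2_eq_cong: "(\<And>r. r \<in> {0..T} \<Longrightarrow> f r = f' r) \<Longrightarrow> L2_eq T f g \<longleftrightarrow> L2_eq T f' g"
  unfolding L2_eq_def by (intro AE_cong) auto

lemma L2_cong: "(\<And>r. r \<in> {0..T} \<Longrightarrow> f r = f' r) \<Longrightarrow> L2 T f \<longleftrightarrow> L2 T f'"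
  unfolding L2_iff l2_def
  by (intro conj_cong measurable_cong Bochner_Integration.integrable_cong) auto

text \<open>Agreement is asked only for square-integrable \<open>f\<close> and on
  \<open>[0, T]\<close>: \<open>Dbar\<close> matches its single-kernel form only there, because
  splitting the integrals requires integrability.\<close>

lemma op_invertible_cong:
  assumes "\<And>f r. L2 T f \<Longrightarrow> r \<in> {0..T} \<Longrightarrow> A f r = A' f r"
  shows "op_invertible T A \<longleftrightarrow> op_invertible T A'"
proof -
  have eq: "L2_eq T (A f) g \<longleftrightarrow> L2_eq T (A' f) g" if "L2 T f" for f g
    by (rule L2_eq_cong) (rule assms[OF that])
  have eq': "L2_eq T g (A f) \<longleftrightarrow> L2_eq T g (A' f)" if "L2 T f" for f g
    unfolding L2_eq_def using assms[OF that] by (intro AE_cong) auto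
  have L2: "L2 T (A f) \<longleftrightarrow> L2 T (A' f)" if "L2 T f" for f
    by (rule L2_cong) (rule assms[OF that])
  have "(\<forall>f. L2 T f \<longrightarrow> L2 T (A f)) \<longleftrightarrow> (\<forall>f. L2 T f \<longrightarrow> L2 T (A' f))"
    using L2 by blast
  moreover have "(\<exists>f. L2 T f \<and> L2_eq T (A f) g) \<longleftrightarrow> (\<exists>f. L2 T f \<and> L2_eq T (A' f) g)" for g
    using eq by blast
  moreover have "L2_eq T (A f) (A g) \<longleftrightarrow> L2_eq T (A' f) (A' g)" if "L2 T f" "L2 T g" for f g
    using eq[OF that(1), of "A g"] eq'[OF that(2), of "A' f"] by simp
  ultimately show ?thesis unfolding op_invertible_def by simp
qed

text \<open>Rows and columns share one bound, so \<open>K\<close> and its adjoint both act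
  pointwise. Nonnegativity is stated for the form of \<open>K\<close> alone, which is half the
  symmetrised form. The class is closed under sums and nonnegative multiples, which covers
  \<open>Hk\<close>, \<open>Gk\<close> and \<open>Kbar\<close>.\<close>

locale volterra_kernel =
  fixes T C :: real and K :: "real \<Rightarrow> real \<Rightarrow> real"
  assumes rows: "l2_rows (leb T) C K"
    and cols: "l2_rows (leb T) C (\<lambda>s t. K t s)"
    and volterra: "\<And>t s. t \<in> {0..T} \<Longrightarrow> s \<in> {0..T} \<Longrightarrow> t \<le> s \<Longrightarrow> K t s = 0"
    and pos: "\<And>f. l2 (leb T) f \<Longrightarrow> 0 \<le> (\<integral>t. f t * kint (leb T) K f t \<partial>leb T)"
    and C_nonneg: "0 \<le> C"
    and T_pos: "0 < T"

lemma volterra_kernel_add: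
  assumes "volterra_kernel T C1 K1" "volterra_kernel T C2 K2"
  shows "volterra_kernel T (2 * C1 + 2 * C2) (\<lambda>t s. K1 t s + K2 t s)"
proof -
  interpret K1: volterra_kernel T C1 K1 by fact
  interpret K2: volterra_kernel T C2 K2 by fact
  show ?thesis
  proof
    fix f assume f: "l2 (leb T) f"
    have "(\<integral>t. f t * kint (leb T) (\<lambda>t s. K1 t s + K2 t s) f t \<partial>leb T)
      = (\<integral>t. f t * kint (leb T) K1 f t + f t * kint (leb T) K2 f t \<partial>leb T)"
      by (intro Bochner_Integration.integral_cong)
        (auto simp: kint_kernel_add[OF K1.rows K2.rows f] distrib_left)
    also have "\<dots> = (\<integral>t. f t * kint (leb T) K1 f t \<partial>leb T) + (\<integral>t. f t * kint (leb T) K2 f t \<partial>leb T)"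
      by (intro Bochner_Integration.integral_add l2_mult_integrable f
          l2_kint[OF finite_measure_leb K1.rows f] l2_kint[OF finite_measure_leb K2.rows f])
    finally show "0 \<le> (\<integral>t. f t * kint (leb T) (\<lambda>t s. K1 t s + K2 t s) f t \<partial>leb T)"
      using K1.pos[OF f] K2.pos[OF f] by simp
  qed (use K1.C_nonneg K2.C_nonneg K1.T_pos K1.volterra K2.volterra
      l2_rows_add[OF K1.rows K2.rows] l2_rows_add[OF K1.cols K2.cols] in auto)
qed

lemma volterra_kernel_cmult:
  assumes "volterra_kernel T C K" "0 \<le> c"
  shows "volterra_kernel T (c\<^sup>2 * C) (\<lambda>t s. c * K t s)"
proof -
  interpret volterra_kernel T C K by fact
  show ?thesis
  proof
    fix f assume f: "l2 (leb T) f"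
    have "(\<integral>t. f t * kint (leb T) (\<lambda>t s. c * K t s) f t \<partial>leb T)
      = (\<integral>t. c * (f t * kint (leb T) K f t) \<partial>leb T)"
      by (intro Bochner_Integration.integral_cong) (auto simp: kint_kernel_cmult)
    also have "\<dots> = c * (\<integral>t. f t * kint (leb T) K f t \<partial>leb T)" by simp
    finally show "0 \<le> (\<integral>t. f t * kint (leb T) (\<lambda>t s. c * K t s) f t \<partial>leb T)"
      using pos[OF f] assms(2) by simp
  qed (use C_nonneg T_pos volterra l2_rows_cmult[OF rows] l2_rows_cmult[OF cols] in auto)
qed

lemma l2_leb_of_nn_integral_le:
  assumes "f \<in> borel_measurable (leb T)"
    and "(\<integral>\<^sup>+ s. ennreal ((f s)\<^sup>2) * indicator {0..T} s \<partial>lborel) \<le> ennreal c" "0 \<le> c"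
  shows "l2 (leb T) f" "(\<integral>s. (f s)\<^sup>2 \<partial>leb T) \<le> c"
proof -
  have le: "(\<integral>\<^sup>+ s. ennreal ((f s)\<^sup>2) \<partial>leb T) \<le> ennreal c"
    using assms(2) by (simp add: nn_integral_restrict_space)
  have "(\<integral>\<^sup>+ s. ennreal (norm ((f s)\<^sup>2)) \<partial>leb T) < \<infinity>"
    using le by (simp add: le_less_trans)
  then show f: "l2 (leb T) f" using assms(1) by (auto simp: l2_def integrable_iff_bounded)
  then show "(\<integral>s. (f s)\<^sup>2 \<partial>leb T) \<le> c"
    using le assms(3) l2_square[OF f] by (simp add: nn_integral_eq_integral)
qed

lemma volterra_kernel_of_admissible:
  assumes K: "admissible_kernel T K" and "0 < T"
  shows "\<exists>C. volterra_kernel T C K"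
proof -
  let ?L = "leb T"
  have K1: "set_borel_measurable borel ({0..T} \<times> {0..T}) (\<lambda>(t, s). K t s)"
    and K2: "volterra T K" and K3: "nonneg_definite T K"
    using K by (auto simp: admissible_kernel_def)
  obtain C1 where C1: "\<forall>t\<in>{0..T}. (\<integral>\<^sup>+ s. ennreal ((K t s)\<^sup>2) * indicator {0..T} s \<partial>lborel) \<le> ennreal C1"
    using K unfolding admissible_kernel_def by blast
  obtain C2 where C2: "\<forall>s\<in>{0..T}. (\<integral>\<^sup>+ t. ennreal ((K t s)\<^sup>2) * indicator {0..T} t \<partial>lborel) \<le> ennreal C2"
    using K unfolding admissible_kernel_def by blast
  define C where "C = max 0 (max C1 C2)"
  \<comment> \<open>Admissibility gives Borel measurability in the plane, while the operators live
    on the product of restricted spaces; the inclusion of the latter into the former is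
    measurable.\<close>
  have id: "(\<lambda>x. x) \<in> measurable (?L \<Otimes>\<^sub>M ?L) borel"
  proof -
    have id: "(\<lambda>x. x) \<in> borel_measurable ?L" by (rule leb_borel_measurable) simp
    have "(\<lambda>x. (fst x, snd x)) \<in> measurable (?L \<Otimes>\<^sub>M ?L) (borel \<Otimes>\<^sub>M borel)"
      by (intro measurable_Pair measurable_compose[OF measurable_fst id] measurable_compose[OF measurable_snd id])
    then show ?thesis by (simp add: borel_prod)
  qed
  have meas: "(\<lambda>(t, s). K t s) \<in> borel_measurable (?L \<Otimes>\<^sub>M ?L)"
  proof -
    have "(\<lambda>x. indicator ({0..T} \<times> {0..T}) x *\<^sub>R (case x of (t, s) \<Rightarrow> K t s)) \<in> borel_measurable (?L \<Otimes>\<^sub>M ?L)"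
      by (rule measurable_compose[OF id]) (use K1 in \<open>simp add: set_borel_measurable_def\<close>)
    then show ?thesis
      by (rule measurable_cong[THEN iffD1, rotated]) (auto simp: space_pair_measure)
  qed
  have meas': "(\<lambda>(s, t). K t s) \<in> borel_measurable (?L \<Otimes>\<^sub>M ?L)"
    using measurable_compose[OF measurable_pair_swap' meas] by (simp add: case_prod_beta')
  have rows: "l2_rows ?L C K"
    unfolding l2_rows_def
  proof (intro conjI ballI)
    fix t assume t: "t \<in> space ?L"
    have [measurable]: "K t \<in> borel_measurable ?L"
      using measurable_compose[OF measurable_Pair1'[OF t] meas] by simp
    have "ennreal C1 \<le> ennreal C" by (intro ennreal_leI) (simp add: C_def)
    then have "(\<integral>\<^sup>+ s. ennreal ((K t s)\<^sup>2) * indicator {0..T} s \<partial>lborel) \<le> ennreal C"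
      using C1[rule_format, of t] t by (auto intro: order_trans)
    from l2_leb_of_nn_integral_le[OF _ this] show "l2 ?L (K t)" "(\<integral>s. (K t s)\<^sup>2 \<partial>?L) \<le> C"
      by (auto simp: C_def)
  qed (rule meas)
  have cols: "l2_rows ?L C (\<lambda>s t. K t s)"
    unfolding l2_rows_def
  proof (intro conjI ballI)
    fix s assume s: "s \<in> space ?L"
    have [measurable]: "(\<lambda>t. K t s) \<in> borel_measurable ?L"
      using measurable_compose[OF measurable_Pair1'[OF s] meas'] by simp
    have "ennreal C2 \<le> ennreal C" by (intro ennreal_leI) (simp add: C_def)
    then have "(\<integral>\<^sup>+ t. ennreal ((K t s)\<^sup>2) * indicator {0..T} t \<partial>lborel) \<le> ennreal C"
      using C2[rule_format, of s] s by (auto intro: order_trans)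
    from l2_leb_of_nn_integral_le[OF _ this] show "l2 ?L (\<lambda>t. K t s)" "(\<integral>t. (K t s)\<^sup>2 \<partial>?L) \<le> C"
      by (auto simp: C_def)
  qed (rule meas')
  have "volterra_kernel T C K"
  proof
    fix f assume f: "l2 ?L f"
    have "0 \<le> (\<integral>t. (\<integral>s. (K t s + K s t) * f s * f t \<partial>?L) \<partial>?L)"
      using K3 f unfolding nonneg_definite_def L2_iff
      by (simp add: set_lebesgue_integral_def integral_restrict_space)
    also have "\<dots> = (\<integral>t. f t * kint ?L K f t + kint ?L (\<lambda>t s. K s t) f t * f t \<partial>?L)"
    proof (rule Bochner_Integration.integral_cong[OF refl])
      fix t assume "t \<in> space ?L"
      then have "kint ?L (\<lambda>t s. K t s + K s t) f t = kint ?L K f t + kint ?L (\<lambda>t s. K s t) f t"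
        by (rule kint_kernel_add[OF rows cols f])
      moreover have "(\<integral>s. (K t s + K s t) * f s * f t \<partial>?L) = kint ?L (\<lambda>t s. K t s + K s t) f t * f t"
        by (simp add: kint_def)
      ultimately show "(\<integral>s. (K t s + K s t) * f s * f t \<partial>?L)
          = f t * kint ?L K f t + kint ?L (\<lambda>t s. K s t) f t * f t"
        by (simp add: algebra_simps)
    qed
    also have "\<dots> = (\<integral>t. f t * kint ?L K f t \<partial>?L) + (\<integral>t. kint ?L (\<lambda>t s. K s t) f t * f t \<partial>?L)"
      by (intro Bochner_Integration.integral_add l2_mult_integrable f
          l2_kint[OF finite_measure_leb rows] l2_kint[OF finite_measure_leb cols])
    \<comment> \<open>The adjoint has the same quadratic form, so the symmetrised form is twice that
      of \<open>K\<close>.\<close>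
    also have "(\<integral>t. kint ?L (\<lambda>t s. K s t) f t * f t \<partial>?L) = (\<integral>t. f t * kint ?L K f t \<partial>?L)"
      by (rule integral_mult_kint[OF finite_measure_leb rows f f, symmetric])
    finally show "0 \<le> (\<integral>t. f t * kint ?L K f t \<partial>?L)" by simp
  qed (use rows cols K2 \<open>0 < T\<close> in \<open>auto simp: C_def volterra_def\<close>)
  then show ?thesis by blast
qed

section \<open>The symmetrised cut operator, its dual column and the resolvent kernel\<close>

context volterra_kernel
begin

abbreviation "L \<equiv> leb T"

sublocale fin: finite_measure L
  by (rule finite_measure_leb)

text \<open>The kernel of the cut operator plus its adjoint; for \<open>Kbar\<close>, adding
  \<open>2 * lam\<close> times the identity gives \<open>Dbar\<close>, as shown in
  \<open>Dbar_eq\<close>.\<close>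

definition sym_cut :: "real \<Rightarrow> real \<Rightarrow> real \<Rightarrow> real" where
  "sym_cut t = (\<lambda>r s. (if t \<le> s then K r s else 0) + (if t \<le> r then K s r else 0))"

definition tail_col :: "real \<Rightarrow> real \<Rightarrow> real" where
  "tail_col t = (\<lambda>r. if t \<le> r then K r t else 0)"

lemma K_measurable [measurable]: "(\<lambda>x. K (fst x) (snd x)) \<in> borel_measurable (L \<Otimes>\<^sub>M L)"
  using l2_rows_measurable[OF rows] by (simp add: case_prod_beta')

lemma l2_kint_K: "l2 L f \<Longrightarrow> l2 L (kint L K f)"
  by (rule l2_kint[OF finite_measure_leb rows])

lemma l2_kint_adj: "l2 L f \<Longrightarrow> l2 L (kint L (\<lambda>t s. K s t) f)"
  by (rule l2_kint[OF finite_measure_leb cols])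

lemma id_measurable_leb [measurable]: "(\<lambda>x. x) \<in> borel_measurable L"
  by (rule leb_borel_measurable) simp

lemma cut_rows: "l2_rows L C (\<lambda>r s. if t \<le> s then K r s else 0)"
proof (rule l2_rows_dominated[OF rows])
  have "(\<lambda>x. if t \<le> snd x then K (fst x) (snd x) else 0) \<in> borel_measurable (L \<Otimes>\<^sub>M L)"
    by measurable
  then show "(\<lambda>(r, s). if t \<le> s then K r s else 0) \<in> borel_measurable (L \<Otimes>\<^sub>M L)"
    by (simp add: case_prod_beta')
qed auto

lemma K_swap_measurable [measurable]: "(\<lambda>x. K (snd x) (fst x)) \<in> borel_measurable (L \<Otimes>\<^sub>M L)"
  using l2_rows_measurable[OF cols] by (simp add: case_prod_beta')

lemma cut_cols: "l2_rows L C (\<lambda>r s. if t \<le> r then K s r else 0)"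
proof (rule l2_rows_dominated[OF cols])
  have "(\<lambda>x. if t \<le> fst x then K (snd x) (fst x) else 0) \<in> borel_measurable (L \<Otimes>\<^sub>M L)"
    by measurable
  then show "(\<lambda>(r, s). if t \<le> r then K s r else 0) \<in> borel_measurable (L \<Otimes>\<^sub>M L)"
    by (simp add: case_prod_beta')
qed auto

lemma sym_cut_rows: "l2_rows L (4 * C) (sym_cut t)"
  using l2_rows_add[OF cut_rows[of t] cut_cols[of t]] by (simp add: sym_cut_def)

lemma sym_cut_sym: "sym_cut t r s = sym_cut t s r"
  by (simp add: sym_cut_def)

lemma kint_cut: "kint L (\<lambda>r s. if t \<le> s then K r s else 0) f r = kint L K (\<lambda>s. indicator {t..} s * f s) r"
  unfolding kint_def by (intro Bochner_Integration.integral_cong) (auto simp: indicator_def)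

lemma l2_indicator:
  assumes f: "l2 L f" and A: "A \<in> sets borel"
  shows "l2 L (\<lambda>s. indicator A s * f s)"
proof (rule l2_bound[OF f])
  have "(\<lambda>s. indicator A s :: real) \<in> borel_measurable L"
    using A by (intro leb_borel_measurable) simp
  then show "(\<lambda>s. indicator A s * f s) \<in> borel_measurable L"
    using l2_measurable[OF f] by (rule borel_measurable_times)
qed (auto simp: indicator_def)

lemma l2_tail: "l2 L f \<Longrightarrow> l2 L (\<lambda>s. indicator {t..} s * f s)"
  by (rule l2_indicator) auto

text \<open>By the Volterra property the cut operator produces functions vanishing before
  \<open>t\<close>, hence its quadratic form at \<open>f\<close> is that of the uncut
  \<open>K\<close> at \<open>f\<close> restricted to \<open>[t, T]\<close>. The two halves of
  \<open>sym_cut\<close> are adjoint to each other and contribute equally.\<close>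

lemma sym_cut_pos:
  assumes f: "l2 L f"
  shows "0 \<le> (\<integral>r. f r * kint L (sym_cut t) f r \<partial>L)"
proof -
  let ?g = "\<lambda>s. indicator {t..} s * f s"
  let ?K = "\<lambda>r s. if t \<le> s then K r s else 0"
  have g: "l2 L ?g" by (rule l2_tail[OF f])
  note i1 = l2_mult_integrable[OF f l2_kint[OF finite_measure_leb cut_rows f]]
  note i2 = l2_mult_integrable[OF f l2_kint[OF finite_measure_leb cut_cols f]]
  have "(\<integral>r. f r * kint L (sym_cut t) f r \<partial>L)
     = (\<integral>r. f r * kint L ?K f r + f r * kint L (\<lambda>r s. ?K s r) f r \<partial>L)"
    unfolding sym_cut_def
    by (intro Bochner_Integration.integral_cong)
      (auto simp: kint_kernel_add[OF cut_rows cut_cols f] distrib_left)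
  also have "\<dots> = (\<integral>r. f r * kint L ?K f r \<partial>L) + (\<integral>r. f r * kint L (\<lambda>r s. ?K s r) f r \<partial>L)"
    using i1 i2 by (rule Bochner_Integration.integral_add)
  also have "(\<integral>r. f r * kint L (\<lambda>r s. ?K s r) f r \<partial>L) = (\<integral>r. f r * kint L ?K f r \<partial>L)"
    using integral_mult_kint[OF finite_measure_leb cut_rows[of t] f f] by (simp add: mult.commute)
  also have "(\<integral>r. f r * kint L ?K f r \<partial>L) = (\<integral>r. ?g r * kint L K ?g r \<partial>L)"
  proof (rule Bochner_Integration.integral_cong[OF refl])
    fix r assume r: "r \<in> space L"
    have "kint L K ?g r = 0" if "r < t"
    proof -
      have "K r s * ?g s = 0" if "s \<in> space L" for s
        using volterra[of r s] r that \<open>r < t\<close> by (auto simp: indicator_def)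
      then show ?thesis unfolding kint_def
        by (subst Bochner_Integration.integral_cong[OF refl, where g = "\<lambda>_. 0"]) auto
    qed
    then show "f r * kint L ?K f r = ?g r * kint L K ?g r"
      by (auto simp: kint_cut indicator_def)
  qed
  finally show ?thesis using pos[OF g] by simp
qed

lemma l2_col: "t \<in> {0..T} \<Longrightarrow> l2 L (\<lambda>r. K r t)"
  using l2_rows_l2[OF cols] by simp

lemma tail_col_eq: "tail_col t = (\<lambda>r. indicator {t..} r * K r t)"
  by (auto simp: tail_col_def indicator_def)

lemma l2_tail_col: "t \<in> {0..T} \<Longrightarrow> l2 L (tail_col t)"
  unfolding tail_col_eq by (intro l2_tail l2_col)

text \<open>The constant bounds the squared operator norm: rows of \<open>sym_cut t\<close> have
  squared norm at most \<open>4 * C\<close>, and the interval has length \<open>T\<close>.\<close>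

definition dual_col :: "real \<Rightarrow> real \<Rightarrow> real \<Rightarrow> real" where
  "dual_col lam t = coercive_inverse L lam (4 * C * T) (sym_cut t) (tail_col t)"

lemma measure_leb [simp]: "measure L {0..T} = T"
  using T_pos by (simp add: measure_restrict_space)

lemma dual_col:
  assumes "0 < lam" "t \<in> {0..T}"
  shows l2_dual_col: "l2 L (dual_col lam t)"
    and dual_col_eq: "\<And>r. r \<in> {0..T} \<Longrightarrow>
      2 * lam * dual_col lam t r + kint L (sym_cut t) (dual_col lam t) r = tail_col t r"
  using coercive_inverse[OF finite_measure_leb sym_cut_rows assms(1) l2_tail_col[OF assms(2)] _ _ sym_cut_pos,
      of "4 * C * T"] C_nonneg T_pos
  unfolding dual_col_def by (auto simp: mult_ac)

lemma kint_cut_cols_head: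
  assumes "r < t" shows "kint L (\<lambda>r s. if t \<le> r then K s r else 0) f r = 0"
  using assms by (simp add: kint_def)

lemma kint_cut_rows_head:
  assumes "r < t" "r \<in> {0..T}" shows "kint L (\<lambda>r s. if t \<le> s then K r s else 0) f r = 0"
  unfolding kint_def
  by (subst Bochner_Integration.integral_cong[OF refl, where g = "\<lambda>_. 0"])
    (use assms volterra in auto)

text \<open>At \<open>r < t\<close> one half of \<open>sym_cut\<close> is cut away and the other
  vanishes because \<open>K r s = 0\<close> for \<open>s \<ge> t\<close>; the equation reduces to
  \<open>2 * lam * z r = 0\<close>. It is essential that this holds at every such \<open>r\<close>:
  progressive measurability of the test processes does not forgive null sets.\<close>

lemma dual_col_head:
  assumes "0 < lam" "t \<in> {0..T}" "r \<in> {0..T}" "r < t"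
  shows "dual_col lam t r = 0"
proof -
  have "kint L (sym_cut t) (dual_col lam t) r = 0"
    unfolding sym_cut_def
    using kint_kernel_add[OF cut_rows cut_cols l2_dual_col[OF assms(1,2)], of r t t] assms
    by (simp add: kint_cut_cols_head kint_cut_rows_head)
  then show ?thesis using dual_col_eq[OF assms(1,2,3)] assms(1,4) by (simp add: tail_col_def)
qed

lemma dual_col_measurable: "(\<lambda>(t, r). dual_col lam t r) \<in> borel_measurable (L \<Otimes>\<^sub>M L)"
  unfolding dual_col_def
proof (rule coercive_inverse_measurable)
  show "sigma_finite_measure L" by (rule fin.sigma_finite_measure_axioms)
  have [measurable]: "(\<lambda>p. K (fst (snd p)) (snd (snd p))) \<in> borel_measurable (L \<Otimes>\<^sub>M L \<Otimes>\<^sub>M L)"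
    by (rule measurable_compose[OF _ K_measurable, of snd]) simp
  have [measurable]: "(\<lambda>p. K (snd (snd p)) (fst (snd p))) \<in> borel_measurable (L \<Otimes>\<^sub>M L \<Otimes>\<^sub>M L)"
    by (rule measurable_compose[OF _ K_swap_measurable, of snd]) simp
  have "(\<lambda>p. (if fst p \<le> snd (snd p) then K (fst (snd p)) (snd (snd p)) else 0)
      + (if fst p \<le> fst (snd p) then K (snd (snd p)) (fst (snd p)) else 0)) \<in> borel_measurable (L \<Otimes>\<^sub>M L \<Otimes>\<^sub>M L)"
    by measurable
  then show "(\<lambda>(t, r, s). sym_cut t r s) \<in> borel_measurable (L \<Otimes>\<^sub>M L \<Otimes>\<^sub>M L)"
    by (simp add: sym_cut_def case_prod_beta')
  have "(\<lambda>p. if fst p \<le> snd p then K (snd p) (fst p) else 0) \<in> borel_measurable (L \<Otimes>\<^sub>M L)"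
    by measurable
  then show "(\<lambda>(t, r). tail_col t r) \<in> borel_measurable (L \<Otimes>\<^sub>M L)"
    by (simp add: tail_col_def case_prod_beta')
qed

lemma op_invertible_sym_cut:
  assumes "0 < lam"
  shows "op_invertible T (\<lambda>f r. 2 * lam * f r + kint L (sym_cut t) f r)"
  unfolding op_invertible_def L2_iff L2_eq_iff
proof (intro conjI allI impI)
  let ?S = "kint L (sym_cut t)"
  note l2S = l2_kint[OF finite_measure_leb sym_cut_rows]
  show "l2 L (\<lambda>r. 2 * lam * f r + ?S f r)" if "l2 L f" for f
    by (intro l2_add l2_cmult that l2S)
  show "\<exists>f. l2 L f \<and> (AE s in L. 2 * lam * f s + ?S f s = g s)" if g: "l2 L g" for g
  proof -
    have "4 * C * measure L (space L) \<le> 4 * C * T" "0 \<le> 4 * C * T"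
      using C_nonneg T_pos by auto
    note ci = coercive_inverse[OF finite_measure_leb sym_cut_rows[of t] assms g this sym_cut_pos]
    then show ?thesis by (intro exI[of _ "coercive_inverse L lam (4 * C * T) (sym_cut t) g"]) auto
  qed
  fix f g assume f: "l2 L f" and g: "l2 L g"
    and eq: "AE s in L. 2 * lam * f s + ?S f s = 2 * lam * g s + ?S g s"
  define h where "h = (\<lambda>s. f s - g s)"
  have h: "l2 L h" unfolding h_def by (intro l2_diff f g)
  have "AE s in L. 2 * lam * h s + ?S h s = 0"
    using eq AE_space
  proof eventually_elim
    case (elim s)
    then show ?case
      using kint_diff[OF sym_cut_rows[of t] f g elim(2)] by (simp add: h_def algebra_simps)
  qed
  from coercive_bound[OF sym_cut_rows finite_measure_leb assms h l2_zero sym_cut_pos[OF h] this]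
  have "(\<integral>s. (h s)\<^sup>2 \<partial>L) \<le> 0" using assms by (simp add: mult_le_0_iff)
  from l2_null_AE[OF h this] show "AE s in L. f s = g s" by (simp add: h_def)
qed

text \<open>Self-adjointness of \<open>2 lam id + S\<close> moves its inverse from \<open>v\<close>
  to the tail column. Only an almost everywhere solution \<open>y\<close> is asked for, so the
  identity applies to whichever representative \<open>op_inv\<close> chooses.\<close>

lemma integral_tail_col_mult:
  assumes lam: "0 < lam" "t \<in> {0..T}" and y: "l2 L y" and v: "v \<in> borel_measurable L"
    and eq: "AE r in L. 2 * lam * y r + kint L (sym_cut t) y r = v r"
  shows "(\<integral>r. tail_col t r * y r \<partial>L) = (\<integral>r. dual_col lam t r * v r \<partial>L)"
proof -
  let ?z = "dual_col lam t" and ?S = "kint L (sym_cut t)"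
  note z = l2_dual_col[OF lam]
  note l2S = l2_kint[OF finite_measure_leb sym_cut_rows]
  have Szy: "(\<integral>r. ?z r * ?S y r \<partial>L) = (\<integral>r. ?S ?z r * y r \<partial>L)"
  proof -
    have "(\<lambda>r s. sym_cut t s r) = sym_cut t" by (intro ext) (rule sym_cut_sym)
    then show ?thesis using integral_mult_kint[OF finite_measure_leb sym_cut_rows z y, of t] by simp
  qed
  have "(\<integral>r. tail_col t r * y r \<partial>L) = (\<integral>r. 2 * lam * (?z r * y r) + ?S ?z r * y r \<partial>L)"
    using dual_col_eq[OF lam, symmetric]
    by (intro Bochner_Integration.integral_cong) (auto simp: algebra_simps)
  also have "\<dots> = 2 * lam * (\<integral>r. ?z r * y r \<partial>L) + (\<integral>r. ?z r * ?S y r \<partial>L)"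
    using l2_mult_integrable[OF z y] l2_mult_integrable[OF l2S[OF z] y] Szy by simp
  also have "\<dots> = (\<integral>r. 2 * lam * (?z r * y r) + ?z r * ?S y r \<partial>L)"
    using l2_mult_integrable[OF z y] l2_mult_integrable[OF z l2S[OF y]] by simp
  also have "\<dots> = (\<integral>r. ?z r * v r \<partial>L)"
  proof (rule integral_cong_AE)
    show "AE r in L. 2 * lam * (?z r * y r) + ?z r * ?S y r = ?z r * v r"
      using eq
    proof eventually_elim
      fix r assume "2 * lam * y r + ?S y r = v r"
      from this[symmetric] show "2 * lam * (?z r * y r) + ?z r * ?S y r = ?z r * v r"
        by (simp add: algebra_simps)
    qed
  qed (use l2_measurable[OF z] l2_measurable[OF y] l2_measurable[OF l2S[OF y]] v in auto)
  finally show ?thesis .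
qed

text \<open>\<open>Bbar\<close> with the inverse moved to the other factor of the inner product.
  \<open>K r s\<close> carries no cut-off because \<open>dual_col lam t\<close> already vanishes
  before \<open>t\<close>.\<close>

definition volterra_resolvent :: "real \<Rightarrow> real \<Rightarrow> real \<Rightarrow> real" where
  "volterra_resolvent lam t s =
     (if s < t then 1 / (2 * lam) * ((\<integral>r. dual_col lam t r * K r s \<partial>L) - K t s) else 0)"

text \<open>Cauchy-Schwarz bounds the inner product uniformly in both variables:
  \<open>coercive_bound\<close> gives \<open>C / (4 * lam^2)\<close> for the squared norm of the
  dual column, and a column of \<open>K\<close> contributes \<open>C\<close>.\<close>

lemma volterra_resolvent_rows:
  assumes lam: "0 < lam"
  shows "\<exists>C'>0. l2_rows L C' (volterra_resolvent lam)"
proof -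
  let ?I = "\<lambda>t s. \<integral>r. dual_col lam t r * K r s \<partial>L"
  define c where "c = sqrt (C / (4 * lam\<^sup>2) * C)"
  have I_bound: "\<bar>?I t s\<bar> \<le> \<bar>c\<bar>" if t: "t \<in> {0..T}" and s: "s \<in> {0..T}" for t s
  proof -
    have tc: "(\<integral>r. (tail_col t r)\<^sup>2 \<partial>L) \<le> C"
    proof -
      have "(\<integral>r. (tail_col t r)\<^sup>2 \<partial>L) \<le> (\<integral>r. (K r t)\<^sup>2 \<partial>L)"
        using l2_square[OF l2_tail_col[OF t]] l2_square[OF l2_col[OF t]]
        by (intro integral_mono) (auto simp: tail_col_def)
      also have "\<dots> \<le> C" using l2_rows_bound[OF cols, of t] t by simp
      finally show ?thesis .
    qed
    have "4 * lam\<^sup>2 * (\<integral>r. (dual_col lam t r)\<^sup>2 \<partial>L) \<le> (\<integral>r. (tail_col t r)\<^sup>2 \<partial>L)"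
      using dual_col_eq[OF lam t]
      by (intro coercive_bound[OF sym_cut_rows[of t] finite_measure_leb lam] l2_dual_col[OF lam t]
          l2_tail_col[OF t] sym_cut_pos) auto
    with tc lam have z: "(\<integral>r. (dual_col lam t r)\<^sup>2 \<partial>L) \<le> C / (4 * lam\<^sup>2)"
      by (simp add: field_simps)
    have "(?I t s)\<^sup>2 \<le> (\<integral>r. (dual_col lam t r)\<^sup>2 \<partial>L) * (\<integral>r. (K r s)\<^sup>2 \<partial>L)"
      by (rule l2_cauchy_schwarz[OF l2_dual_col[OF lam t] l2_col[OF s]])
    also have "\<dots> \<le> C / (4 * lam\<^sup>2) * C"
      using z l2_rows_bound[OF cols, of s] s C_nonneg by (intro mult_mono) auto
    finally have "sqrt ((?I t s)\<^sup>2) \<le> c" unfolding c_def by (rule real_sqrt_le_mono)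
    then show ?thesis by simp
  qed
  have zK: "(\<lambda>p. dual_col lam (fst (fst p)) (snd p) * K (snd p) (snd (fst p)))
      \<in> borel_measurable ((L \<Otimes>\<^sub>M L) \<Otimes>\<^sub>M L)"
  proof (intro borel_measurable_times)
    show "(\<lambda>p. dual_col lam (fst (fst p)) (snd p)) \<in> borel_measurable ((L \<Otimes>\<^sub>M L) \<Otimes>\<^sub>M L)"
      using measurable_compose[OF _ dual_col_measurable, of "\<lambda>p. (fst (fst p), snd p)" "(L \<Otimes>\<^sub>M L) \<Otimes>\<^sub>M L" lam]
      by simp
    show "(\<lambda>p. K (snd p) (snd (fst p))) \<in> borel_measurable ((L \<Otimes>\<^sub>M L) \<Otimes>\<^sub>M L)"
      using measurable_compose[OF _ K_measurable, of "\<lambda>p. (snd p, snd (fst p))" "(L \<Otimes>\<^sub>M L) \<Otimes>\<^sub>M L"]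
      by simp
  qed
  have I_meas [measurable]: "(\<lambda>x. ?I (fst x) (snd x)) \<in> borel_measurable (L \<Otimes>\<^sub>M L)"
    by (rule fin.borel_measurable_lebesgue_integral) (use zK in \<open>simp add: case_prod_beta'\<close>)
  have I_rows: "l2_rows L (c\<^sup>2 * measure L (space L)) ?I"
    by (rule l2_rows_dominated[OF l2_rows_const[OF finite_measure_leb]])
      (use I_bound I_meas in \<open>auto simp: case_prod_beta'\<close>)
  define C' where "C' = (1 / (2 * lam))\<^sup>2 * (2 * (c\<^sup>2 * measure L (space L)) + 2 * ((- 1)\<^sup>2 * C))"
  have G: "l2_rows L C' (\<lambda>t s. 1 / (2 * lam) * (?I t s + (- 1) * K t s))"
    unfolding C'_def by (intro l2_rows_cmult l2_rows_add I_rows rows)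
  have V: "l2_rows L C' (volterra_resolvent lam)"
  proof (rule l2_rows_dominated[OF G])
    have "(\<lambda>x. if snd x < fst x then 1 / (2 * lam) * (?I (fst x) (snd x) - K (fst x) (snd x)) else 0)
        \<in> borel_measurable (L \<Otimes>\<^sub>M L)"
      by measurable
    then show "(\<lambda>(t, s). volterra_resolvent lam t s) \<in> borel_measurable (L \<Otimes>\<^sub>M L)"
      by (simp add: volterra_resolvent_def case_prod_beta')
  qed (auto simp: volterra_resolvent_def)
  \<comment> \<open>\<open>C'\<close> may be 0, whereas the estimate for Volterra iterates divides
    by the constant; hence the added 1.\<close>
  have "l2_rows L (C' + 1) (volterra_resolvent lam)"
    using V by (force simp: l2_rows_def)
  moreover have "0 \<le> C'" using C_nonneg T_pos by (simp add: C'_def)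
  then have "0 < C' + 1" by simp
  ultimately show ?thesis by blast
qed

lemma volterra_resolvent_volterra: "t \<le> s \<Longrightarrow> volterra_resolvent lam t s = 0"
  by (simp add: volterra_resolvent_def)

text \<open>After moving \<open>K\<close> and its adjoint onto \<open>z\<close>, the factor of
  \<open>m r\<close> is explicit: the column \<open>K r t\<close> from \<open>t\<close> on, by the
  equation for \<open>z\<close>, and \<open>2 * lam * volterra_resolvent lam t r + K t r\<close>
  before \<open>t\<close>. Integrating against \<open>m\<close> turns these into values at time
  \<open>t\<close>.\<close>

lemma integral_dual_col_mult:
  assumes lam: "0 < lam" and t: "t \<in> {0..T}" and m: "l2 L m"
  shows "(\<integral>r. dual_col lam t r * (2 * lam * m r + kint L K m r + kint L (\<lambda>t s. K s t) m r) \<partial>L)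
    = kint L (\<lambda>t s. K s t) m t + 2 * lam * kint L (volterra_resolvent lam) m t + kint L K m t"
proof -
  let ?z = "dual_col lam t" and ?Ka = "\<lambda>t s. K s t"
  note z = l2_dual_col[OF lam t]
  obtain C' where V: "l2_rows L C' (volterra_resolvent lam)" using volterra_resolvent_rows[OF lam] by auto
  have adj: "(\<integral>r. ?z r * kint L K m r \<partial>L) = (\<integral>r. kint L ?Ka ?z r * m r \<partial>L)"
    "(\<integral>r. ?z r * kint L ?Ka m r \<partial>L) = (\<integral>r. kint L K ?z r * m r \<partial>L)"
    using integral_mult_kint[OF finite_measure_leb rows z m] integral_mult_kint[OF finite_measure_leb cols z m]
    by auto
  note ints = l2_mult_integrable[OF z m] l2_mult_integrable[OF z l2_kint_K[OF m]]
    l2_mult_integrable[OF z l2_kint_adj[OF m]]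
    l2_mult_integrable[OF l2_kint_K[OF z] m] l2_mult_integrable[OF l2_kint_adj[OF z] m]
  have tL: "t \<in> space L" using t by simp
  note ints2 = kint_integrable[OF cols m tL] kint_integrable[OF rows m tL] kint_integrable[OF V m tL]
  have "(\<integral>r. ?z r * (2 * lam * m r + kint L K m r + kint L ?Ka m r) \<partial>L)
     = (\<integral>r. 2 * lam * (?z r * m r) + ?z r * kint L K m r + ?z r * kint L ?Ka m r \<partial>L)"
    by (intro Bochner_Integration.integral_cong) (auto simp: algebra_simps)
  also have "\<dots> = 2 * lam * (\<integral>r. ?z r * m r \<partial>L) + (\<integral>r. kint L ?Ka ?z r * m r \<partial>L) + (\<integral>r. kint L K ?z r * m r \<partial>L)"
    using ints by (simp add: adj)
  also have "\<dots> = (\<integral>r. 2 * lam * (?z r * m r) + kint L ?Ka ?z r * m r + kint L K ?z r * m r \<partial>L)"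
    using ints by simp
  also have "\<dots> = (\<integral>r. ?Ka t r * m r + 2 * lam * (volterra_resolvent lam t r * m r) + K t r * m r \<partial>L)"
  proof (rule Bochner_Integration.integral_cong[OF refl])
    fix r assume "r \<in> space L"
    then have r: "r \<in> {0..T}" by simp
    have "2 * lam * ?z r + kint L ?Ka ?z r + kint L K ?z r
      = ?Ka t r + 2 * lam * volterra_resolvent lam t r + K t r"
    proof (cases "t \<le> r")
      case True
      have "kint L (\<lambda>r s. if t \<le> s then K r s else 0) ?z r = kint L K ?z r"
        unfolding kint_def using dual_col_head[OF lam t]
        by (intro Bochner_Integration.integral_cong) auto
      moreover have "kint L (\<lambda>r s. if t \<le> r then K s r else 0) ?z r = kint L ?Ka ?z r"
        using True by (simp add: kint_def)
      ultimately have "kint L (sym_cut t) ?z r = kint L K ?z r + kint L ?Ka ?z r"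
        unfolding sym_cut_def using kint_kernel_add[OF cut_rows cut_cols z, of r t t] r by simp
      then show ?thesis
        using dual_col_eq[OF lam t r] True volterra[OF t r True]
        by (simp add: tail_col_def volterra_resolvent_def)
    next
      case False
      \<comment> \<open>Before \<open>t\<close> only the adjoint term survives, and it is exactly
        the inner product in the definition of the resolvent.\<close>
      have "K r s * ?z s = 0" if "s \<in> space L" for s
        using dual_col_head[OF lam t, of s] volterra[OF r, of s] False that by (cases "s < t") auto
      then have "kint L K ?z r = 0" unfolding kint_def
        by (subst Bochner_Integration.integral_cong[OF refl, where g = "\<lambda>_. 0"]) auto
      then show ?thesis
        using dual_col_head[OF lam t r] volterra[OF r t] False lam
        by (simp add: volterra_resolvent_def kint_def mult.commute)
    qed
    from arg_cong[OF this, of "\<lambda>x. x * m r"]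
    show "2 * lam * (?z r * m r) + kint L ?Ka ?z r * m r + kint L K ?z r * m r
      = ?Ka t r * m r + 2 * lam * (volterra_resolvent lam t r * m r) + K t r * m r"
      by (simp add: algebra_simps)
  qed
  also have "\<dots> = kint L ?Ka m t + 2 * lam * kint L (volterra_resolvent lam) m t + kint L K m t"
    using ints2 by (simp add: kint_def)
  finally show ?thesis .
qed

end

subsection \<open>Continuity of translations and Lebesgue points\<close>

lemma lborel_integral_shift: "(\<integral>x. f (h + x) \<partial>lborel) = (\<integral>x. f x \<partial>lborel)" for f :: "real \<Rightarrow> real"
  using lborel_integral_real_affine[of 1 f h] by simp

lemma lborel_integrable_shift: "integrable lborel f \<Longrightarrow> integrable lborel (\<lambda>x. f (h + x))" for f :: "real \<Rightarrow> real"
  using lborel_integrable_real_affine[of f 1 h] by simp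

lemma integral_shift_diff_le:
  fixes f g :: "real \<Rightarrow> real"
  assumes "integrable lborel f" "integrable lborel g"
  shows "(\<integral>x. \<bar>f (h + x) - f x\<bar> \<partial>lborel)
    \<le> 2 * (\<integral>x. \<bar>f x - g x\<bar> \<partial>lborel) + (\<integral>x. \<bar>g (h + x) - g x\<bar> \<partial>lborel)"
proof -
  note [simp, intro] = assms lborel_integrable_shift[OF assms(1)] lborel_integrable_shift[OF assms(2)]
  have "(\<integral>x. \<bar>f (h + x) - f x\<bar> \<partial>lborel)
    \<le> (\<integral>x. \<bar>f (h + x) - g (h + x)\<bar> + \<bar>f x - g x\<bar> + \<bar>g (h + x) - g x\<bar> \<partial>lborel)"
    by (intro integral_mono) auto
  also have "\<dots> = (\<integral>x. \<bar>f (h + x) - g (h + x)\<bar> \<partial>lborel) + (\<integral>x. \<bar>f x - g x\<bar> \<partial>lborel)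
      + (\<integral>x. \<bar>g (h + x) - g x\<bar> \<partial>lborel)"
    by simp
  also have "(\<integral>x. \<bar>f (h + x) - g (h + x)\<bar> \<partial>lborel) = (\<integral>x. \<bar>f x - g x\<bar> \<partial>lborel)"
    by (rule lborel_integral_shift[of "\<lambda>x. \<bar>f x - g x\<bar>"])
  finally show ?thesis by simp
qed

text \<open>Translation preserves the \<open>L1\<close> norm, so replacing \<open>f\<close> by
  \<open>g\<close> costs twice the approximation error, uniformly in the shift.\<close>

lemma shift_continuous_approx:
  fixes f :: "real \<Rightarrow> real"
  assumes f: "integrable lborel f"
    and approx: "\<And>e. 0 < e \<Longrightarrow> \<exists>g. integrable lborel g \<and> (\<integral>x. \<bar>f x - g x\<bar> \<partial>lborel) < e
      \<and> (\<lambda>n. \<integral>x. \<bar>g (h n + x) - g x\<bar> \<partial>lborel) \<longlonglongrightarrow> 0"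
  shows "(\<lambda>n. \<integral>x. \<bar>f (h n + x) - f x\<bar> \<partial>lborel) \<longlonglongrightarrow> 0"
proof (rule order_tendstoI)
  fix a :: real assume "a < 0"
  moreover have "0 \<le> (\<integral>x. \<bar>f (h n + x) - f x\<bar> \<partial>lborel)" for n by simp
  ultimately show "\<forall>\<^sub>F n in sequentially. a < (\<integral>x. \<bar>f (h n + x) - f x\<bar> \<partial>lborel)"
    by (intro always_eventually allI) (rule less_le_trans)
next
  fix a :: real assume "0 < a"
  then obtain g where g: "integrable lborel g" "(\<integral>x. \<bar>f x - g x\<bar> \<partial>lborel) < a / 4"
    "(\<lambda>n. \<integral>x. \<bar>g (h n + x) - g x\<bar> \<partial>lborel) \<longlonglongrightarrow> 0"
    using approx[of "a / 4"] by auto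
  have "\<forall>\<^sub>F n in sequentially. (\<integral>x. \<bar>g (h n + x) - g x\<bar> \<partial>lborel) < a / 2"
    using g(3) \<open>0 < a\<close> by (intro order_tendstoD) auto
  then show "\<forall>\<^sub>F n in sequentially. (\<integral>x. \<bar>f (h n + x) - f x\<bar> \<partial>lborel) < a"
  proof eventually_elim
    case (elim n)
    then show ?case using integral_shift_diff_le[OF f g(1), of "h n"] g(2) by simp
  qed
qed

text \<open>A set and its translate have equal measure, so the symmetric difference is twice the
  part of \<open>U\<close> that the shift throws out of \<open>U\<close>. That part disappears
  pointwise because \<open>U\<close> is open; boundary points, which may have positive measure,
  never enter.\<close>

lemma shift_continuous_open:
  fixes U :: "real set"
  assumes U: "open U" "emeasure lborel U < \<infinity>" and h: "h \<longlonglongrightarrow> 0"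
  shows "(\<lambda>n. \<integral>x. \<bar>indicator U (h n + x) - indicator U x :: real\<bar> \<partial>lborel) \<longlonglongrightarrow> 0"
proof -
  let ?f = "indicator U :: real \<Rightarrow> real"
  have [measurable]: "U \<in> sets borel" using U(1) by simp
  have f: "integrable lborel ?f" using U by simp
  have fh: "integrable lborel (\<lambda>x. ?f (h n + x))" for n by (rule lborel_integrable_shift[OF f])
  have ff: "integrable lborel (\<lambda>x. ?f x * ?f (h n + x))" for n
    by (rule Bochner_Integration.integrable_bound[OF f]) (auto simp: indicator_def)
  have eq: "(\<integral>x. \<bar>?f (h n + x) - ?f x\<bar> \<partial>lborel) = 2 * (\<integral>x. ?f x - ?f x * ?f (h n + x) \<partial>lborel)" for n
  proof -
    have "(\<integral>x. \<bar>?f (h n + x) - ?f x\<bar> \<partial>lborel)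
      = (\<integral>x. 2 * (?f x - ?f x * ?f (h n + x)) + (?f (h n + x) - ?f x) \<partial>lborel)"
      by (intro Bochner_Integration.integral_cong) (auto simp: indicator_def)
    also have "\<dots> = 2 * (\<integral>x. ?f x - ?f x * ?f (h n + x) \<partial>lborel)"
      using f ff[of n] fh[of n] lborel_integral_shift[of ?f "h n"] by simp
    finally show ?thesis .
  qed
  have "(\<lambda>n. \<integral>x. ?f x - ?f x * ?f (h n + x) \<partial>lborel) \<longlonglongrightarrow> (\<integral>x. 0 \<partial>(lborel :: real measure))"
  proof (rule integral_dominated_convergence[where w = ?f])
    show "AE x in lborel. norm (?f x - ?f x * ?f (h n + x)) \<le> ?f x" for n
      by (auto simp: indicator_def)
    show "AE x in lborel. (\<lambda>n. ?f x - ?f x * ?f (h n + x)) \<longlonglongrightarrow> 0"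
    proof (rule AE_I2)
      fix x :: real
      show "(\<lambda>n. ?f x - ?f x * ?f (h n + x)) \<longlonglongrightarrow> 0"
      proof (cases "x \<in> U")
        case True
        have "(\<lambda>n. h n + x) \<longlonglongrightarrow> 0 + x" by (intro tendsto_intros h)
        then have "\<forall>\<^sub>F n in sequentially. h n + x \<in> U"
          using True U(1) by (intro topological_tendstoD) auto
        then have "\<forall>\<^sub>F n in sequentially. ?f x - ?f x * ?f (h n + x) = 0"
          by eventually_elim (use True in auto)
        then show ?thesis by (rule tendsto_eventually)
      qed simp
    qed
  qed (use f in auto)
  then have "(\<lambda>n. 2 * (\<integral>x. ?f x - ?f x * ?f (h n + x) \<partial>lborel)) \<longlonglongrightarrow> 2 * 0"
    by (intro tendsto_intros) simp
  then show ?thesis by (simp add: eq)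
qed

theorem shift_continuous:
  fixes f :: "real \<Rightarrow> real"
  assumes "integrable lborel f" and h: "h \<longlonglongrightarrow> 0"
  shows "(\<lambda>n. \<integral>x. \<bar>f (h n + x) - f x\<bar> \<partial>lborel) \<longlonglongrightarrow> 0"
  using assms(1)
proof (induction rule: integrable_induct)
  case (base A c)
  then have [measurable]: "A \<in> sets borel" by simp
  let ?f = "indicator A :: real \<Rightarrow> real"
  have f: "integrable lborel ?f" using base by simp
  have "(\<lambda>n. \<integral>x. \<bar>?f (h n + x) - ?f x\<bar> \<partial>lborel) \<longlonglongrightarrow> 0"
  proof (rule shift_continuous_approx[OF f])
    fix e :: real assume "0 < e"
    obtain U where U: "open U" "A \<subseteq> U" "emeasure lborel (U - A) < e"
      using outer_regular_lborel[OF \<open>A \<in> sets borel\<close> \<open>0 < e\<close>] by auto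
    have [measurable]: "U \<in> sets borel" using U by simp
    have "emeasure lborel U = emeasure lborel A + emeasure lborel (U - A)"
      using U(2) by (subst plus_emeasure) (auto intro!: arg_cong[where f = "emeasure lborel"])
    also have "\<dots> < \<infinity>" using U(3) base(2) by (auto simp: less_top[symmetric] top_unique)
    finally have Ufin: "emeasure lborel U < \<infinity>" .
    have "(\<integral>x. \<bar>?f x - indicator U x\<bar> \<partial>lborel) = (\<integral>x. indicator (U - A) x \<partial>lborel)"
      using U(2) by (intro Bochner_Integration.integral_cong) (auto simp: indicator_def)
    also have "\<dots> = measure lborel (U - A)" by simp
    also have "\<dots> < e"
    proof -
      have "emeasure lborel (U - A) \<noteq> \<infinity>" using U(3) by auto
      then show ?thesis using U(3) by (simp add: emeasure_eq_ennreal_measure ennreal_less_iff)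
    qed
    finally show "\<exists>g. integrable lborel g \<and> (\<integral>x. \<bar>?f x - g x\<bar> \<partial>lborel) < e
      \<and> (\<lambda>n. \<integral>x. \<bar>g (h n + x) - g x\<bar> \<partial>lborel) \<longlonglongrightarrow> 0"
      using shift_continuous_open[OF U(1) Ufin h] Ufin
      by (intro exI[of _ "indicator U"]) auto
  qed
  then have "(\<lambda>n. \<bar>c\<bar> * (\<integral>x. \<bar>?f (h n + x) - ?f x\<bar> \<partial>lborel)) \<longlonglongrightarrow> \<bar>c\<bar> * 0"
    by (intro tendsto_intros)
  moreover have "\<bar>c\<bar> * (\<integral>x. \<bar>?f (h n + x) - ?f x\<bar> \<partial>lborel)
      = (\<integral>x. \<bar>?f (h n + x) *\<^sub>R c - ?f x *\<^sub>R c\<bar> \<partial>lborel)" for n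
  proof -
    have "\<bar>c\<bar> * (\<integral>x. \<bar>?f (h n + x) - ?f x\<bar> \<partial>lborel) = (\<integral>x. \<bar>c\<bar> * \<bar>?f (h n + x) - ?f x\<bar> \<partial>lborel)"
      by simp
    also have "\<dots> = (\<integral>x. \<bar>?f (h n + x) *\<^sub>R c - ?f x *\<^sub>R c\<bar> \<partial>lborel)"
      by (intro Bochner_Integration.integral_cong) (auto simp: abs_mult[symmetric] algebra_simps)
    finally show ?thesis .
  qed
  ultimately show ?case by simp
next
  case (add f g)
  show ?case
  proof (rule tendsto_sandwich[where f = "\<lambda>_. 0"])
    show "(\<lambda>n. (\<integral>x. \<bar>f (h n + x) - f x\<bar> \<partial>lborel) + (\<integral>x. \<bar>g (h n + x) - g x\<bar> \<partial>lborel)) \<longlonglongrightarrow> 0"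
      using tendsto_add[OF add.IH] by simp
    have "(\<integral>x. \<bar>f (h n + x) + g (h n + x) - (f x + g x)\<bar> \<partial>lborel)
      \<le> (\<integral>x. \<bar>f (h n + x) - f x\<bar> + \<bar>g (h n + x) - g x\<bar> \<partial>lborel)" for n
      using add.hyps lborel_integrable_shift[of f "h n"] lborel_integrable_shift[of g "h n"]
      by (intro integral_mono) auto
    also have "(\<integral>x. \<bar>f (h n + x) - f x\<bar> + \<bar>g (h n + x) - g x\<bar> \<partial>lborel)
      = (\<integral>x. \<bar>f (h n + x) - f x\<bar> \<partial>lborel) + (\<integral>x. \<bar>g (h n + x) - g x\<bar> \<partial>lborel)" for n
      using add.hyps lborel_integrable_shift[of f "h n"] lborel_integrable_shift[of g "h n"] by simp
    finally show "\<forall>\<^sub>F n in sequentially. (\<integral>x. \<bar>f (h n + x) + g (h n + x) - (f x + g x)\<bar> \<partial>lborel)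
      \<le> (\<integral>x. \<bar>f (h n + x) - f x\<bar> \<partial>lborel) + (\<integral>x. \<bar>g (h n + x) - g x\<bar> \<partial>lborel)"
      by simp
  qed auto
next
  case (lim f s)
  show ?case
  proof (rule shift_continuous_approx)
    show "integrable lborel f" by fact
    fix e :: real assume "0 < e"
    have "(\<lambda>i. \<integral>x. \<bar>f x - s i x\<bar> \<partial>lborel) \<longlonglongrightarrow> (\<integral>x. 0 \<partial>(lborel :: real measure))"
    proof (rule integral_dominated_convergence[where w = "\<lambda>x. 3 * \<bar>f x\<bar>"])
      show "AE x in lborel. norm \<bar>f x - s i x\<bar> \<le> 3 * \<bar>f x\<bar>" for i
      proof (rule AE_I2)
        fix x :: real
        show "norm \<bar>f x - s i x\<bar> \<le> 3 * \<bar>f x\<bar>" using lim.hyps(3)[of x i] by simp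
      qed
      show "AE x in lborel. (\<lambda>i. \<bar>f x - s i x\<bar>) \<longlonglongrightarrow> 0"
      proof (rule AE_I2)
        fix x :: real
        have "(\<lambda>i. \<bar>f x - s i x\<bar>) \<longlonglongrightarrow> \<bar>f x - f x\<bar>" by (intro tendsto_intros lim.hyps(2)) simp
        then show "(\<lambda>i. \<bar>f x - s i x\<bar>) \<longlonglongrightarrow> 0" by simp
      qed
    qed (use lim.hyps(1,4) in auto)
    then have "\<forall>\<^sub>F i in sequentially. (\<integral>x. \<bar>f x - s i x\<bar> \<partial>lborel) < e"
      using \<open>0 < e\<close> by (intro order_tendstoD) auto
    then obtain i where "(\<integral>x. \<bar>f x - s i x\<bar> \<partial>lborel) < e"
      by (auto simp: eventually_sequentially)
    then show "\<exists>g. integrable lborel g \<and> (\<integral>x. \<bar>f x - g x\<bar> \<partial>lborel) < e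
      \<and> (\<lambda>n. \<integral>x. \<bar>g (h n + x) - g x\<bar> \<partial>lborel) \<longlonglongrightarrow> 0"
      using lim.hyps(1) lim.IH by blast
  qed
qed

section \<open>Lebesgue points of functions with values in \<open>L1\<close> of the sample
  space\<close>

lemma integrable_snd_pair:
  fixes f :: "'b \<Rightarrow> real"
  assumes "finite_measure M1" "sigma_finite_measure M2" and f: "integrable M2 f"
  shows "integrable (M1 \<Otimes>\<^sub>M M2) (\<lambda>p. f (snd p))"
    and "(\<integral>p. f (snd p) \<partial>(M1 \<Otimes>\<^sub>M M2)) = measure M1 (space M1) * (\<integral>y. f y \<partial>M2)"
proof -
  interpret M1: finite_measure M1 by fact
  interpret M2: sigma_finite_measure M2 by fact
  interpret P: pair_sigma_finite M1 M2 ..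
  have [measurable]: "f \<in> borel_measurable M2" using f by simp
  show int: "integrable (M1 \<Otimes>\<^sub>M M2) (\<lambda>p. f (snd p))"
    by (rule P.Fubini_integrable) (use f in auto)
  show "(\<integral>p. f (snd p) \<partial>(M1 \<Otimes>\<^sub>M M2)) = measure M1 (space M1) * (\<integral>y. f y \<partial>M2)"
    using P.integral_fst'[OF int] by simp
qed

text \<open>A Lebesgue differentiation statement for \<open>t \<mapsto> \<Theta> (t, \<cdot>)\<close> with values in \<open>L\<^sup>1 M\<close>; the averages over
  \<open>[t, t + h]\<close> are parametrised by \<open>[0, 1]\<close>, and convergence along one subsequence suffices.\<close>

lemma AE_forward_averages:
  fixes \<Theta> :: "real \<times> 'a \<Rightarrow> real"
  assumes "prob_space M" and \<Theta>: "integrable (lborel \<Otimes>\<^sub>M M) \<Theta>"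
  shows "\<exists>h. (\<forall>n. 0 < h n) \<and> (AE t in lborel.
    (\<forall>n. integrable (leb 1 \<Otimes>\<^sub>M M) (\<lambda>(r, \<omega>). \<Theta> (h n * r + t, \<omega>) - \<Theta> (t, \<omega>))) \<and>
    (\<lambda>n. \<integral>(r, \<omega>). \<bar>\<Theta> (h n * r + t, \<omega>) - \<Theta> (t, \<omega>)\<bar> \<partial>(leb 1 \<Otimes>\<^sub>M M)) \<longlonglongrightarrow> 0)"
proof -
  interpret M: prob_space M by fact
  interpret I: finite_measure "leb 1" by (rule finite_measure_leb)
  interpret IM: pair_sigma_finite "leb 1" M ..
  interpret IM': sigma_finite_measure "leb 1 \<Otimes>\<^sub>M M" by (rule IM.P.sigma_finite_measure_axioms)
  interpret P: pair_sigma_finite lborel M ..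
  interpret Q: pair_sigma_finite "leb 1 \<Otimes>\<^sub>M M" "lborel :: real measure" ..
  interpret Q': pair_sigma_finite "lborel :: real measure" "leb 1 \<Otimes>\<^sub>M M" ..
  let ?M' = "leb 1 \<Otimes>\<^sub>M M"
  define h where "h n = 1 / real (Suc n)" for n
  have h0: "h \<longlonglongrightarrow> 0" unfolding h_def by real_asymp
  have hpos: "0 < h n" for n by (simp add: h_def)
  have [measurable]: "\<Theta> \<in> borel_measurable (borel \<Otimes>\<^sub>M M)"
    using borel_measurable_integrable[OF \<Theta>] by (simp cong: measurable_cong_sets sets_pair_measure_cong)
  have idI [measurable]: "(\<lambda>x. x) \<in> borel_measurable (leb 1)" by (rule leb_borel_measurable) simp
  define w where "w \<omega> = (\<integral>t. \<bar>\<Theta> (t, \<omega>)\<bar> \<partial>lborel)" for \<omega>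
  have "integrable (lborel \<Otimes>\<^sub>M M) (\<lambda>p. \<bar>\<Theta> p\<bar>)" using \<Theta> by simp
  from P.integrable_snd[of "\<lambda>t \<omega>. \<bar>\<Theta> (t, \<omega>)\<bar>"] this have w: "integrable M w"
    by (simp add: w_def[abs_def] case_prod_beta')
  have sect: "AE \<omega> in M. integrable lborel (\<lambda>t. \<Theta> (t, \<omega>))"
    using P.AE_integrable_snd[of "\<lambda>t \<omega>. \<Theta> (t, \<omega>)"] \<Theta> by (simp add: case_prod_beta')
  have sect': "AE p in ?M'. integrable lborel (\<lambda>t. \<Theta> (t, snd p))"
    by (rule IM.AE_pair_measure) (use sect in auto)
  define g where "g n p t = \<Theta> (h n * fst p + t, snd p) - \<Theta> (t, snd p)" for n and p :: "real \<times> 'a" and t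
  have fstm [measurable]: "fst \<in> borel_measurable ?M'"
    using measurable_compose[OF measurable_fst idI] by simp
  have g_meas [measurable]: "(\<lambda>(p, t). g n p t) \<in> borel_measurable (?M' \<Otimes>\<^sub>M lborel)" for n
    unfolding g_def by measurable
  have g_int: "AE p in ?M'. integrable lborel (g n p) \<and> (\<integral>t. \<bar>g n p t\<bar> \<partial>lborel) \<le> 2 * w (snd p)" for n
    using sect'
  proof eventually_elim
    case (elim p)
    note sh = lborel_integrable_shift[OF elim, of "h n * fst p"]
    have "(\<integral>t. \<bar>g n p t\<bar> \<partial>lborel)
      \<le> (\<integral>t. \<bar>\<Theta> (h n * fst p + t, snd p)\<bar> + \<bar>\<Theta> (t, snd p)\<bar> \<partial>lborel)"
      unfolding g_def using elim sh by (intro integral_mono) auto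
    also have "\<dots> = (\<integral>t. \<bar>\<Theta> (h n * fst p + t, snd p)\<bar> \<partial>lborel) + w (snd p)"
      unfolding w_def using elim sh by simp
    also have "(\<integral>t. \<bar>\<Theta> (h n * fst p + t, snd p)\<bar> \<partial>lborel) = w (snd p)"
      unfolding w_def by (rule lborel_integral_shift[of "\<lambda>t. \<bar>\<Theta> (t, snd p)\<bar>"])
    finally show ?case using elim sh by (simp add: g_def[abs_def])
  qed
  have w2: "integrable ?M' (\<lambda>p. 2 * w (snd p))"
    using integrable_snd_pair(1)[OF I.finite_measure_axioms M.sigma_finite_measure_axioms w] by simp
  have gQ: "integrable (?M' \<Otimes>\<^sub>M lborel) (\<lambda>(p, t). g n p t)" for n
  proof (rule Q.Fubini_integrable)
    show "integrable ?M' (\<lambda>p. \<integral>t. norm (case (p, t) of (p, t) \<Rightarrow> g n p t) \<partial>lborel)"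
    proof (rule Bochner_Integration.integrable_bound[OF w2])
      show "(\<lambda>p. \<integral>t. norm (case (p, t) of (p, t) \<Rightarrow> g n p t) \<partial>lborel) \<in> borel_measurable ?M'" by measurable
      show "AE p in ?M'. norm (\<integral>t. norm (case (p, t) of (p, t) \<Rightarrow> g n p t) \<partial>lborel) \<le> norm (2 * w (snd p))"
        using g_int[of n] by eventually_elim auto
    qed
    show "AE p in ?M'. integrable lborel (\<lambda>t. case (p, t) of (p, t) \<Rightarrow> g n p t)"
      using g_int[of n] by eventually_elim auto
  qed measurable
  have gQ': "integrable (lborel \<Otimes>\<^sub>M ?M') (\<lambda>(t, p). g n p t)" for n
    using Q.integrable_product_swap[OF gQ[of n]] by (simp add: case_prod_beta')
  define e where "e n t = (\<integral>p. \<bar>g n p t\<bar> \<partial>?M')" for n t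
  have e_int: "integrable lborel (e n)" for n
    unfolding e_def[abs_def] using Q'.integrable_fst'[OF integrable_abs[OF gQ'[of n]]] by simp
  \<comment> \<open>For a fixed pair \<open>p\<close> this is continuity of translations along
    \<open>h n * fst p\<close>, dominated by \<open>2 * w\<close>. Exchanging the integrals shows
    that \<open>e n\<close> tends to 0 in \<open>L1\<close> over \<open>t\<close>, hence almost
    everywhere along a subsequence.\<close>
  have "(\<lambda>n. \<integral>p. (\<integral>t. \<bar>g n p t\<bar> \<partial>lborel) \<partial>?M') \<longlonglongrightarrow> (\<integral>p. 0 \<partial>?M')"
  proof (rule integral_dominated_convergence[OF _ _ w2])
    show "AE p in ?M'. norm (\<integral>t. \<bar>g n p t\<bar> \<partial>lborel) \<le> 2 * w (snd p)" for n
      using g_int[of n] by eventually_elim auto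
    show "AE p in ?M'. (\<lambda>n. \<integral>t. \<bar>g n p t\<bar> \<partial>lborel) \<longlonglongrightarrow> 0"
      using sect'
    proof eventually_elim
      case (elim p)
      have "(\<lambda>n. h n * fst p) \<longlonglongrightarrow> 0 * fst p" by (intro tendsto_intros h0)
      then show ?case unfolding g_def using shift_continuous[OF elim, of "\<lambda>n. h n * fst p"] by simp
    qed
    show "(\<lambda>p. \<integral>t. \<bar>g n p t\<bar> \<partial>lborel) \<in> borel_measurable ?M'" for n by measurable
  qed simp
  moreover have "(\<integral>p. (\<integral>t. \<bar>g n p t\<bar> \<partial>lborel) \<partial>?M') = (\<integral>t. norm (e n t) \<partial>lborel)" for n
    using Q'.Fubini_integral[of "\<lambda>t p. \<bar>g n p t\<bar>"] integrable_abs[OF gQ'[of n]]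
    by (simp add: e_def case_prod_beta')
  ultimately have "(\<lambda>n. \<integral>t. norm (e n t) \<partial>lborel) \<longlonglongrightarrow> 0" by simp
  from tendsto_L1_AE_subseq[OF e_int this] obtain k where k: "strict_mono k"
    "AE t in lborel. (\<lambda>n. e (k n) t) \<longlonglongrightarrow> 0" by auto
  have "AE t in lborel. \<forall>n. integrable ?M' (\<lambda>p. g n p t)"
    using Q'.AE_integrable_fst'[OF gQ'] by (simp add: AE_all_countable)
  with k(2) have "AE t in lborel. (\<forall>n. integrable ?M' (\<lambda>p. g (k n) p t)) \<and> (\<lambda>n. e (k n) t) \<longlonglongrightarrow> 0"
    by eventually_elim auto
  then show ?thesis
    using hpos by (intro exI[of _ "\<lambda>n. h (k n)"]) (auto simp: g_def e_def case_prod_beta')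
qed

text \<open>The family \<open>\<A> t\<close> may be uncountable and changes with \<open>t\<close>,
  so discarding a null set of times for each event separately does not work. At a Lebesgue point in
  \<open>L1\<close> the averages, which vanish by \<open>orth\<close>, differ from the value at
  \<open>t\<close> by at most the \<open>L1\<close> distance, whatever \<open>A\<close> is.\<close>

lemma AE_section_orthogonal:
  fixes \<Theta> :: "real \<times> 'a \<Rightarrow> real"
  assumes "prob_space M" and \<Theta>: "integrable (lborel \<Otimes>\<^sub>M M) \<Theta>"
    and sub: "\<And>t. t \<in> S \<Longrightarrow> \<A> t \<subseteq> sets M"
    and orth: "\<And>t h A. t \<in> S \<Longrightarrow> 0 < h \<Longrightarrow> A \<in> \<A> t \<Longrightarrow>
      (\<integral>\<omega>. (\<integral>s. indicator A \<omega> * (indicator {t..t + h} s * \<Theta> (s, \<omega>)) \<partial>lborel) \<partial>M) = 0"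
  shows "AE t in lborel. t \<in> S \<longrightarrow> (\<forall>A\<in>\<A> t. (\<integral>\<omega>. indicator A \<omega> * \<Theta> (t, \<omega>) \<partial>M) = 0)"
proof -
  interpret M: prob_space M by fact
  interpret I: finite_measure "leb 1" by (rule finite_measure_leb)
  interpret IM: pair_sigma_finite "leb 1" M ..
  interpret P: pair_sigma_finite lborel M ..
  let ?M' = "leb 1 \<Otimes>\<^sub>M M"
  obtain h where h: "\<And>n. 0 < h n" and good: "AE t in lborel.
    (\<forall>n. integrable ?M' (\<lambda>(r, \<omega>). \<Theta> (h n * r + t, \<omega>) - \<Theta> (t, \<omega>))) \<and>
    (\<lambda>n. \<integral>(r, \<omega>). \<bar>\<Theta> (h n * r + t, \<omega>) - \<Theta> (t, \<omega>)\<bar> \<partial>?M') \<longlonglongrightarrow> 0"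
    using AE_forward_averages[OF assms(1) \<Theta>] by auto
  have "AE t in lborel. integrable M (\<lambda>\<omega>. \<Theta> (t, \<omega>))"
    using P.AE_integrable_fst'[OF \<Theta>] .
  with good show ?thesis
  proof eventually_elim
    case (elim t)
    show ?case
    proof (intro impI ballI)
      fix A assume t: "t \<in> S" and A: "A \<in> \<A> t"
      have [measurable]: "A \<in> sets M" using sub t A by auto
      define J where "J = (\<integral>\<omega>. indicator A \<omega> * \<Theta> (t, \<omega>) \<partial>M)"
      have i0: "integrable M (\<lambda>\<omega>. indicator A \<omega> * \<Theta> (t, \<omega>))"
        using integrable_mult_indicator[OF \<open>A \<in> sets M\<close> elim(2)] by simp
      note i1 = integrable_snd_pair[OF I.finite_measure_axioms M.sigma_finite_measure_axioms i0]
      have meas1: "measure (leb 1) (space (leb 1)) = 1" by (simp add: measure_restrict_space)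
      have "\<bar>J\<bar> \<le> (\<integral>(r, \<omega>). \<bar>\<Theta> (h n * r + t, \<omega>) - \<Theta> (t, \<omega>)\<bar> \<partial>?M')" for n
      proof -
        define d where "d p = \<Theta> (h n * fst p + t, snd p) - \<Theta> (t, snd p)" for p
        have d: "integrable ?M' d"
          using elim(1) by (auto simp: d_def[abs_def] case_prod_beta')
        have d1: "integrable ?M' (\<lambda>p. indicator A (snd p) * d p)"
        proof (rule Bochner_Integration.integrable_bound[OF d])
          show "(\<lambda>p. indicator A (snd p) * d p) \<in> borel_measurable ?M'"
            using borel_measurable_integrable[OF d] by measurable
        qed (auto simp: indicator_def)
        have int: "integrable ?M' (\<lambda>p. indicator A (snd p) * \<Theta> (h n * fst p + t, snd p))"
          using Bochner_Integration.integrable_add[OF d1 i1(1)] by (simp add: d_def algebra_simps)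
        have "(\<integral>p. indicator A (snd p) * \<Theta> (h n * fst p + t, snd p) \<partial>?M')
          = (\<integral>\<omega>. (\<integral>r. indicator A \<omega> * \<Theta> (h n * r + t, \<omega>) \<partial>leb 1) \<partial>M)"
          using IM.integral_snd[of "\<lambda>r \<omega>. indicator A \<omega> * \<Theta> (h n * r + t, \<omega>)"] int
          by (simp add: case_prod_beta')
        also have "\<dots> = (\<integral>\<omega>. (1 / h n) * (\<integral>s. indicator A \<omega> * (indicator {t..t + h n} s * \<Theta> (s, \<omega>)) \<partial>lborel) \<partial>M)"
        proof (rule Bochner_Integration.integral_cong[OF refl])
          fix \<omega>
          have "(\<integral>s. indicator A \<omega> * (indicator {t..t + h n} s * \<Theta> (s, \<omega>)) \<partial>lborel)
            = h n * (\<integral>r. indicator A \<omega> * (indicator {t..t + h n} (t + h n * r) * \<Theta> (t + h n * r, \<omega>)) \<partial>lborel)"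
            using h[of n] by (subst lborel_integral_real_affine[where c = "h n" and t = t]) auto
          also have "(\<integral>r. indicator A \<omega> * (indicator {t..t + h n} (t + h n * r) * \<Theta> (t + h n * r, \<omega>)) \<partial>lborel)
            = (\<integral>r. indicator {0..1} r *\<^sub>R (indicator A \<omega> * \<Theta> (h n * r + t, \<omega>)) \<partial>lborel)"
          proof (rule Bochner_Integration.integral_cong[OF refl])
            fix r
            have "t + h n * r \<in> {t..t + h n} \<longleftrightarrow> r \<in> {0..1}"
              using h[of n] by (simp add: zero_le_mult_iff mult_le_cancel_left1 not_less)
            then show "indicator A \<omega> * (indicator {t..t + h n} (t + h n * r) * \<Theta> (t + h n * r, \<omega>))
              = indicator {0..1} r *\<^sub>R (indicator A \<omega> * \<Theta> (h n * r + t, \<omega>))"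
              by (auto simp: indicator_def add.commute split: if_splits)
          qed
          also have "\<dots> = (\<integral>r. indicator A \<omega> * \<Theta> (h n * r + t, \<omega>) \<partial>leb 1)"
            by (rule integral_restrict_space[symmetric]) simp
          finally have eq: "(\<integral>s. indicator A \<omega> * (indicator {t..t + h n} s * \<Theta> (s, \<omega>)) \<partial>lborel)
            = h n * (\<integral>r. indicator A \<omega> * \<Theta> (h n * r + t, \<omega>) \<partial>leb 1)" .
          have "y = (1 / h n) * x" if "x = h n * y" for x y :: real
            using h[of n] that by simp
          from this[OF eq] show "(\<integral>r. indicator A \<omega> * \<Theta> (h n * r + t, \<omega>) \<partial>leb 1)
            = (1 / h n) * (\<integral>s. indicator A \<omega> * (indicator {t..t + h n} s * \<Theta> (s, \<omega>)) \<partial>lborel)" .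
        qed
        also have "\<dots> = (1 / h n) * (\<integral>\<omega>. (\<integral>s. indicator A \<omega> * (indicator {t..t + h n} s * \<Theta> (s, \<omega>)) \<partial>lborel) \<partial>M)"
          by (rule integral_mult_right_zero)
        also have "\<dots> = 0" using orth[OF t h A] by simp
        finally have zero: "(\<integral>p. indicator A (snd p) * \<Theta> (h n * fst p + t, snd p) \<partial>?M') = 0" .
        have "(\<integral>p. indicator A (snd p) * d p \<partial>?M')
          = (\<integral>p. indicator A (snd p) * \<Theta> (h n * fst p + t, snd p) - indicator A (snd p) * \<Theta> (t, snd p) \<partial>?M')"
          by (simp add: d_def algebra_simps)
        also have "\<dots> = - J"
          using int i1 zero meas1 by (simp add: J_def)
        finally have "\<bar>J\<bar> = \<bar>\<integral>p. indicator A (snd p) * d p \<partial>?M'\<bar>" by simp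
        also have "\<dots> \<le> (\<integral>p. \<bar>indicator A (snd p) * d p\<bar> \<partial>?M')"
          by (rule integral_abs_bound)
        also have "\<dots> \<le> (\<integral>p. \<bar>d p\<bar> \<partial>?M')"
          using d d1 by (intro integral_mono) (auto simp: indicator_def)
        finally show ?thesis by (simp add: d_def case_prod_beta')
      qed
      then have "\<bar>J\<bar> \<le> 0"
        using elim(1) by (intro LIMSEQ_le_const[of _ 0]) auto
      then show "(\<integral>\<omega>. indicator A \<omega> * \<Theta> (t, \<omega>) \<partial>M) = 0" by (simp add: J_def)
    qed
  qed
qed

subsection \<open>The first-order condition\<close>

definition bil :: "'b measure \<Rightarrow> ('b \<Rightarrow> 'b \<Rightarrow> real) \<Rightarrow> ('b \<Rightarrow> real) \<Rightarrow> ('b \<Rightarrow> real) \<Rightarrow> real" where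
  "bil L K f g = (\<integral>t. f t * kint L K g t \<partial>L)"

definition ip :: "'b measure \<Rightarrow> ('b \<Rightarrow> real) \<Rightarrow> ('b \<Rightarrow> real) \<Rightarrow> real" where
  "ip L f g = (\<integral>t. f t * g t \<partial>L)"

lemma ip_commute: "ip L f g = ip L g f"
  by (simp add: ip_def mult.commute)

lemma ip_add_left:
  assumes "l2 L f" "l2 L h" "l2 L g"
  shows "ip L (\<lambda>s. f s + e * h s) g = ip L f g + e * ip L h g"
proof -
  have "ip L (\<lambda>s. f s + e * h s) g = (\<integral>t. f t * g t + e * (h t * g t) \<partial>L)"
    unfolding ip_def by (intro Bochner_Integration.integral_cong) (auto simp: algebra_simps)
  then show ?thesis
    using l2_mult_integrable[OF assms(1,3)] l2_mult_integrable[OF assms(2,3)] by (simp add: ip_def)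
qed

lemma ip_add_right:
  assumes "l2 L f" "l2 L h" "l2 L g"
  shows "ip L g (\<lambda>s. f s + e * h s) = ip L g f + e * ip L g h"
  using ip_add_left[OF assms, of e] by (simp add: ip_commute)

lemma ip_sum_left:
  assumes "\<And>i. i \<in> I \<Longrightarrow> l2 L (f i)" "l2 L g"
  shows "ip L (\<lambda>s. \<Sum>i\<in>I. f i s) g = (\<Sum>i\<in>I. ip L (f i) g)"
  unfolding ip_def sum_distrib_right
  using assms by (intro Bochner_Integration.integral_sum l2_mult_integrable)

lemma bil_eq_ip: "bil L K f g = ip L f (kint L K g)"
  by (simp add: bil_def ip_def)

context
  fixes L :: "'b measure" and K :: "'b \<Rightarrow> 'b \<Rightarrow> real" and C :: real
  assumes fin: "finite_measure L" and rows: "l2_rows L C K"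
begin

lemma bil_add_left:
  assumes "l2 L f" "l2 L h" "l2 L g"
  shows "bil L K (\<lambda>s. f s + e * h s) g = bil L K f g + e * bil L K h g"
  unfolding bil_eq_ip by (intro ip_add_left assms l2_kint[OF fin rows])

lemma bil_add_right:
  assumes "l2 L f" "l2 L h" "l2 L g"
  shows "bil L K g (\<lambda>s. f s + e * h s) = bil L K g f + e * bil L K g h"
proof -
  have "bil L K g (\<lambda>s. f s + e * h s) = ip L g (\<lambda>s. kint L K f s + e * kint L K h s)"
    unfolding bil_def ip_def
    using kint_add[OF rows assms(1) l2_cmult[OF assms(2), of e]]
    by (intro Bochner_Integration.integral_cong) (auto simp: kint_cmult)
  then show ?thesis
    by (simp add: bil_eq_ip ip_add_right assms l2_kint[OF fin rows])
qed

lemma bil_sum_left: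
  assumes "\<And>i. i \<in> I \<Longrightarrow> l2 L (f i)" "l2 L g"
  shows "bil L K (\<lambda>s. \<Sum>i\<in>I. f i s) g = (\<Sum>i\<in>I. bil L K (f i) g)"
  unfolding bil_eq_ip using assms by (intro ip_sum_left l2_kint[OF fin rows])

lemma bil_sum_right:
  assumes "finite I" "\<And>i. i \<in> I \<Longrightarrow> l2 L (f i)" "l2 L g"
  shows "bil L K g (\<lambda>s. \<Sum>i\<in>I. f i s) = (\<Sum>i\<in>I. bil L K g (f i))"
  using assms(1,2)
proof (induction I rule: finite_induct)
  case empty
  then show ?case by (simp add: bil_def kint_def)
next
  case (insert i I)
  have "bil L K g (\<lambda>s. f i s + 1 * (\<Sum>j\<in>I. f j s)) = bil L K g (f i) + 1 * bil L K g (\<lambda>s. \<Sum>j\<in>I. f j s)"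
    using insert.prems by (intro bil_add_right assms(3) l2_sum) auto
  then show ?case using insert by simp
qed

lemma bil_adj: 
  assumes "l2 L f" "l2 L g"
  shows "bil L (\<lambda>t s. K s t) f g = bil L K g f"
  using integral_mult_kint[OF fin rows assms(2,1)] by (simp add: bil_def mult.commute)

end

lemma ip_cmult_left: "ip L (\<lambda>s. c * f s) g = c * ip L f g"
  by (simp add: ip_def mult.assoc)

lemma bil_cmult_left: "bil L K (\<lambda>s. c * f s) g = c * bil L K f g"
  by (simp add: bil_eq_ip ip_cmult_left)

lemma bil_cmult_right: "bil L K g (\<lambda>s. c * f s) = c * bil L K g f"
  by (simp add: bil_def kint_cmult mult.left_commute)

lemma quadratic_max_zero:
  fixes a b :: real
  assumes "\<And>e. e * a + e\<^sup>2 * b \<le> 0"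
  shows "a = 0"
proof (rule ccontr)
  assume "a \<noteq> 0"
  \<comment> \<open>\<open>d\<close> exceeds \<open>\<bar>b\<bar>\<close>, so at
    \<open>e = a / d\<close> the linear term outweighs the quadratic one.\<close>
  define d where "d = \<bar>b\<bar> + 1"
  have d: "0 < d" "\<bar>b\<bar> < d" by (auto simp: d_def)
  have "a / d * a + (a / d)\<^sup>2 * b = a\<^sup>2 * (d + b) / d\<^sup>2"
    using d by (simp add: field_simps power2_eq_square)
  moreover have "0 < a\<^sup>2 * (d + b) / d\<^sup>2"
    using d \<open>a \<noteq> 0\<close> by (intro divide_pos_pos mult_pos_pos) auto
  ultimately show False using assms[of "a / d"] by simp
qed

lemma AE_pair_snd:
  assumes "sigma_finite_measure M" "AE y in M. P y"
  shows "AE p in N \<Otimes>\<^sub>M M. P (snd p)"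
proof -
  interpret sigma_finite_measure M by fact
  obtain A where A: "A \<in> null_sets M" "{y \<in> space M. \<not> P y} \<subseteq> A"
    using assms(2) by (auto elim: AE_E3 simp: eventually_ae_filter)
  then have "space N \<times> A \<in> null_sets (N \<Otimes>\<^sub>M M)"
    by (auto simp: null_sets_def emeasure_pair_measure_Times)
  then show ?thesis
    by (rule AE_I') (use A in \<open>auto simp: space_pair_measure\<close>)
qed

section \<open>Square-integrable processes over a filtration\<close>

locale filtered_prob_space = prob_space M for M :: "'a measure" +
  fixes F :: "real \<Rightarrow> 'a measure" and T :: real
  assumes filtration: "is_filtration M F T" and T_pos: "0 < T"
begin

abbreviation "L \<equiv> leb T"
abbreviation "P \<equiv> leb T \<Otimes>\<^sub>M M"

sublocale L: finite_measure L by (rule finite_measure_leb)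
sublocale LM: pair_sigma_finite L M ..
sublocale P: finite_measure P
  by (rule finite_measure_pair_measure) (unfold_locales)

abbreviation l2_proc :: "(real \<Rightarrow> 'a \<Rightarrow> real) \<Rightarrow> bool" where
  "l2_proc u \<equiv> l2 P (\<lambda>(s, \<omega>). u s \<omega>)"

lemma subalgebra_F: "t \<in> {0..T} \<Longrightarrow> subalgebra M (F t)"
  using filtration by (auto simp: is_filtration_def)

lemma space_F: "t \<in> {0..T} \<Longrightarrow> space (F t) = space M"
  using subalgebra_F by (auto simp: subalgebra_def)

lemma sets_F_mono: "0 \<le> s \<Longrightarrow> s \<le> t \<Longrightarrow> t \<le> T \<Longrightarrow> sets (F s) \<subseteq> sets (F t)"
  using filtration by (auto simp: is_filtration_def)

lemma id_measurable_F: "t \<in> {0..T} \<Longrightarrow> (\<lambda>x. x) \<in> measurable M (F t)"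
  by (rule measurable_from_subalg[OF subalgebra_F]) auto

lemma prog_measurable_T:
  assumes "prog_measurable M F T u"
  shows "(\<lambda>(s, \<omega>). u s \<omega>) \<in> borel_measurable P"
proof -
  have T: "T \<in> {0..T}" using T_pos by simp
  have "(\<lambda>p. (fst p, snd p)) \<in> measurable P (restrict_space borel {0..T} \<Otimes>\<^sub>M F T)"
  proof (rule measurable_Pair)
    show "fst \<in> measurable P (restrict_space borel {0..T})"
      using measurable_fst[of L M] measurable_cong_sets[OF refl sets_leb, of P T] by auto
    show "snd \<in> measurable P (F T)"
      using measurable_compose[OF measurable_snd[of L M] id_measurable_F[OF T]] by simp
  qed
  moreover have "(\<lambda>(s, \<omega>). u s \<omega>) \<in> borel_measurable (restrict_space borel {0..T} \<Otimes>\<^sub>M F T)"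
    using assms T by (simp add: prog_measurable_def)
  ultimately show ?thesis using measurable_compose by (fastforce simp: case_prod_beta')
qed

lemma admissible_nn_integral:
  assumes "(\<lambda>(s, \<omega>). u s \<omega>) \<in> borel_measurable P"
  shows "(\<integral>\<^sup>+ s. (\<integral>\<^sup>+ \<omega>. ennreal ((u s \<omega>)\<^sup>2) \<partial>M) * indicator {0..T} s \<partial>lborel)
    = (\<integral>\<^sup>+ p. ennreal (norm ((case p of (s, \<omega>) \<Rightarrow> u s \<omega>)\<^sup>2)) \<partial>P)"
proof -
  note [measurable] = assms
  have "(\<integral>\<^sup>+ p. ennreal (norm ((case p of (s, \<omega>) \<Rightarrow> u s \<omega>)\<^sup>2)) \<partial>P)
    = (\<integral>\<^sup>+ s. (\<integral>\<^sup>+ \<omega>. ennreal ((u s \<omega>)\<^sup>2) \<partial>M) \<partial>L)"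
    by (subst nn_integral_fst[symmetric]) auto
  then show ?thesis by (simp add: nn_integral_restrict_space)
qed

lemma l2_proc_of_admissible:
  assumes "admissible M F T u" shows "l2_proc u"
proof -
  have m: "(\<lambda>(s, \<omega>). u s \<omega>) \<in> borel_measurable P"
    using assms prog_measurable_T by (simp add: admissible_def)
  then show ?thesis
    using assms admissible_nn_integral[OF m] by (auto simp: admissible_def l2_def integrable_iff_bounded)
qed

lemma admissible_of_l2_proc:
  assumes "prog_measurable M F T u" "l2_proc u" shows "admissible M F T u"
  using assms admissible_nn_integral[OF prog_measurable_T[OF assms(1)]]
  by (auto simp: admissible_def l2_def integrable_iff_bounded)

lemma admissible_add_cmult:
  assumes "admissible M F T u" "admissible M F T v"
  shows "admissible M F T (\<lambda>s \<omega>. u s \<omega> + e * v s \<omega>)"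
proof (rule admissible_of_l2_proc)
  show "prog_measurable M F T (\<lambda>s \<omega>. u s \<omega> + e * v s \<omega>)"
    using assms unfolding admissible_def prog_measurable_def case_prod_beta'
    by (intro ballI borel_measurable_add borel_measurable_times borel_measurable_const) auto
  show "l2_proc (\<lambda>s \<omega>. u s \<omega> + e * v s \<omega>)"
    using l2_add[OF l2_proc_of_admissible[OF assms(1)] l2_cmult[OF l2_proc_of_admissible[OF assms(2)], of e]]
    by (simp add: case_prod_beta')
qed

lemma l2_proc_path:
  assumes "l2_proc u" shows "AE \<omega> in M. l2 L (\<lambda>s. u s \<omega>)"
proof -
  have "integrable P (\<lambda>(s, \<omega>). (u s \<omega>)\<^sup>2)"
    using l2_square[OF assms] by (simp add: case_prod_beta')
  from LM.AE_integrable_snd[OF this] AE_space show ?thesis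
  proof eventually_elim
    case (elim \<omega>)
    have "(\<lambda>s. (s, \<omega>)) \<in> measurable L P" using elim(2) by simp
    from measurable_compose[OF this l2_measurable[OF assms]] elim(1) show ?case
      by (simp add: l2_def)
  qed
qed

lemma l2_proc_ip:
  assumes "l2_proc u" "l2_proc v"
  shows "integrable M (\<lambda>\<omega>. ip L (\<lambda>s. u s \<omega>) (\<lambda>s. v s \<omega>))"
    and "(\<integral>\<omega>. ip L (\<lambda>s. u s \<omega>) (\<lambda>s. v s \<omega>) \<partial>M) = (\<integral>(s, \<omega>). u s \<omega> * v s \<omega> \<partial>P)"
proof -
  have int: "integrable P (\<lambda>(s, \<omega>). u s \<omega> * v s \<omega>)"
    using l2_mult_integrable[OF assms] by (simp add: case_prod_beta')
  show "integrable M (\<lambda>\<omega>. ip L (\<lambda>s. u s \<omega>) (\<lambda>s. v s \<omega>))"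
    using LM.integrable_snd[OF int] by (simp add: ip_def)
  show "(\<integral>\<omega>. ip L (\<lambda>s. u s \<omega>) (\<lambda>s. v s \<omega>) \<partial>M) = (\<integral>(s, \<omega>). u s \<omega> * v s \<omega> \<partial>P)"
    using LM.integral_snd[OF int] by (simp add: ip_def)
qed

lemma kint_proc_measurable:
  assumes K: "(\<lambda>(t, s). K t s) \<in> borel_measurable (L \<Otimes>\<^sub>M L)" and u: "(\<lambda>(s, \<omega>). u s \<omega>) \<in> borel_measurable P"
  shows "(\<lambda>(s, \<omega>). kint L K (\<lambda>r. u r \<omega>) s) \<in> borel_measurable P"
proof -
  have [measurable]: "(\<lambda>p. K (fst (fst p)) (snd p)) \<in> borel_measurable (P \<Otimes>\<^sub>M L)"
    using measurable_compose[OF _ K, of "\<lambda>p. (fst (fst p), snd p)" "P \<Otimes>\<^sub>M L"] by simp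
  have [measurable]: "(\<lambda>p. u (snd p) (snd (fst p))) \<in> borel_measurable (P \<Otimes>\<^sub>M L)"
    using measurable_compose[OF _ u, of "\<lambda>p. (snd p, snd (fst p))" "P \<Otimes>\<^sub>M L"] by simp
  have "(\<lambda>p. \<integral>r. K (fst p) r * u r (snd p) \<partial>L) \<in> borel_measurable P"
    by (rule L.borel_measurable_lebesgue_integral) (simp add: case_prod_beta')
  then show ?thesis by (simp add: kint_def case_prod_beta')
qed

text \<open>The pointwise bound \<open>kint_square_le\<close> does not depend on the time, so the
  squared process is dominated by a function of \<open>\<omega>\<close> alone, a multiple of the
  squared norm of the path of \<open>u\<close>.\<close>

lemma l2_proc_kint:
  assumes K: "l2_rows L C K" and u: "l2_proc u"
  shows "l2_proc (\<lambda>s \<omega>. kint L K (\<lambda>r. u r \<omega>) s)"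
  unfolding l2_def
proof
  show m: "(\<lambda>(s, \<omega>). kint L K (\<lambda>r. u r \<omega>) s) \<in> borel_measurable P"
    by (rule kint_proc_measurable[OF l2_rows_measurable[OF K] l2_measurable[OF u]])
  define w where "w \<omega> = \<bar>C\<bar> * (\<integral>s. (u s \<omega>)\<^sup>2 \<partial>L)" for \<omega>
  have "integrable P (\<lambda>(s, \<omega>). (u s \<omega>)\<^sup>2)"
    using l2_square[OF u] by (simp add: case_prod_beta')
  from LM.integrable_snd[OF this] have "integrable M w" unfolding w_def by simp
  then have "integrable P (\<lambda>p. w (snd p))"
    by (rule integrable_snd_pair(1)[OF L.finite_measure_axioms sigma_finite_measure_axioms])
  then show "integrable P (\<lambda>p. (case p of (s, \<omega>) \<Rightarrow> kint L K (\<lambda>r. u r \<omega>) s)\<^sup>2)"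
  proof (rule Bochner_Integration.integrable_bound)
    show "(\<lambda>p. (case p of (s, \<omega>) \<Rightarrow> kint L K (\<lambda>r. u r \<omega>) s)\<^sup>2) \<in> borel_measurable P"
      using m by simp
    have "AE p in P. l2 L (\<lambda>s. u s (snd p))"
      using AE_pair_snd[OF sigma_finite_measure_axioms l2_proc_path[OF u]] .
    then show "AE p in P. norm ((case p of (s, \<omega>) \<Rightarrow> kint L K (\<lambda>r. u r \<omega>) s)\<^sup>2) \<le> norm (w (snd p))"
      using AE_space
    proof eventually_elim
      case (elim p)
      then have "(kint L K (\<lambda>r. u r (snd p)) (fst p))\<^sup>2 \<le> C * (\<integral>s. (u s (snd p))\<^sup>2 \<partial>L)"
        by (intro kint_square_le[OF K]) (auto simp: space_pair_measure)
      also have "\<dots> \<le> w (snd p)" unfolding w_def by (intro mult_right_mono) auto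
      finally show ?case by (simp add: case_prod_beta')
    qed
  qed
qed

lemma l2_proc_bil:
  assumes K: "l2_rows L C K" and "l2_proc u" "l2_proc v"
  shows "integrable M (\<lambda>\<omega>. bil L K (\<lambda>s. u s \<omega>) (\<lambda>s. v s \<omega>))"
  unfolding bil_eq_ip by (intro l2_proc_ip assms l2_proc_kint[OF K])

end

section \<open>Perturbing one player's control at equilibrium\<close>

locale stochastic_game = filtered_prob_space +
  fixes N :: nat and A1 A2h A3 :: "real \<Rightarrow> real \<Rightarrow> real" and lam C1 C2 C3 :: real
    and b0 :: "real \<Rightarrow> 'a \<Rightarrow> real" and b :: "nat \<Rightarrow> real \<Rightarrow> 'a \<Rightarrow> real"
    and c :: "nat \<Rightarrow> 'a \<Rightarrow> real" and U :: "nat \<Rightarrow> real \<Rightarrow> 'a \<Rightarrow> real"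
  assumes N_pos: "0 < N" and lam_pos: "0 < lam"
    and b0: "admissible M F T b0" and b: "\<And>i. i \<in> {1..N} \<Longrightarrow> admissible M F T (b i)"
    and c: "\<And>i. i \<in> {1..N} \<Longrightarrow> integrable M (c i)"
    and A1: "volterra_kernel T C1 A1" and A2: "volterra_kernel T C2 A2h" and A3: "volterra_kernel T C3 A3"
    and nash: "nash_equilibrium M F N T A1 lam A2h A3 b0 b c U"
begin

text \<open>Coefficient of \<open>e\<close> in the payoff when \<open>U i\<close> moves to
  \<open>U i + e * h\<close>. The average then moves by \<open>e * h / N\<close>, whence the factors
  \<open>1 / real N\<close>; both orders of each bilinear form occur because the kernels are not
  symmetric. \<open>payoff_curvature\<close> is the coefficient of \<open>e^2\<close>, which depends
  on the direction only.\<close>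

definition payoff_slope :: "nat \<Rightarrow> (real \<Rightarrow> real) \<Rightarrow> 'a \<Rightarrow> real" where
  "payoff_slope i h \<omega> =
    (let f = (\<lambda>s. avg N U s \<omega>); g = (\<lambda>s. U i s \<omega>) in
     - 1 / real N * (bil L A1 f h + bil L A1 h f)
     - (2 * lam * ip L g h + bil L A2h g h + bil L A2h h g)
     - (bil L A3 h f + bil L A3 f h + 1 / real N * (bil L A3 g h + bil L A3 h g))
     + ip L (\<lambda>s. b i s \<omega>) h + 1 / real N * ip L (\<lambda>s. b0 s \<omega>) h)"

definition payoff_curvature :: "(real \<Rightarrow> real) \<Rightarrow> real" where
  "payoff_curvature h = - (1 / real N)\<^sup>2 * bil L A1 h h - (lam * ip L h h + bil L A2h h h)
     - 1 / real N * (bil L A3 h h + bil L A3 h h)"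

lemma U_admissible: "i \<in> {1..N} \<Longrightarrow> admissible M F T (U i)"
  using nash by (auto simp: nash_equilibrium_def)

lemma avg_eq: "avg N V s \<omega> = (1 / real N) * (\<Sum>j=1..N. V j s \<omega>)"
  by (simp add: avg_def)

lemma l2_proc_avg:
  assumes "\<And>i. i \<in> {1..N} \<Longrightarrow> l2_proc (V i)" shows "l2_proc (avg N V)"
proof -
  have "l2 P (\<lambda>p. (1 / real N) * (\<Sum>j=1..N. case p of (s, \<omega>) \<Rightarrow> V j s \<omega>))"
    by (intro l2_cmult l2_sum assms)
  then show ?thesis by (simp add: avg_eq case_prod_beta')
qed

lemma payoff_eq:
  assumes f: "l2 L (\<lambda>s. avg N V s \<omega>)" and g: "l2 L (\<lambda>s. V i s \<omega>)"
    and \<beta>: "l2 L (\<lambda>s. b i s \<omega>)"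
  shows "payoff N T A1 lam A2h A3 b0 b c i V \<omega> =
    (let f = (\<lambda>s. avg N V s \<omega>); g = (\<lambda>s. V i s \<omega>) in
      - bil L A1 f f - (lam * ip L g g + bil L A2h g g) - (bil L A3 g f + bil L A3 f g)
      + ip L (\<lambda>s. b i s \<omega>) g + ip L (\<lambda>s. b0 s \<omega>) f + c i \<omega>)"
proof -
  interpret A2: volterra_kernel T C2 A2h by (rule A2)
  interpret A3: volterra_kernel T C3 A3 by (rule A3)
  let ?f = "\<lambda>s. avg N V s \<omega>" and ?g = "\<lambda>s. V i s \<omega>"
  have e2: "ip L ?g (\<lambda>t. kint L A2h ?g t + lam * ?g t) = lam * ip L ?g ?g + bil L A2h ?g ?g"
    using ip_add_right[OF A2.l2_kint_K[OF g] g g, of lam] by (simp add: bil_eq_ip)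
  have e3: "ip L ?g (\<lambda>t. kint L A3 ?f t + 1 * kint L (\<lambda>t s. A3 s t) ?f t) = bil L A3 ?g ?f + bil L A3 ?f ?g"
    using ip_add_right[OF A3.l2_kint_K[OF f] A3.l2_kint_adj[OF f] g, of 1]
      bil_adj[OF finite_measure_leb A3.rows g f]
    by (simp add: bil_eq_ip)
  show ?thesis
    unfolding payoff_def Let_def l2inner_eq kop_eq adj_def
    using e2 e3 by (simp add: ip_def bil_def add.commute)
qed

lemma payoff_perturbed:
  assumes i: "i \<in> {1..N}" and U: "\<And>j. j \<in> {1..N} \<Longrightarrow> l2 L (\<lambda>s. U j s \<omega>)" and h: "l2 L (\<lambda>s. v s \<omega>)"
    and \<beta>: "l2 L (\<lambda>s. b i s \<omega>)" "l2 L (\<lambda>s. b0 s \<omega>)"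
  shows "payoff N T A1 lam A2h A3 b0 b c i (U(i := \<lambda>s \<omega>. U i s \<omega> + e * v s \<omega>)) \<omega>
    = payoff N T A1 lam A2h A3 b0 b c i U \<omega>
      + e * payoff_slope i (\<lambda>s. v s \<omega>) \<omega> + e\<^sup>2 * payoff_curvature (\<lambda>s. v s \<omega>)"
proof -
  interpret A1: volterra_kernel T C1 A1 by (rule A1)
  interpret A2: volterra_kernel T C2 A2h by (rule A2)
  interpret A3: volterra_kernel T C3 A3 by (rule A3)
  let ?V = "U(i := \<lambda>s \<omega>. U i s \<omega> + e * v s \<omega>)"
  define f g h where "f = (\<lambda>s. avg N U s \<omega>)" and "g = (\<lambda>s. U i s \<omega>)" and "h = (\<lambda>s. v s \<omega>)"
  have [simp]: "real N \<noteq> 0" using N_pos by simp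
  have avgV: "avg N ?V s \<omega> = f s + (e / real N) * h s" for s
  proof -
    have "(\<Sum>j=1..N. ?V j s \<omega>) = (\<Sum>j=1..N. U j s \<omega> + (if j = i then e * v s \<omega> else 0))"
      by (intro sum.cong) auto
    also have "\<dots> = (\<Sum>j=1..N. U j s \<omega>) + e * v s \<omega>"
      using i by (simp add: sum.distrib)
    finally show ?thesis by (simp add: avg_def f_def h_def add_divide_distrib)
  qed
  have Vi: "?V i s \<omega> = g s + e * h s" for s by (simp add: g_def h_def)
  have f: "l2 L f"
    unfolding f_def avg_eq by (intro l2_cmult l2_sum U)
  have g: "l2 L g" using U[OF i] by (simp add: g_def)
  have h: "l2 L h" using h by (simp add: h_def)
  have f': "l2 L (\<lambda>s. f s + (e / real N) * h s)" and g': "l2 L (\<lambda>s. g s + e * h s)"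
    by (intro l2_add l2_cmult f g h)+
  note fin = finite_measure_leb[of T]
  have "l2 L (\<lambda>s. avg N ?V s \<omega>)" "l2 L (\<lambda>s. ?V i s \<omega>)" unfolding avgV Vi by (rule f' g')+
  note pV = payoff_eq[OF this \<beta>(1), unfolded avgV Vi Let_def]
  note pU = payoff_eq[of U, OF f[unfolded f_def] g[unfolded g_def] \<beta>(1), folded f_def g_def, unfolded Let_def]
  note bils = bil_add_left[OF fin A1.rows] bil_add_right[OF fin A1.rows]
    bil_add_left[OF fin A2.rows] bil_add_right[OF fin A2.rows]
    bil_add_left[OF fin A3.rows] bil_add_right[OF fin A3.rows] ip_add_left ip_add_right
  have q: "ip L g h = ip L h g" by (rule ip_commute)
  show ?thesis
    unfolding pV pU payoff_slope_def payoff_curvature_def Let_def f_def[symmetric] g_def[symmetric] h_def[symmetric]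
    by (simp only: bils f g h f' g' \<beta>) (simp add: q power2_eq_square algebra_simps add_divide_distrib)
qed

lemma payoff_slope_integrable:
  assumes i: "i \<in> {1..N}" and v: "admissible M F T v"
  shows "integrable M (\<lambda>\<omega>. payoff_slope i (\<lambda>s. v s \<omega>) \<omega>)"
proof -
  interpret A1: volterra_kernel T C1 A1 by (rule A1)
  interpret A2: volterra_kernel T C2 A2h by (rule A2)
  interpret A3: volterra_kernel T C3 A3 by (rule A3)
  note v' = l2_proc_of_admissible[OF v] and u' = l2_proc_of_admissible[OF U_admissible]
  have m: "l2_proc (avg N U)" by (intro l2_proc_avg u')
  show ?thesis unfolding payoff_slope_def Let_def
    by (intro Bochner_Integration.integrable_add Bochner_Integration.integrable_diff integrable_mult_right
        l2_proc_bil[OF A1.rows] l2_proc_bil[OF A2.rows] l2_proc_bil[OF A3.rows] l2_proc_ip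
        m v' u' i l2_proc_of_admissible[OF b] l2_proc_of_admissible[OF b0])
qed

lemma payoff_curvature_integrable:
  assumes v: "admissible M F T v"
  shows "integrable M (\<lambda>\<omega>. payoff_curvature (\<lambda>s. v s \<omega>))"
proof -
  interpret A1: volterra_kernel T C1 A1 by (rule A1)
  interpret A2: volterra_kernel T C2 A2h by (rule A2)
  interpret A3: volterra_kernel T C3 A3 by (rule A3)
  note v' = l2_proc_of_admissible[OF v]
  show ?thesis unfolding payoff_curvature_def
    by (intro Bochner_Integration.integrable_add Bochner_Integration.integrable_diff integrable_mult_right
        l2_proc_bil[OF A1.rows] l2_proc_bil[OF A2.rows] l2_proc_bil[OF A3.rows] l2_proc_ip v')
qed

lemma AE_paths:
  "AE \<omega> in M. l2 L (\<lambda>s. b0 s \<omega>) \<and> (\<forall>i\<in>{1..N}. l2 L (\<lambda>s. U i s \<omega>) \<and> l2 L (\<lambda>s. b i s \<omega>))"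
proof -
  have "AE \<omega> in M. \<forall>i\<in>{1..N}. l2 L (\<lambda>s. U i s \<omega>) \<and> l2 L (\<lambda>s. b i s \<omega>)"
    using l2_proc_path[OF l2_proc_of_admissible[OF U_admissible]]
      l2_proc_path[OF l2_proc_of_admissible[OF b]]
    by (intro AE_finite_allI) auto
  with l2_proc_path[OF l2_proc_of_admissible[OF b0]] show ?thesis by eventually_elim auto
qed

lemma ip_measurable:
  assumes [measurable]: "(\<lambda>(s, \<omega>). u s \<omega>) \<in> borel_measurable P" "(\<lambda>(s, \<omega>). v s \<omega>) \<in> borel_measurable P"
  shows "(\<lambda>\<omega>. ip L (\<lambda>s. u s \<omega>) (\<lambda>s. v s \<omega>)) \<in> borel_measurable M"
proof -
  have "(\<lambda>(s, \<omega>). u s \<omega> * v s \<omega>) \<in> borel_measurable P" by measurable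
  from measurable_pair_swap[OF this]
  have "(\<lambda>(\<omega>, s). u s \<omega> * v s \<omega>) \<in> borel_measurable (M \<Otimes>\<^sub>M L)" by (simp add: case_prod_beta')
  then show ?thesis unfolding ip_def by (rule L.borel_measurable_lebesgue_integral)
qed

text \<open>Obtained from the defining integrals, for every measurable profile. The expansion into
  bilinear forms is available only on square-integrable paths, hence for almost every
  \<open>\<omega>\<close>, and measurability is what lets expectations be compared across that null
  set.\<close>

lemma payoff_measurable:
  assumes i: "i \<in> {1..N}" and V: "\<And>j. j \<in> {1..N} \<Longrightarrow> (\<lambda>(s, \<omega>). V j s \<omega>) \<in> borel_measurable P"
  shows "payoff N T A1 lam A2h A3 b0 b c i V \<in> borel_measurable M"
proof -
  interpret A1: volterra_kernel T C1 A1 by (rule A1)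
  interpret A2: volterra_kernel T C2 A2h by (rule A2)
  interpret A3: volterra_kernel T C3 A3 by (rule A3)
  note [measurable] = V[OF i] l2_measurable[OF l2_proc_of_admissible[OF b[OF i]]]
    l2_measurable[OF l2_proc_of_admissible[OF b0]] borel_measurable_integrable[OF c[OF i]]
  have "(\<lambda>p. (1 / real N) * (\<Sum>j=1..N. case p of (s, \<omega>) \<Rightarrow> V j s \<omega>)) \<in> borel_measurable P"
    by (intro borel_measurable_times borel_measurable_const borel_measurable_sum V)
  then have [measurable]: "(\<lambda>(s, \<omega>). avg N V s \<omega>) \<in> borel_measurable P"
    by (simp add: avg_eq case_prod_beta')
  note m = \<open>(\<lambda>(s, \<omega>). avg N V s \<omega>) \<in> borel_measurable P\<close>
  note kint_proc_measurable[OF l2_rows_measurable[OF A1.rows] m, measurable]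
    kint_proc_measurable[OF l2_rows_measurable[OF A2.rows] V[OF i], measurable]
    kint_proc_measurable[OF l2_rows_measurable[OF A3.rows] m, measurable]
    kint_proc_measurable[OF l2_rows_measurable[OF A3.cols] m, measurable]
  have "payoff N T A1 lam A2h A3 b0 b c i V = (\<lambda>\<omega>.
      - ip L (\<lambda>s. avg N V s \<omega>) (\<lambda>s. kint L A1 (\<lambda>r. avg N V r \<omega>) s)
      - ip L (\<lambda>s. V i s \<omega>) (\<lambda>s. lam * V i s \<omega> + kint L A2h (\<lambda>r. V i r \<omega>) s)
      - ip L (\<lambda>s. V i s \<omega>) (\<lambda>s. kint L A3 (\<lambda>r. avg N V r \<omega>) s + kint L (\<lambda>t s. A3 s t) (\<lambda>r. avg N V r \<omega>) s)
      + ip L (\<lambda>s. b i s \<omega>) (\<lambda>s. V i s \<omega>) + ip L (\<lambda>s. b0 s \<omega>) (\<lambda>s. avg N V s \<omega>) + c i \<omega>)"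
    by (simp add: fun_eq_iff payoff_def Let_def l2inner_eq kop_eq adj_def ip_def)
  also have "\<dots> \<in> borel_measurable M"
    by (intro borel_measurable_add borel_measurable_diff borel_measurable_uminus ip_measurable
        borel_measurable_integrable[OF c[OF i]]) measurable
  finally show ?thesis .
qed

lemma payoff_integrable:
  assumes i: "i \<in> {1..N}"
  shows "integrable M (payoff N T A1 lam A2h A3 b0 b c i U)"
proof -
  interpret A1: volterra_kernel T C1 A1 by (rule A1)
  interpret A2: volterra_kernel T C2 A2h by (rule A2)
  interpret A3: volterra_kernel T C3 A3 by (rule A3)
  note u' = l2_proc_of_admissible[OF U_admissible]
  have m: "l2_proc (avg N U)" by (intro l2_proc_avg u')
  let ?f = "\<lambda>\<omega> s. avg N U s \<omega>" and ?g = "\<lambda>\<omega> s. U i s \<omega>"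
  have int: "integrable M (\<lambda>\<omega>. - 1 * bil L A1 (?f \<omega>) (?f \<omega>) - (lam * ip L (?g \<omega>) (?g \<omega>) + bil L A2h (?g \<omega>) (?g \<omega>))
      - (bil L A3 (?g \<omega>) (?f \<omega>) + bil L A3 (?f \<omega>) (?g \<omega>))
      + ip L (\<lambda>s. b i s \<omega>) (?g \<omega>) + ip L (\<lambda>s. b0 s \<omega>) (?f \<omega>) + c i \<omega>)"
    by (intro Bochner_Integration.integrable_add Bochner_Integration.integrable_diff integrable_mult_right
        l2_proc_bil[OF A1.rows] l2_proc_bil[OF A2.rows] l2_proc_bil[OF A3.rows] l2_proc_ip
        m u' i c l2_proc_of_admissible[OF b] l2_proc_of_admissible[OF b0])
  have eq: "payoff N T A1 lam A2h A3 b0 b c i U \<omega> = - 1 * bil L A1 (?f \<omega>) (?f \<omega>)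
      - (lam * ip L (?g \<omega>) (?g \<omega>) + bil L A2h (?g \<omega>) (?g \<omega>))
      - (bil L A3 (?g \<omega>) (?f \<omega>) + bil L A3 (?f \<omega>) (?g \<omega>))
      + ip L (\<lambda>s. b i s \<omega>) (?g \<omega>) + ip L (\<lambda>s. b0 s \<omega>) (?f \<omega>) + c i \<omega>"
    if "l2 L (?f \<omega>)" "l2 L (?g \<omega>)" "l2 L (\<lambda>s. b i s \<omega>)" for \<omega>
    using payoff_eq[OF that] by (simp add: Let_def)
  have aeq: "AE \<omega> in M. payoff N T A1 lam A2h A3 b0 b c i U \<omega> = - 1 * bil L A1 (?f \<omega>) (?f \<omega>)
      - (lam * ip L (?g \<omega>) (?g \<omega>) + bil L A2h (?g \<omega>) (?g \<omega>))
      - (bil L A3 (?g \<omega>) (?f \<omega>) + bil L A3 (?f \<omega>) (?g \<omega>))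
      + ip L (\<lambda>s. b i s \<omega>) (?g \<omega>) + ip L (\<lambda>s. b0 s \<omega>) (?f \<omega>) + c i \<omega>"
    using AE_paths l2_proc_path[OF m]
  proof eventually_elim
    case (elim \<omega>)
    then show ?case using i by (intro eq) auto
  qed
  show ?thesis
    by (rule integrable_cong_AE_imp[OF int])
      (use payoff_measurable[OF i l2_measurable[OF u']] aeq in auto)
qed

lemma objective_perturbed:
  assumes i: "i \<in> {1..N}" and v: "admissible M F T v"
  shows "objective M N T A1 lam A2h A3 b0 b c i (U(i := \<lambda>s \<omega>. U i s \<omega> + e * v s \<omega>))
    = objective M N T A1 lam A2h A3 b0 b c i U
      + e * (\<integral>\<omega>. payoff_slope i (\<lambda>s. v s \<omega>) \<omega> \<partial>M) + e\<^sup>2 * (\<integral>\<omega>. payoff_curvature (\<lambda>s. v s \<omega>) \<partial>M)"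
proof -
  let ?V = "U(i := \<lambda>s \<omega>. U i s \<omega> + e * v s \<omega>)"
  note ints = payoff_integrable[OF i] payoff_slope_integrable[OF i v] payoff_curvature_integrable[OF v]
  have V: "l2_proc (?V j)" if "j \<in> {1..N}" for j
    using that admissible_add_cmult[OF U_admissible[OF i] v, of e] U_admissible[of j]
    by (auto intro!: l2_proc_of_admissible)
  have "(\<integral>\<omega>. payoff N T A1 lam A2h A3 b0 b c i ?V \<omega> \<partial>M)
    = (\<integral>\<omega>. payoff N T A1 lam A2h A3 b0 b c i U \<omega> + e * payoff_slope i (\<lambda>s. v s \<omega>) \<omega>
        + e\<^sup>2 * payoff_curvature (\<lambda>s. v s \<omega>) \<partial>M)"
  proof (rule integral_cong_AE)
    show "AE \<omega> in M. payoff N T A1 lam A2h A3 b0 b c i ?V \<omega>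
      = payoff N T A1 lam A2h A3 b0 b c i U \<omega> + e * payoff_slope i (\<lambda>s. v s \<omega>) \<omega>
        + e\<^sup>2 * payoff_curvature (\<lambda>s. v s \<omega>)"
      using AE_paths l2_proc_path[OF l2_proc_of_admissible[OF v]]
    proof eventually_elim
      case (elim \<omega>)
      then show ?case using i by (intro payoff_perturbed) auto
    qed
    show "payoff N T A1 lam A2h A3 b0 b c i ?V \<in> borel_measurable M"
      by (rule payoff_measurable[OF i l2_measurable[OF V]])
  qed (use ints in auto)
  then show ?thesis using ints by (simp add: objective_def)
qed

lemma payoff_slope_zero:
  assumes i: "i \<in> {1..N}" and v: "admissible M F T v"
  shows "(\<integral>\<omega>. payoff_slope i (\<lambda>s. v s \<omega>) \<omega> \<partial>M) = 0"
proof (rule quadratic_max_zero)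
  fix e :: real
  have "admissible M F T (\<lambda>s \<omega>. U i s \<omega> + e * v s \<omega>)"
    by (rule admissible_add_cmult[OF U_admissible[OF i] v])
  then have "objective M N T A1 lam A2h A3 b0 b c i (U(i := \<lambda>s \<omega>. U i s \<omega> + e * v s \<omega>))
      \<le> objective M N T A1 lam A2h A3 b0 b c i U"
    using nash i by (auto simp: nash_equilibrium_def)
  then show "e * (\<integral>\<omega>. payoff_slope i (\<lambda>s. v s \<omega>) \<omega> \<partial>M)
      + e\<^sup>2 * (\<integral>\<omega>. payoff_curvature (\<lambda>s. v s \<omega>) \<partial>M) \<le> 0"
    unfolding objective_perturbed[OF i v] by simp
qed

abbreviation "K \<equiv> Kbar N A1 A2h A3"

definition X :: "real \<Rightarrow> 'a \<Rightarrow> real" where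
  "X s \<omega> = avg N b s \<omega> + b0 s \<omega> / real N"

definition foc :: "real \<Rightarrow> 'a \<Rightarrow> real" where
  "foc s \<omega> = X s \<omega> - (2 * lam * avg N U s \<omega> + kint L K (\<lambda>r. avg N U r \<omega>) s
     + kint L (\<lambda>t s. K s t) (\<lambda>r. avg N U r \<omega>) s)"

text \<open>The weights are \<open>(N - 1) / N^2 + 1 / N^2 = 1 / N\<close> for \<open>A1\<close> and
  \<open>(N - 1) / N + 2 / N = 1 + 1 / N\<close> for \<open>A3\<close>. In this form
  \<open>Kbar\<close> is visibly the kernel that averaging the slopes over the players
  produces.\<close>

lemma K_eq: "K = (\<lambda>t s. 1 / real N * A1 t s + (1 + 1 / real N) * A3 t s + A2h t s)"
  using N_pos by (simp add: fun_eq_iff Kbar_def Hk_def Gk_def field_simps power2_eq_square)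

lemma volterra_K: "\<exists>C. volterra_kernel T C K"
proof -
  have "volterra_kernel T ((1 / real N)\<^sup>2 * C1) (\<lambda>t s. 1 / real N * A1 t s)"
    by (rule volterra_kernel_cmult[OF A1]) simp
  moreover have "volterra_kernel T ((1 + 1 / real N)\<^sup>2 * C3) (\<lambda>t s. (1 + 1 / real N) * A3 t s)"
    by (rule volterra_kernel_cmult[OF A3]) simp
  ultimately have "volterra_kernel T (2 * ((1 / real N)\<^sup>2 * C1) + 2 * ((1 + 1 / real N)\<^sup>2 * C3))
      (\<lambda>t s. 1 / real N * A1 t s + (1 + 1 / real N) * A3 t s)"
    by (rule volterra_kernel_add)
  from volterra_kernel_add[OF this A2] show ?thesis
    unfolding K_eq by blast
qed

lemma bil_K:
  assumes f: "l2 L f" and g: "l2 L g"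
  shows "bil L K f g = 1 / real N * bil L A1 f g + (1 + 1 / real N) * bil L A3 f g + bil L A2h f g"
proof -
  interpret A1: volterra_kernel T C1 A1 by (rule A1)
  interpret A2: volterra_kernel T C2 A2h by (rule A2)
  interpret A3: volterra_kernel T C3 A3 by (rule A3)
  note r1 = l2_rows_cmult[OF A1.rows, of "1 / real N"] and r3 = l2_rows_cmult[OF A3.rows, of "1 + 1 / real N"]
  have "kint L K g t = (1 / real N * kint L A1 g t + (1 + 1 / real N) * kint L A3 g t) + kint L A2h g t"
    if "t \<in> space L" for t
    unfolding K_eq kint_kernel_add[OF l2_rows_add[OF r1 r3] A2.rows g that]
      kint_kernel_add[OF r1 r3 g that] kint_kernel_cmult ..
  then have "bil L K f g = ip L f (\<lambda>t. (1 / real N * kint L A1 g t + (1 + 1 / real N) * kint L A3 g t) + 1 * kint L A2h g t)"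
    unfolding bil_def ip_def by (intro Bochner_Integration.integral_cong) auto
  also have "\<dots> = ip L f (\<lambda>t. 1 / real N * kint L A1 g t + (1 + 1 / real N) * kint L A3 g t) + 1 * ip L f (kint L A2h g)"
    by (intro ip_add_right l2_add l2_cmult f A1.l2_kint_K A2.l2_kint_K A3.l2_kint_K g)
  also have "ip L f (\<lambda>t. 1 / real N * kint L A1 g t + (1 + 1 / real N) * kint L A3 g t)
    = ip L f (\<lambda>t. 1 / real N * kint L A1 g t) + (1 + 1 / real N) * ip L f (kint L A3 g)"
    by (intro ip_add_right l2_add l2_cmult f A1.l2_kint_K A3.l2_kint_K g)
  also have "ip L f (\<lambda>t. 1 / real N * kint L A1 g t) = 1 / real N * ip L f (kint L A1 g)"
    by (subst (1 2) ip_commute) (rule ip_cmult_left)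
  finally show ?thesis by (simp add: bil_eq_ip)
qed

lemma l2_proc_m: "l2_proc (avg N U)"
  by (intro l2_proc_avg l2_proc_of_admissible U_admissible)

lemma l2_proc_X: "l2_proc X"
proof -
  have "l2_proc (avg N b)"
    by (intro l2_proc_avg l2_proc_of_admissible b)
  from l2_add[OF this l2_cmult[OF l2_proc_of_admissible[OF b0], of "1 / real N"]]
  show ?thesis by (simp add: X_def case_prod_beta')
qed

lemma l2_proc_foc: "l2_proc foc"
proof -
  obtain C where "volterra_kernel T C K" using volterra_K by auto
  then interpret K: volterra_kernel T C K .
  have "l2 P (\<lambda>p. (case p of (s, \<omega>) \<Rightarrow> X s \<omega>) - (2 * lam * (case p of (s, \<omega>) \<Rightarrow> avg N U s \<omega>)
      + (case p of (s, \<omega>) \<Rightarrow> kint L K (\<lambda>r. avg N U r \<omega>) s)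
      + (case p of (s, \<omega>) \<Rightarrow> kint L (\<lambda>t s. K s t) (\<lambda>r. avg N U r \<omega>) s)))"
    by (intro l2_diff l2_add l2_cmult l2_proc_X l2_proc_m l2_proc_kint[OF K.rows] l2_proc_kint[OF K.cols])
  then show ?thesis by (simp add: foc_def case_prod_beta')
qed

text \<open>Each slope is linear in \<open>U i\<close> and \<open>b i\<close>, tested against the
  same \<open>h\<close> for all players, so the sum replaces them by \<open>N\<close> times their
  averages. Individual controls disappear, which is why the mean satisfies a closed
  equation.\<close>

lemma sum_payoff_slope:
  assumes U: "\<And>j. j \<in> {1..N} \<Longrightarrow> l2 L (\<lambda>s. U j s \<omega>)" and h: "l2 L h"
    and b: "\<And>j. j \<in> {1..N} \<Longrightarrow> l2 L (\<lambda>s. b j s \<omega>)" and b0: "l2 L (\<lambda>s. b0 s \<omega>)"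
  shows "(\<Sum>i=1..N. payoff_slope i h \<omega>) = real N * ip L h (\<lambda>s. foc s \<omega>)"
proof -
  interpret A1: volterra_kernel T C1 A1 by (rule A1)
  interpret A2: volterra_kernel T C2 A2h by (rule A2)
  interpret A3: volterra_kernel T C3 A3 by (rule A3)
  obtain C where "volterra_kernel T C K" using volterra_K by auto
  then interpret K: volterra_kernel T C K .
  note fin = finite_measure_leb[of T]
  have [simp]: "real N \<noteq> 0" using N_pos by simp
  define f where "f = (\<lambda>s. avg N U s \<omega>)"
  define x where "x = (\<lambda>s. X s \<omega>)"
  have f: "l2 L f" unfolding f_def avg_eq by (intro l2_cmult l2_sum U)
  have ab: "l2 L (\<lambda>s. avg N b s \<omega>)" unfolding avg_eq by (intro l2_cmult l2_sum b)
  have x: "l2 L x" unfolding x_def X_def using l2_add[OF ab l2_cmult[OF b0, of "1 / real N"]] by simp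
  have sumU: "(\<lambda>s. \<Sum>i=1..N. U i s \<omega>) = (\<lambda>s. real N * f s)"
    using N_pos by (simp add: f_def avg_def)
  have sumb: "(\<lambda>s. \<Sum>i=1..N. b i s \<omega>) = (\<lambda>s. real N * avg N b s \<omega>)"
    using N_pos by (simp add: avg_def)
  have sums: "(\<Sum>i=1..N. ip L (\<lambda>s. U i s \<omega>) h) = real N * ip L f h"
    "(\<Sum>i=1..N. bil L A2h (\<lambda>s. U i s \<omega>) h) = real N * bil L A2h f h"
    "(\<Sum>i=1..N. bil L A2h h (\<lambda>s. U i s \<omega>)) = real N * bil L A2h h f"
    "(\<Sum>i=1..N. bil L A3 (\<lambda>s. U i s \<omega>) h) = real N * bil L A3 f h"
    "(\<Sum>i=1..N. bil L A3 h (\<lambda>s. U i s \<omega>)) = real N * bil L A3 h f"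
    using ip_sum_left[where I = "{1..N}" and f = "\<lambda>i s. U i s \<omega>", OF U h]
      bil_sum_left[OF fin A2.rows, where I = "{1..N}" and f = "\<lambda>i s. U i s \<omega>", OF U h]
      bil_sum_right[OF fin A2.rows finite_atLeastAtMost, of 1 N "\<lambda>i s. U i s \<omega>", OF U h]
      bil_sum_left[OF fin A3.rows, where I = "{1..N}" and f = "\<lambda>i s. U i s \<omega>", OF U h]
      bil_sum_right[OF fin A3.rows finite_atLeastAtMost, of 1 N "\<lambda>i s. U i s \<omega>", OF U h]
    by (simp_all only: sumU ip_cmult_left bil_cmult_left bil_cmult_right)
  have sb: "(\<Sum>i=1..N. ip L (\<lambda>s. b i s \<omega>) h) = real N * ip L (\<lambda>s. avg N b s \<omega>) h"
    using ip_sum_left[where I = "{1..N}" and f = "\<lambda>i s. b i s \<omega>", OF b h]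
    by (simp only: sumb ip_cmult_left)
  have ipx: "ip L x h = ip L (\<lambda>s. avg N b s \<omega>) h + 1 / real N * ip L (\<lambda>s. b0 s \<omega>) h"
    using ip_add_left[OF ab b0 h, of "1 / real N"] by (simp add: x_def X_def)
  have "(\<Sum>i=1..N. payoff_slope i h \<omega>)
    = real N * (- 1 / real N * (bil L A1 f h + bil L A1 h f))
      - (2 * lam * (\<Sum>i=1..N. ip L (\<lambda>s. U i s \<omega>) h) + (\<Sum>i=1..N. bil L A2h (\<lambda>s. U i s \<omega>) h)
         + (\<Sum>i=1..N. bil L A2h h (\<lambda>s. U i s \<omega>)))
      - (real N * (bil L A3 h f + bil L A3 f h) + 1 / real N * ((\<Sum>i=1..N. bil L A3 (\<lambda>s. U i s \<omega>) h)
         + (\<Sum>i=1..N. bil L A3 h (\<lambda>s. U i s \<omega>))))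
      + (\<Sum>i=1..N. ip L (\<lambda>s. b i s \<omega>) h) + real N * (1 / real N * ip L (\<lambda>s. b0 s \<omega>) h)"
    unfolding payoff_slope_def Let_def f_def[symmetric]
    by (simp only: sum.distrib sum_subtractf sum_distrib_left[symmetric] sum_constant card_atLeastAtMost)
      (simp add: algebra_simps add_divide_distrib)
  also have "\<dots> = real N * (ip L x h - 2 * lam * ip L f h - bil L K f h - bil L K h f)"
    unfolding sums sb ipx bil_K[OF f h] bil_K[OF h f] by (simp add: algebra_simps add_divide_distrib)
  also have "ip L x h - 2 * lam * ip L f h - bil L K f h - bil L K h f = ip L h (\<lambda>s. foc s \<omega>)"
  proof -
    have "ip L h (\<lambda>s. foc s \<omega>)
      = ip L h (\<lambda>s. ((x s + (- (2 * lam)) * f s) + (- 1) * kint L K f s) + (- 1) * kint L (\<lambda>t s. K s t) f s)"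
      by (simp add: foc_def x_def f_def algebra_simps)
    also have "\<dots> = ip L h x + (- (2 * lam)) * ip L h f + (- 1) * ip L h (kint L K f)
        + (- 1) * ip L h (kint L (\<lambda>t s. K s t) f)"
      using x f h K.l2_kint_K[OF f] K.l2_kint_adj[OF f] l2_add[OF x l2_cmult[OF f, of "- (2 * lam)"]]
        l2_add[OF l2_add[OF x l2_cmult[OF f, of "- (2 * lam)"]] l2_cmult[OF K.l2_kint_K[OF f], of "- 1"]]
      by (simp only: ip_add_right)
    finally show ?thesis
      using bil_adj[OF fin K.rows h f] by (simp add: bil_eq_ip ip_commute[of L h x] ip_commute[of L h f])
  qed
  finally show ?thesis .
qed

theorem first_order_condition:
  assumes v: "admissible M F T v"
  shows "(\<integral>\<omega>. ip L (\<lambda>s. v s \<omega>) (\<lambda>s. foc s \<omega>) \<partial>M) = 0"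
proof -
  have "0 = (\<Sum>i=1..N. \<integral>\<omega>. payoff_slope i (\<lambda>s. v s \<omega>) \<omega> \<partial>M)"
    using payoff_slope_zero[OF _ v] by simp
  also have "\<dots> = (\<integral>\<omega>. (\<Sum>i=1..N. payoff_slope i (\<lambda>s. v s \<omega>) \<omega>) \<partial>M)"
    using payoff_slope_integrable[OF _ v] by (intro Bochner_Integration.integral_sum[symmetric])
  also have "\<dots> = (\<integral>\<omega>. real N * ip L (\<lambda>s. v s \<omega>) (\<lambda>s. foc s \<omega>) \<partial>M)"
  proof (rule integral_cong_AE)
    show "(\<lambda>\<omega>. \<Sum>i=1..N. payoff_slope i (\<lambda>s. v s \<omega>) \<omega>) \<in> borel_measurable M"
      using payoff_slope_integrable[OF _ v] by (intro borel_measurable_sum) auto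
    show "(\<lambda>\<omega>. real N * ip L (\<lambda>s. v s \<omega>) (\<lambda>s. foc s \<omega>)) \<in> borel_measurable M"
      using l2_proc_ip(1)[OF l2_proc_of_admissible[OF v] l2_proc_foc] by auto
    show "AE \<omega> in M. (\<Sum>i=1..N. payoff_slope i (\<lambda>s. v s \<omega>) \<omega>) = real N * ip L (\<lambda>s. v s \<omega>) (\<lambda>s. foc s \<omega>)"
      using AE_paths l2_proc_path[OF l2_proc_of_admissible[OF v]]
      by eventually_elim (rule sum_payoff_slope, auto)
  qed
  finally show ?thesis using N_pos by simp
qed

end

subsection \<open>Disintegration of the first-order condition\<close>

context filtered_prob_space
begin

lemma l2_proc_fst:
  assumes z: "l2 L z" shows "l2_proc (\<lambda>s \<omega>. z s)"
proof -
  interpret swap: pair_sigma_finite M L ..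
  have "integrable (M \<Otimes>\<^sub>M L) (\<lambda>p. (z (snd p))\<^sup>2)"
    by (rule integrable_snd_pair(1)[OF finite_measure_axioms L.sigma_finite_measure_axioms l2_square[OF z]])
  from swap.integrable_product_swap[OF this] have "integrable P (\<lambda>p. (z (fst p))\<^sup>2)"
    by (simp add: case_prod_beta')
  then show ?thesis
    using measurable_compose[OF measurable_fst[of L M] l2_measurable[OF z]] by (simp add: l2_def case_prod_beta')
qed

text \<open>At horizons before \<open>t\<close> the process is identically 0; from \<open>t\<close>
  on, \<open>A\<close> belongs to the sigma-algebra and \<open>z\<close> is deterministic. Both
  kinds of test process, the dual column and the indicator of a short interval, have this
  shape.\<close>

lemma admissible_elementary:
  assumes t: "t \<in> {0..T}" and z: "l2 L z" and head: "\<And>r. r \<in> {0..T} \<Longrightarrow> r < t \<Longrightarrow> z r = 0"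
    and A: "A \<in> sets (F t)"
  shows "admissible M F T (\<lambda>s \<omega>. z s * indicator A \<omega>)"
proof (rule admissible_of_l2_proc)
  show "prog_measurable M F T (\<lambda>s \<omega>. z s * indicator A \<omega>)"
    unfolding prog_measurable_def
  proof
    fix \<tau> assume \<tau>: "\<tau> \<in> {0..T}"
    let ?N = "restrict_space borel {0..\<tau>} \<Otimes>\<^sub>M F \<tau>"
    show "(\<lambda>(s, \<omega>). z s * indicator A \<omega>) \<in> borel_measurable ?N"
    proof (cases "\<tau> < t")
      case True
      have "(\<lambda>(s, \<omega>). z s * indicator A \<omega>) \<in> borel_measurable ?N \<longleftrightarrow> (\<lambda>_. 0 :: real) \<in> borel_measurable ?N"
        using head True \<tau> by (intro measurable_cong) (auto simp: space_pair_measure space_restrict_space)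
      then show ?thesis by simp
    next
      case False
      then have "A \<in> sets (F \<tau>)" using sets_F_mono[of t \<tau>] A t \<tau> by auto
      then have [measurable]: "(\<lambda>p. indicator A (snd p) :: real) \<in> borel_measurable ?N"
        by (intro measurable_compose[OF measurable_snd]) auto
      have "fst \<in> measurable ?N (restrict_space borel {0..T})"
        by (rule measurable_restrict_space2)
          (use \<tau> in \<open>auto simp: space_pair_measure space_restrict_space
            intro!: measurable_compose[OF measurable_fst] measurable_restrict_space1\<close>)
      then have "fst \<in> measurable ?N L"
        using measurable_cong_sets[OF refl sets_leb] by blast
      from measurable_compose[OF this l2_measurable[OF z]]
      have [measurable]: "(\<lambda>p. z (fst p)) \<in> borel_measurable ?N" .
      show ?thesis by (simp add: case_prod_beta')
    qed
  qed
  have AM: "A \<in> sets M" using A subalgebra_F[OF t] by (auto simp: subalgebra_def)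
  then have ind: "(\<lambda>p. indicator A (snd p) :: real) \<in> borel_measurable P"
    by (intro measurable_compose[OF measurable_snd]) auto
  have "(\<lambda>p. z (fst p) * indicator A (snd p)) \<in> borel_measurable P"
    using l2_measurable[OF l2_proc_fst[OF z]] ind by (intro borel_measurable_times) (simp_all add: case_prod_beta')
  with l2_proc_fst[OF z] show "l2_proc (\<lambda>s \<omega>. z s * indicator A \<omega>)"
    by (intro l2_bound[OF l2_proc_fst[OF z]]) (auto simp: indicator_def case_prod_beta')
qed

lemma integrable_extend_zero:
  assumes f: "integrable P (\<lambda>(s, \<omega>). f s \<omega>)"
  shows "integrable (lborel \<Otimes>\<^sub>M M) (\<lambda>(s, \<omega>). indicator {0..T} s * f s \<omega> :: real)"
proof -
  interpret BM: pair_sigma_finite "lborel :: real measure" M ..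
  \<comment> \<open>Clamping time to \<open>[0, T]\<close> maps the whole line measurably into the
    restricted space and changes nothing where the indicator is nonzero.\<close>
  have clamp: "(\<lambda>p. (max 0 (min T (fst p)), snd p)) \<in> measurable (lborel \<Otimes>\<^sub>M M) P"
  proof (rule measurable_Pair)
    have "(\<lambda>p. max 0 (min T (fst p))) \<in> measurable (lborel \<Otimes>\<^sub>M M) (restrict_space borel {0..T})"
      using T_pos by (intro measurable_restrict_space2) auto
    then show "(\<lambda>p. max 0 (min T (fst p))) \<in> measurable (lborel \<Otimes>\<^sub>M M) L"
      using measurable_cong_sets[OF refl sets_leb] by blast
  qed simp
  have "(\<lambda>p. indicator {0..T} (fst p) * f (max 0 (min T (fst p))) (snd p)) \<in> borel_measurable (lborel \<Otimes>\<^sub>M M)"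
    using measurable_compose[OF clamp borel_measurable_integrable[OF f]]
    by (intro borel_measurable_times) (auto intro!: measurable_compose[OF measurable_fst])
  moreover have "indicator {0..T} s * f (max 0 (min T s)) \<omega> = indicator {0..T} s * f s \<omega>" for s \<omega>
    by (auto simp: indicator_def min_def max_def)
  ultimately have m: "(\<lambda>(s, \<omega>). indicator {0..T} s * f s \<omega>) \<in> borel_measurable (lborel \<Otimes>\<^sub>M M)"
    by (simp add: case_prod_beta')
  show ?thesis
  proof (rule BM.Fubini_integrable[OF m])
    have "integrable L (\<lambda>s. \<integral>\<omega>. \<bar>f s \<omega>\<bar> \<partial>M)"
      using LM.integrable_fst'[OF integrable_abs[OF f]] by simp
    then have "integrable lborel (\<lambda>s. indicator {0..T} s *\<^sub>R (\<integral>\<omega>. \<bar>f s \<omega>\<bar> \<partial>M))"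
      by (simp add: integrable_restrict_space)
    also have "(\<lambda>s. indicator {0..T} s *\<^sub>R (\<integral>\<omega>. \<bar>f s \<omega>\<bar> \<partial>M))
      = (\<lambda>s. \<integral>\<omega>. norm (case (s, \<omega>) of (s, \<omega>) \<Rightarrow> indicator {0..T} s * f s \<omega>) \<partial>M)"
      by (auto simp: fun_eq_iff indicator_def)
    finally show "integrable lborel (\<lambda>s. \<integral>\<omega>. norm (case (s, \<omega>) of (s, \<omega>) \<Rightarrow> indicator {0..T} s * f s \<omega>) \<partial>M)" .
    have "AE s in L. integrable M (\<lambda>\<omega>. f s \<omega>)"
      using LM.AE_integrable_fst'[OF f] by simp
    then have "AE s in lborel. s \<in> {0..T} \<longrightarrow> integrable M (\<lambda>\<omega>. f s \<omega>)"
      by (simp add: AE_restrict_space_iff)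
    then show "AE s in lborel. integrable M (\<lambda>\<omega>. case (s, \<omega>) of (s, \<omega>) \<Rightarrow> indicator {0..T} s * f s \<omega>)"
      by eventually_elim (auto simp: indicator_def)
  qed
qed

lemma integral_path_measurable:
  fixes g :: "real \<Rightarrow> 'b \<Rightarrow> real"
  assumes "(\<lambda>(s, \<omega>). g s \<omega>) \<in> borel_measurable (L \<Otimes>\<^sub>M N)"
  shows "(\<lambda>\<omega>. \<integral>s. g s \<omega> \<partial>L) \<in> borel_measurable N"
proof (rule L.borel_measurable_lebesgue_integral)
  show "(\<lambda>(\<omega>, s). g s \<omega>) \<in> borel_measurable (N \<Otimes>\<^sub>M L)"
    using measurable_pair_swap[OF assms] by (simp add: case_prod_beta')
qed

lemma prog_measurable_section:
  assumes "prog_measurable M F T u" "t \<in> {0..T}"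
  shows "u t \<in> borel_measurable (F t)"
proof -
  have "(\<lambda>(s, \<omega>). u s \<omega>) \<in> borel_measurable (restrict_space borel {0..t} \<Otimes>\<^sub>M F t)"
    using assms by (auto simp: prog_measurable_def)
  moreover have "t \<in> space (restrict_space borel {0..t})"
    using assms by (simp add: space_restrict_space)
  then have "(\<lambda>\<omega>. (t, \<omega>)) \<in> measurable (F t) (restrict_space borel {0..t} \<Otimes>\<^sub>M F t)" by simp
  ultimately show ?thesis using measurable_compose[of "\<lambda>\<omega>. (t, \<omega>)" _ _ "\<lambda>(s, \<omega>). u s \<omega>"] by simp
qed

text \<open>\<open>min s t\<close> stays in \<open>[0, t]\<close>, where progressive measurability
  at \<open>t\<close> applies. Through this lemma an integral of the past of a process against a
  Volterra row is seen to be measurable for \<open>F t\<close>.\<close>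

lemma prog_measurable_stopped:
  assumes "prog_measurable M F T u" and t: "t \<in> {0..T}"
  shows "(\<lambda>(s, \<omega>). u (min s t) \<omega>) \<in> borel_measurable (L \<Otimes>\<^sub>M F t)"
proof -
  have u: "(\<lambda>(s, \<omega>). u s \<omega>) \<in> borel_measurable (restrict_space borel {0..t} \<Otimes>\<^sub>M F t)"
    using assms by (auto simp: prog_measurable_def)
  have "(\<lambda>p. min (fst p) t) \<in> borel_measurable (L \<Otimes>\<^sub>M F t)"
    by (intro measurable_compose[OF measurable_fst] leb_borel_measurable) simp
  then have "(\<lambda>p. min (fst p) t) \<in> measurable (L \<Otimes>\<^sub>M F t) (restrict_space borel {0..t})"
    using t by (intro measurable_restrict_space2) (auto simp: space_pair_measure)
  then have "(\<lambda>p. (min (fst p) t, snd p)) \<in> measurable (L \<Otimes>\<^sub>M F t) (restrict_space borel {0..t} \<Otimes>\<^sub>M F t)"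
    by (intro measurable_Pair) auto
  from measurable_compose[OF this u] show ?thesis by (simp add: case_prod_beta')
qed

lemma subalgebra_pair: "t \<in> {0..T} \<Longrightarrow> subalgebra P (L \<Otimes>\<^sub>M F t)"
proof -
  assume t: "t \<in> {0..T}"
  have id: "(\<lambda>p. p) \<in> measurable P (L \<Otimes>\<^sub>M F t)"
  proof -
    have "(\<lambda>p. (fst p, snd p)) \<in> measurable P (L \<Otimes>\<^sub>M F t)"
      by (intro measurable_Pair measurable_fst measurable_compose[OF measurable_snd[of L M] id_measurable_F[OF t]])
    then show ?thesis by simp
  qed
  have sp: "space (L \<Otimes>\<^sub>M F t) = space P" by (simp add: space_pair_measure space_F[OF t])
  have "sets (L \<Otimes>\<^sub>M F t) \<subseteq> sets P"
  proof
    fix B assume B: "B \<in> sets (L \<Otimes>\<^sub>M F t)"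
    from measurable_sets[OF id B] sets.sets_into_space[OF B] sp show "B \<in> sets P"
      by (simp add: Int_absorb2)
  qed
  with sp show ?thesis by (simp add: subalgebra_def)
qed

text \<open>Conditioning once on the product space yields a version measurable in both variables, so
  that its integrals over \<open>r\<close> are measurable for \<open>F t\<close>; versions chosen
  separately for each \<open>r\<close> would not ensure this. Square integrability is Jensen's
  inequality for the conditional expectation.\<close>

lemma cond_exp_pair:
  assumes t: "t \<in> {0..T}" and X: "l2_proc X"
  defines "Y \<equiv> cond_exp_proc M F T t X"
  shows "(\<lambda>(r, \<omega>). Y r \<omega>) \<in> borel_measurable (L \<Otimes>\<^sub>M F t)"
    and "l2_proc Y"
    and "\<And>f. f \<in> borel_measurable (L \<Otimes>\<^sub>M F t) \<Longrightarrow> l2 P f \<Longrightarrow>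
      (\<integral>(r, \<omega>). f (r, \<omega>) * Y r \<omega> \<partial>P) = (\<integral>(r, \<omega>). f (r, \<omega>) * X r \<omega> \<partial>P)"
proof -
  interpret S: finite_measure_subalgebra P "L \<Otimes>\<^sub>M F t"
    by unfold_locales (rule subalgebra_pair[OF t])
  have Y: "(\<lambda>(r, \<omega>). Y r \<omega>) = real_cond_exp P (L \<Otimes>\<^sub>M F t) (\<lambda>(r, \<omega>). X r \<omega>)"
    by (simp add: Y_def cond_exp_proc_def fun_eq_iff)
  show Ym: "(\<lambda>(r, \<omega>). Y r \<omega>) \<in> borel_measurable (L \<Otimes>\<^sub>M F t)"
    unfolding Y by (rule borel_measurable_cond_exp)
  have cvx: "convex_on UNIV (\<lambda>x::real. x\<^sup>2)"
    by (rule convex_power2)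
  have "integrable P (\<lambda>p. (real_cond_exp P (L \<Otimes>\<^sub>M F t) (\<lambda>(r, \<omega>). X r \<omega>) p)\<^sup>2)"
    by (rule S.integrable_convex_cond_exp[where I = UNIV and q = "\<lambda>x. x\<^sup>2"])
      (use P.l2_integrable[OF X] l2_square[OF X] cvx in auto)
  then show "l2_proc Y"
    using measurable_from_subalg[OF subalgebra_pair[OF t] Ym] by (simp add: l2_def Y)
  fix f assume f: "f \<in> borel_measurable (L \<Otimes>\<^sub>M F t)" "l2 P f"
  have "(\<integral>p. f p * real_cond_exp P (L \<Otimes>\<^sub>M F t) (\<lambda>(r, \<omega>). X r \<omega>) p \<partial>P) = (\<integral>p. f p * (case p of (r, \<omega>) \<Rightarrow> X r \<omega>) \<partial>P)"
    by (rule S.real_cond_exp_intg(2)[OF l2_mult_integrable[OF f(2) X] f(1) l2_measurable[OF X]])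
  then show "(\<integral>(r, \<omega>). f (r, \<omega>) * Y r \<omega> \<partial>P) = (\<integral>(r, \<omega>). f (r, \<omega>) * X r \<omega> \<partial>P)"
    unfolding Y[symmetric] by (simp add: case_prod_beta')
qed

lemma AE_zero_of_section_orthogonal:
  fixes W :: "'a \<Rightarrow> real"
  assumes t: "t \<in> {0..T}" and W: "W \<in> borel_measurable (F t)" "integrable M W"
    and orth: "\<And>A. A \<in> sets (F t) \<Longrightarrow> (\<integral>\<omega>. indicator A \<omega> * W \<omega> \<partial>M) = 0"
  shows "AE \<omega> in M. W \<omega> = 0"
proof -
  let ?A = "{\<omega> \<in> space (F t). 0 \<le> W \<omega>}" and ?B = "{\<omega> \<in> space (F t). W \<omega> < 0}"
  have A: "?A \<in> sets (F t)" and B: "?B \<in> sets (F t)" using W(1) by measurable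
  have AB: "?A \<in> sets M" "?B \<in> sets M" using A B subalgebra_F[OF t] by (auto simp: subalgebra_def)
  note i = integrable_mult_indicator[OF AB(1) W(2), simplified] integrable_mult_indicator[OF AB(2) W(2), simplified]
  have "(\<integral>\<omega>. \<bar>W \<omega>\<bar> \<partial>M) = (\<integral>\<omega>. indicator ?A \<omega> * W \<omega> - indicator ?B \<omega> * W \<omega> \<partial>M)"
    by (intro Bochner_Integration.integral_cong) (auto simp: indicator_def space_F[OF t])
  also have "\<dots> = (\<integral>\<omega>. indicator ?A \<omega> * W \<omega> \<partial>M) - (\<integral>\<omega>. indicator ?B \<omega> * W \<omega> \<partial>M)"
    by (rule Bochner_Integration.integral_diff[OF i])
  also have "\<dots> = 0" using orth[OF A] orth[OF B] by simp
  finally have "(\<integral>\<omega>. \<bar>W \<omega>\<bar> \<partial>M) = 0" .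
  then have "AE \<omega> in M. \<bar>W \<omega>\<bar> = 0"
    using W(2) by (subst (asm) integral_nonneg_eq_0_iff_AE) auto
  then show ?thesis by simp
qed

end

context stochastic_game
begin

abbreviation "m \<equiv> avg N U"

text \<open>The indicator of \<open>[t, t + h]\<close> vanishes before \<open>t\<close>, so its
  product with an event of \<open>F t\<close> is an admissible test. The window may run past
  \<open>T\<close>, hence the extension of \<open>foc\<close> by zero to the whole line.\<close>

lemma AE_foc_orthogonal:
  "AE t in lborel. t \<in> {0..T} \<longrightarrow> (\<forall>A\<in>sets (F t). (\<integral>\<omega>. indicator A \<omega> * foc t \<omega> \<partial>M) = 0)"
proof -
  have "integrable P (\<lambda>(s, \<omega>). foc s \<omega>)" by (rule P.l2_integrable[OF l2_proc_foc])
  note int = integrable_extend_zero[OF this]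
  have "AE t in lborel. t \<in> {0..T} \<longrightarrow> (\<forall>A\<in>sets (F t).
      (\<integral>\<omega>. indicator A \<omega> * (case (t, \<omega>) of (s, \<omega>) \<Rightarrow> indicator {0..T} s * foc s \<omega>) \<partial>M) = 0)"
  proof (rule AE_section_orthogonal[OF prob_space_axioms int])
    show "sets (F t) \<subseteq> sets M" if "t \<in> {0..T}" for t
      using subalgebra_F[OF that] by (simp add: subalgebra_def)
    fix t h A assume t: "t \<in> {0..T}" and "0 < (h :: real)" and A: "A \<in> sets (F t)"
    have z: "l2 L (\<lambda>s. indicator {t..t + h} s)"
      by (rule l2_bound[OF L.l2_const[of 1]]) (auto intro!: leb_borel_measurable)
    have adm: "admissible M F T (\<lambda>s \<omega>. indicator {t..t + h} s * indicator A \<omega>)"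
      by (rule admissible_elementary[OF t z _ A]) auto
    have "(\<integral>s. indicator A \<omega> * (indicator {t..t + h} s * (case (s, \<omega>) of (s, \<omega>) \<Rightarrow> indicator {0..T} s * foc s \<omega>)) \<partial>lborel)
      = ip L (\<lambda>s. indicator {t..t + h} s * indicator A \<omega>) (\<lambda>s. foc s \<omega>)" for \<omega>
    proof -
      have "ip L (\<lambda>s. indicator {t..t + h} s * indicator A \<omega>) (\<lambda>s. foc s \<omega>)
        = (\<integral>s. indicator {0..T} s *\<^sub>R (indicator {t..t + h} s * indicator A \<omega> * foc s \<omega>) \<partial>lborel)"
        unfolding ip_def by (rule integral_restrict_space) simp
      then show ?thesis by (simp add: mult_ac)
    qed
    then show "(\<integral>\<omega>. (\<integral>s. indicator A \<omega> * (indicator {t..t + h} s * (case (s, \<omega>) of (s, \<omega>) \<Rightarrow>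
        indicator {0..T} s * foc s \<omega>)) \<partial>lborel) \<partial>M) = 0"
      using first_order_condition[OF adm] by simp
  qed
  then show ?thesis by eventually_elim auto
qed

lemma prog_m: "prog_measurable M F T m"
proof -
  have "\<forall>i\<in>{1..N}. prog_measurable M F T (U i)" using U_admissible by (simp add: admissible_def)
  then show ?thesis unfolding prog_measurable_def avg_eq case_prod_beta'
    by (intro ballI borel_measurable_times borel_measurable_const borel_measurable_sum) auto
qed

lemma prog_X: "prog_measurable M F T X"
proof -
  have "\<forall>i\<in>{1..N}. prog_measurable M F T (b i)" using b by (simp add: admissible_def)
  moreover have "prog_measurable M F T b0" using b0 by (simp add: admissible_def)
  ultimately show ?thesis unfolding prog_measurable_def X_def avg_eq case_prod_beta'
    by (intro ballI borel_measurable_add borel_measurable_divide borel_measurable_times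
        borel_measurable_const borel_measurable_sum) auto
qed

section \<open>The equilibrium equation at a fixed time\<close>

context
  fixes C assumes K: "volterra_kernel T C K"
begin

interpretation K: volterra_kernel T C K by (rule K)

abbreviation "V \<equiv> volterra_kernel.volterra_resolvent T C K lam"
abbreviation "z \<equiv> volterra_kernel.dual_col T C K lam"

text \<open>Besides the adjoint term, the value of \<open>K m\<close> at \<open>t\<close> also
  occurs in both parts and drops out, so \<open>m\<close> enters only through \<open>m t\<close> and
  the resolvent, that is through its present and past.\<close>

lemma ip_dual_foc:
  assumes t: "t \<in> {0..T}" and mo: "l2 L (\<lambda>s. m s \<omega>)" and Xo: "l2 L (\<lambda>s. X s \<omega>)"
  shows "foc t \<omega> - ip L (z t) (\<lambda>s. foc s \<omega>)
    = X t \<omega> - ip L (z t) (\<lambda>s. X s \<omega>) - 2 * lam * (m t \<omega> - kint L V (\<lambda>s. m s \<omega>) t)"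
proof -
  let ?R = "\<lambda>s. 2 * lam * m s \<omega> + kint L K (\<lambda>r. m r \<omega>) s + kint L (\<lambda>t s. K s t) (\<lambda>r. m r \<omega>) s"
  have R: "l2 L ?R" by (intro l2_add l2_cmult mo K.l2_kint_K K.l2_kint_adj)
  have "ip L (z t) (\<lambda>s. foc s \<omega>) = ip L (z t) (\<lambda>s. X s \<omega> + (- 1) * ?R s)"
  proof -
    have "foc s \<omega> = X s \<omega> + (- 1) * ?R s" for s by (simp add: foc_def)
    then show ?thesis by (simp only:)
  qed
  also have "\<dots> = ip L (z t) (\<lambda>s. X s \<omega>) + (- 1) * ip L (z t) ?R"
    by (rule ip_add_right[OF Xo R K.l2_dual_col[OF lam_pos t]])
  finally have "ip L (z t) (\<lambda>s. foc s \<omega>) = ip L (z t) (\<lambda>s. X s \<omega>)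
      - (kint L (\<lambda>t s. K s t) (\<lambda>s. m s \<omega>) t + 2 * lam * kint L V (\<lambda>s. m s \<omega>) t + kint L K (\<lambda>s. m s \<omega>) t)"
    using K.integral_dual_col_mult[OF lam_pos t mo] by (simp add: ip_def)
  then show ?thesis by (simp add: foc_def algebra_simps)
qed

lemma integral_indicator_ip:
  assumes t: "t \<in> {0..T}" and A: "A \<in> sets (F t)" and u: "l2_proc u"
  shows "(\<integral>\<omega>. indicator A \<omega> * ip L (z t) (\<lambda>s. u s \<omega>) \<partial>M) = (\<integral>(s, \<omega>). (z t s * indicator A \<omega>) * u s \<omega> \<partial>P)"
    and "admissible M F T (\<lambda>s \<omega>. z t s * indicator A \<omega>)"
proof -
  show adm: "admissible M F T (\<lambda>s \<omega>. z t s * indicator A \<omega>)"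
    by (rule admissible_elementary[OF t K.l2_dual_col[OF lam_pos t] K.dual_col_head[OF lam_pos t] A])
  have "indicator A \<omega> * ip L (z t) (\<lambda>s. u s \<omega>) = ip L (\<lambda>s. z t s * indicator A \<omega>) (\<lambda>s. u s \<omega>)" for \<omega>
    using ip_cmult_left[of L "indicator A \<omega>" "z t" "\<lambda>s. u s \<omega>"] by (simp add: mult.commute)
  then show "(\<integral>\<omega>. indicator A \<omega> * ip L (z t) (\<lambda>s. u s \<omega>) \<partial>M) = (\<integral>(s, \<omega>). (z t s * indicator A \<omega>) * u s \<omega> \<partial>P)"
    using l2_proc_ip(2)[OF l2_proc_of_admissible[OF adm] u] by simp
qed

text \<open>\<open>W\<close> is the defect of the claimed identity, up to the factor
  \<open>2 * lam\<close>. Being measurable for \<open>F t\<close>, it vanishes as soon as it is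
  orthogonal to every event of \<open>F t\<close>. For that test it is rewritten as
  \<open>W'\<close>, where the \<open>foc\<close> terms have zero expectation on such events and the
  terms in \<open>X\<close> and \<open>Y\<close> agree.\<close>

lemma equilibrium_at:
  assumes t: "t \<in> {0..T}"
    and orth: "\<forall>A\<in>sets (F t). (\<integral>\<omega>. indicator A \<omega> * foc t \<omega> \<partial>M) = 0"
    and foc_int: "integrable M (foc t)"
  defines "Y \<equiv> cond_exp_proc M F T t X"
  shows "AE \<omega> in M. m t \<omega> - kint L V (\<lambda>s. m s \<omega>) t = 1 / (2 * lam) * (X t \<omega> - ip L (z t) (\<lambda>r. Y r \<omega>))"
proof -
  note Y = cond_exp_pair[OF t l2_proc_X, folded Y_def]
  note zt = K.l2_dual_col[OF lam_pos t]
  define W where "W \<omega> = X t \<omega> - ip L (z t) (\<lambda>r. Y r \<omega>) - 2 * lam * (m t \<omega> - kint L V (\<lambda>s. m s \<omega>) t)" for \<omega>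
  obtain C' where V: "l2_rows L C' V" using K.volterra_resolvent_rows[OF lam_pos] by auto
  have Wm: "W \<in> borel_measurable (F t)"
  proof -
    have "z t \<in> borel_measurable L" by (rule l2_measurable[OF zt])
    then have zY: "(\<lambda>(r, \<omega>). z t r * Y r \<omega>) \<in> borel_measurable (L \<Otimes>\<^sub>M F t)"
      using Y(1) by (simp add: case_prod_beta')
    have "V t \<in> borel_measurable L" using l2_measurable[OF l2_rows_l2[OF V]] t by simp
    then have Vm: "(\<lambda>(r, \<omega>). V t r * m (min r t) \<omega>) \<in> borel_measurable (L \<Otimes>\<^sub>M F t)"
      using prog_measurable_stopped[OF prog_m t] by (simp add: case_prod_beta')
    \<comment> \<open>The row \<open>V t\<close> vanishes from \<open>t\<close> on, so
      \<open>m\<close> may be frozen at \<open>t\<close> without changing the integral, which then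
      involves \<open>F t\<close> only.\<close>
    have "kint L V (\<lambda>s. m s \<omega>) t = (\<integral>r. V t r * m (min r t) \<omega> \<partial>L)" for \<omega>
      unfolding kint_def
      by (intro Bochner_Integration.integral_cong) (auto simp: K.volterra_resolvent_def min_def)
    then show ?thesis
      using integral_path_measurable[OF zY] integral_path_measurable[OF Vm]
        prog_measurable_section[OF prog_X t] prog_measurable_section[OF prog_m t]
      unfolding W_def[abs_def] ip_def by simp
  qed
  define W' where "W' \<omega> = foc t \<omega> - ip L (z t) (\<lambda>s. foc s \<omega>)
      + (ip L (z t) (\<lambda>s. X s \<omega>) - ip L (z t) (\<lambda>s. Y s \<omega>))" for \<omega>
  have WW': "AE \<omega> in M. W \<omega> = W' \<omega>"
    using l2_proc_path[OF l2_proc_m] l2_proc_path[OF l2_proc_X]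
  proof eventually_elim
    case (elim \<omega>)
    show ?case using ip_dual_foc[OF t elim] by (simp add: W_def W'_def)
  qed
  note ints = foc_int l2_proc_ip(1)[OF l2_proc_fst[OF zt] l2_proc_foc]
    l2_proc_ip(1)[OF l2_proc_fst[OF zt] l2_proc_X] l2_proc_ip(1)[OF l2_proc_fst[OF zt] Y(2)]
  have W': "integrable M W'" unfolding W'_def[abs_def] using ints by simp
  have WmM: "W \<in> borel_measurable M" by (rule measurable_from_subalg[OF subalgebra_F[OF t] Wm])
  have W: "integrable M W"
    by (rule integrable_cong_AE_imp[OF W' WmM]) (use WW' in auto)
  have "AE \<omega> in M. W \<omega> = 0"
  proof (rule AE_zero_of_section_orthogonal[OF t Wm W])
    fix A assume A: "A \<in> sets (F t)"
    have AM: "A \<in> sets M" using A subalgebra_F[OF t] by (auto simp: subalgebra_def)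
    note ints' = ints[THEN integrable_mult_indicator[OF AM], simplified]
    have Wi: "(\<integral>\<omega>. indicator A \<omega> * W \<omega> \<partial>M) = (\<integral>\<omega>. indicator A \<omega> * W' \<omega> \<partial>M)"
    proof (rule integral_cong_AE)
      show "AE \<omega> in M. indicator A \<omega> * W \<omega> = indicator A \<omega> * W' \<omega>"
        using WW' by eventually_elim simp
    qed (use AM WmM W' in auto)
    also have "\<dots> = (\<integral>\<omega>. indicator A \<omega> * foc t \<omega> - indicator A \<omega> * ip L (z t) (\<lambda>s. foc s \<omega>)
        + (indicator A \<omega> * ip L (z t) (\<lambda>s. X s \<omega>) - indicator A \<omega> * ip L (z t) (\<lambda>s. Y s \<omega>)) \<partial>M)"
      by (simp add: W'_def algebra_simps)
    also have "\<dots> = (\<integral>\<omega>. indicator A \<omega> * foc t \<omega> \<partial>M) - (\<integral>\<omega>. indicator A \<omega> * ip L (z t) (\<lambda>s. foc s \<omega>) \<partial>M)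
        + ((\<integral>\<omega>. indicator A \<omega> * ip L (z t) (\<lambda>s. X s \<omega>) \<partial>M) - (\<integral>\<omega>. indicator A \<omega> * ip L (z t) (\<lambda>s. Y s \<omega>) \<partial>M))"
      using ints' by simp
    also have "(\<integral>\<omega>. indicator A \<omega> * foc t \<omega> \<partial>M) = 0" using orth A by auto
    also have "(\<integral>\<omega>. indicator A \<omega> * ip L (z t) (\<lambda>s. foc s \<omega>) \<partial>M) = 0"
      using first_order_condition[OF integral_indicator_ip(2)[OF t A l2_proc_foc]]
        l2_proc_ip(2)[OF l2_proc_of_admissible[OF integral_indicator_ip(2)[OF t A l2_proc_foc]] l2_proc_foc]
        integral_indicator_ip(1)[OF t A l2_proc_foc] by simp
    \<comment> \<open>\<open>z t\<close> is deterministic and \<open>A\<close> lies in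
      \<open>F t\<close>, so their product is a legitimate test function for the conditional
      expectation \<open>Y\<close>.\<close>
    also have "(\<integral>\<omega>. indicator A \<omega> * ip L (z t) (\<lambda>s. X s \<omega>) \<partial>M) = (\<integral>\<omega>. indicator A \<omega> * ip L (z t) (\<lambda>s. Y s \<omega>) \<partial>M)"
    proof -
      have "(\<lambda>p. indicator A (snd p) :: real) \<in> borel_measurable (L \<Otimes>\<^sub>M F t)"
        using A by (intro measurable_compose[OF measurable_snd]) auto
      then have "(\<lambda>(s, \<omega>). z t s * indicator A \<omega>) \<in> borel_measurable (L \<Otimes>\<^sub>M F t)"
        using measurable_compose[OF measurable_fst[of L "F t"] l2_measurable[OF zt]]
        by (simp add: case_prod_beta')
      from Y(3)[OF this l2_proc_of_admissible[OF integral_indicator_ip(2)[OF t A l2_proc_X]]]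
      show ?thesis
        using integral_indicator_ip(1)[OF t A l2_proc_X] integral_indicator_ip(1)[OF t A Y(2)] by simp
    qed
    finally show "(\<integral>\<omega>. indicator A \<omega> * W \<omega> \<partial>M) = 0" by simp
  qed
  then show ?thesis
  proof eventually_elim
    case (elim \<omega>)
    then show ?case using lam_pos by (simp add: W_def field_simps)
  qed
qed

section \<open>Identification with the operators of the statement\<close>

lemma kernels_HG:
  "\<exists>C. volterra_kernel T C (Hk N A1 A3)" "\<exists>C. volterra_kernel T C (Gk N A1 A2h A3)"
proof -
  have "volterra_kernel T ((1 / real N)\<^sup>2 * C1) (\<lambda>t s. 1 / real N * A1 t s)"
    by (rule volterra_kernel_cmult[OF A1]) simp
  from volterra_kernel_add[OF this A3] show "\<exists>C. volterra_kernel T C (Hk N A1 A3)"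
    by (auto simp: Hk_def)
  have "volterra_kernel T ((1 / (real N)\<^sup>2)\<^sup>2 * C1) (\<lambda>t s. 1 / (real N)\<^sup>2 * A1 t s)"
    by (rule volterra_kernel_cmult[OF A1]) simp
  moreover have "volterra_kernel T ((2 / real N)\<^sup>2 * C3) (\<lambda>t s. 2 / real N * A3 t s)"
    by (rule volterra_kernel_cmult[OF A3]) simp
  ultimately have "volterra_kernel T (2 * ((1 / (real N)\<^sup>2)\<^sup>2 * C1) + 2 * ((2 / real N)\<^sup>2 * C3))
      (\<lambda>t s. 1 / (real N)\<^sup>2 * A1 t s + 2 / real N * A3 t s)"
    by (rule volterra_kernel_add)
  from volterra_kernel_add[OF this A2] show "\<exists>C. volterra_kernel T C (Gk N A1 A2h A3)"
    by (auto simp: Gk_def)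
qed

lemma Dbar_eq:
  assumes f: "L2 T f" and r: "r \<in> {0..T}"
  shows "Dbar N T A1 lam A2h A3 t f r = 2 * lam * f r + kint L (K.sym_cut t) f r"
proof -
  obtain CH where CH: "volterra_kernel T CH (Hk N A1 A3)" using kernels_HG(1) by auto
  obtain CG where CG: "volterra_kernel T CG (Gk N A1 A2h A3)" using kernels_HG(2) by auto
  interpret H: volterra_kernel T CH "Hk N A1 A3" by (rule CH)
  interpret G: volterra_kernel T CG "Gk N A1 A2h A3" by (rule CG)
  let ?c = "(real N - 1) / real N"
  have f': "l2 L f" using f by (simp add: L2_iff)
  have rL: "r \<in> space L" using r by simp
  have K_HG: "K t s = ?c * Hk N A1 A3 t s + Gk N A1 A2h A3 t s" for t s by (simp add: Kbar_def)
  have 1: "kint L (\<lambda>r s. if t \<le> s then K r s else 0) f r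
    = ?c * kint L (cut (Hk N A1 A3) t) f r + kint L (cut (Gk N A1 A2h A3) t) f r"
  proof -
    have "(\<lambda>r s. if t \<le> s then K r s else 0)
      = (\<lambda>r s. ?c * (if t \<le> s then Hk N A1 A3 r s else 0) + (if t \<le> s then Gk N A1 A2h A3 r s else 0))"
      by (auto simp: K_HG fun_eq_iff)
    then show ?thesis
      using kint_kernel_add[OF l2_rows_cmult[OF H.cut_rows, of ?c t] G.cut_rows[of t] f' rL]
        kint_kernel_cmult[of L ?c] by (simp add: cut_def)
  qed
  have 2: "kint L (\<lambda>r s. if t \<le> r then K s r else 0) f r
    = ?c * kint L (adj (cut (Hk N A1 A3) t)) f r + kint L (adj (cut (Gk N A1 A2h A3) t)) f r"
  proof -
    have "(\<lambda>r s. if t \<le> r then K s r else 0)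
      = (\<lambda>r s. ?c * (if t \<le> r then Hk N A1 A3 s r else 0) + (if t \<le> r then Gk N A1 A2h A3 s r else 0))"
      by (auto simp: K_HG fun_eq_iff)
    then show ?thesis
      using kint_kernel_add[OF l2_rows_cmult[OF H.cut_cols, of ?c t] G.cut_cols[of t] f' rL]
        kint_kernel_cmult[of L ?c] by (simp add: cut_def adj_def)
  qed
  have "kint L (K.sym_cut t) f r = kint L (\<lambda>r s. if t \<le> s then K r s else 0) f r
      + kint L (\<lambda>r s. if t \<le> r then K s r else 0) f r"
    unfolding K.sym_cut_def by (rule kint_kernel_add[OF K.cut_rows K.cut_cols f' rL])
  then show ?thesis
    unfolding Dbar_def kop_eq 1 2 by (simp add: algebra_simps)
qed

lemma op_invertible_Dbar: "op_invertible T (Dbar N T A1 lam A2h A3 t)"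
  using K.op_invertible_sym_cut[OF lam_pos, of t] Dbar_eq[of _ _ t]
  by (subst op_invertible_cong) auto

text \<open>The value of \<open>op_inv\<close> is known only up to null sets, but
  \<open>Bbar\<close> and \<open>abar_formula\<close> use the inverse of \<open>Dbar\<close> only
  inside an inner product with the tail column. Self-adjointness turns this into an integral against
  \<open>dual_col\<close>, which absorbs the cut-off on \<open>y\<close>. For \<open>Bbar\<close>,
  \<open>y\<close> is a column of \<open>K\<close>; for \<open>abar_formula\<close>, it is a path of
  the conditional expectation.\<close>

lemma l2inner_op_inv_Dbar:
  assumes t: "t \<in> {0..T}" and y: "l2 L y"
  shows "l2inner T (\<lambda>r. if t \<le> r then K r t else 0)
      (op_inv T (Dbar N T A1 lam A2h A3 t) (\<lambda>r. if t \<le> r then y r else 0)) = ip L (z t) y"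
proof -
  let ?y = "\<lambda>r. if t \<le> r then y r else 0" and ?D = "Dbar N T A1 lam A2h A3 t"
  have y_eq: "?y = (\<lambda>r. indicator {t..} r * y r)" by (auto simp: indicator_def)
  have y': "l2 L ?y" unfolding y_eq by (rule K.l2_tail[OF y])
  note inv = op_inv_L2[OF op_invertible_Dbar, of ?y t, unfolded L2_iff L2_eq_iff, OF y']
  have eq: "AE r in L. 2 * lam * op_inv T ?D ?y r + kint L (K.sym_cut t) (op_inv T ?D ?y) r = ?y r"
    using inv(2) AE_space
  proof eventually_elim
    case (elim r)
    then show ?case using Dbar_eq[of "op_inv T ?D ?y" r t] inv(1) by (simp add: L2_iff)
  qed
  have "l2inner T (\<lambda>r. if t \<le> r then K r t else 0) (op_inv T ?D ?y) = (\<integral>r. K.tail_col t r * op_inv T ?D ?y r \<partial>L)"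
    by (simp add: l2inner_eq K.tail_col_def)
  also have "\<dots> = (\<integral>r. z t r * ?y r \<partial>L)"
    by (rule K.integral_tail_col_mult[OF lam_pos t inv(1) l2_measurable[OF y'] eq])
  also have "\<dots> = ip L (z t) y"
    unfolding ip_def using K.dual_col_head[OF lam_pos t]
    by (intro Bochner_Integration.integral_cong) auto
  finally show ?thesis .
qed

lemma Bbar_eq:
  assumes "t \<in> {0..T}" "s \<in> {0..T}"
  shows "Bbar N T A1 lam A2h A3 t s = V t s"
  unfolding Bbar_def l2inner_op_inv_Dbar[OF assms(1) K.l2_col[OF assms(2)]] K.volterra_resolvent_def
  by (simp add: ip_def)

lemma kop_Bbar: "r \<in> {0..T} \<Longrightarrow> kop T (Bbar N T A1 lam A2h A3) f r = kint L V f r"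
  unfolding kop_eq kint_def using Bbar_eq by (intro Bochner_Integration.integral_cong) auto

lemma op_invertible_Bbar: "op_invertible T (\<lambda>f r. f r - kop T (Bbar N T A1 lam A2h A3) f r)"
proof -
  obtain C' where "C' > 0" "l2_rows L C' V" using K.volterra_resolvent_rows[OF lam_pos] by auto
  then have "op_invertible T (\<lambda>f r. f r - kop T V f r)"
    by (intro op_invertible_id_minus_volterra) (auto simp: K.volterra_resolvent_volterra)
  then show ?thesis
    by (subst op_invertible_cong) (auto simp: kop_Bbar[unfolded kop_eq] kop_eq)
qed

text \<open>Holds almost surely: the equation characterising \<open>op_inv\<close> is at hand only
  where the conditional expectation has a square-integrable path.\<close>

lemma abar_formula_eq:
  assumes t: "t \<in> {0..T}"
  shows "AE \<omega> in M. abar_formula M F N T A1 lam A2h A3 b0 b t \<omega>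
    = 1 / (2 * lam) * (X t \<omega> - ip L (z t) (\<lambda>r. cond_exp_proc M F T t X r \<omega>))"
  using l2_proc_path[OF cond_exp_pair(2)[OF t l2_proc_X]]
proof eventually_elim
  case (elim \<omega>)
  have X_eq: "(\<lambda>r \<omega>'. avg N b r \<omega>' + b0 r \<omega>' / real N) = X" by (simp add: fun_eq_iff X_def)
  show ?case
    unfolding abar_formula_def X_eq Let_def l2inner_op_inv_Dbar[OF t elim] ..
qed

text \<open>Here \<open>abar\<close> is any jointly measurable process that agrees with the formula
  almost surely at each time. The equation is obtained almost surely for almost every
  \<open>t\<close>; joint measurability lets the two quantifiers be exchanged, and injectivity of
  \<open>id - Bbar\<close> then recovers \<open>m\<close> path by path.\<close>

lemma mean_equilibrium:
  assumes abar: "(\<lambda>(t, \<omega>). abar t \<omega>) \<in> borel_measurable P"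
    and formula: "\<forall>t\<in>{0..T}. AE \<omega> in M. abar t \<omega> = abar_formula M F N T A1 lam A2h A3 b0 b t \<omega>"
  shows "AE \<omega> in M. AE t in lborel. t \<in> {0..T} \<longrightarrow>
    m t \<omega> = op_inv T (\<lambda>f r. f r - kop T (Bbar N T A1 lam A2h A3) f r) (\<lambda>s. abar s \<omega>) t"
proof -
  let ?B = "\<lambda>f r. f r - kop T (Bbar N T A1 lam A2h A3) f r"
  obtain C' where V: "l2_rows L C' V" using K.volterra_resolvent_rows[OF lam_pos] by auto
  have "AE t in L. integrable M (foc t)"
    using LM.AE_integrable_fst'[OF P.l2_integrable[OF l2_proc_foc]] by simp
  moreover have "AE t in L. \<forall>A\<in>sets (F t). (\<integral>\<omega>. indicator A \<omega> * foc t \<omega> \<partial>M) = 0"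
    using AE_foc_orthogonal by (simp add: AE_restrict_space_iff)
  ultimately have "AE t in L. AE \<omega> in M. abar t \<omega> = m t \<omega> - kint L V (\<lambda>s. m s \<omega>) t"
    using AE_space
  proof eventually_elim
    case (elim t)
    then have t: "t \<in> {0..T}" by simp
    from formula t have "AE \<omega> in M. abar t \<omega> = abar_formula M F N T A1 lam A2h A3 b0 b t \<omega>" by auto
    with abar_formula_eq[OF t] equilibrium_at[OF t elim(2,1)] show ?case
      by eventually_elim simp
  qed
  moreover have "{p \<in> space P. abar (fst p) (snd p) = m (fst p) (snd p) - kint L V (\<lambda>s. m s (snd p)) (fst p)} \<in> sets P"
  proof -
    have [measurable]: "(\<lambda>p. abar (fst p) (snd p)) \<in> borel_measurable P"
      "(\<lambda>p. m (fst p) (snd p)) \<in> borel_measurable P"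
      "(\<lambda>p. kint L V (\<lambda>s. m s (snd p)) (fst p)) \<in> borel_measurable P"
      using abar l2_measurable[OF l2_proc_m]
        kint_proc_measurable[OF l2_rows_measurable[OF V] l2_measurable[OF l2_proc_m]]
      by (simp_all add: case_prod_beta')
    show ?thesis by measurable
  qed
  ultimately have "AE \<omega> in M. AE t in L. abar t \<omega> = m t \<omega> - kint L V (\<lambda>s. m s \<omega>) t"
    using LM.AE_commute[of "\<lambda>t \<omega>. abar t \<omega> = m t \<omega> - kint L V (\<lambda>s. m s \<omega>) t"] by simp
  then show ?thesis
    using l2_proc_path[OF l2_proc_m] AE_space
  proof eventually_elim
    case (elim \<omega>)
    let ?a = "\<lambda>s. abar s \<omega>" and ?m = "\<lambda>s. m s \<omega>"
    have Bm: "L2_eq T (?B ?m) ?a"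
      unfolding L2_eq_iff using elim(1) AE_space
      by eventually_elim (simp add: kop_Bbar)
    have am: "?a \<in> borel_measurable L"
      using measurable_compose[OF measurable_Pair2'[OF elim(3)] abar] by simp
    \<comment> \<open>The assumptions on \<open>abar\<close> say nothing about integrability of its
      paths; it is inherited from \<open>m - V m\<close>, which equals \<open>abar\<close> almost
      everywhere.\<close>
    have "l2 L (\<lambda>t. m t \<omega> - kint L V (\<lambda>s. m s \<omega>) t)"
      by (intro l2_diff elim(2) l2_kint[OF finite_measure_leb V])
    then have "integrable L (\<lambda>s. (?a s)\<^sup>2)"
    proof (rule integrable_cong_AE_imp[OF l2_square])
      show "(\<lambda>s. (?a s)\<^sup>2) \<in> borel_measurable L" using am by simp
      show "AE t in L. (m t \<omega> - kint L V (\<lambda>s. m s \<omega>) t)\<^sup>2 = (?a t)\<^sup>2"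
        using elim(1) by eventually_elim simp
    qed
    with am have a: "L2 T ?a" unfolding L2_iff l2_def by simp
    note inv = op_inv_L2[OF op_invertible_Bbar a]
    have "L2_eq T (?B ?m) (?B (op_inv T ?B ?a))"
      using Bm inv(2) unfolding L2_eq_iff by eventually_elim simp
    then have "L2_eq T ?m (op_inv T ?B ?a)"
      using op_invertible_Bbar inv(1) elim(2) unfolding op_invertible_def L2_iff by blast
    then show ?case by (simp add: L2_eq_def)
  qed
qed

end

end

theorem mainTheorem1:
  fixes M :: "'a measure" and F :: "real \<Rightarrow> 'a measure" and T lam :: real and N :: nat
    and A1 A2h A3 :: "real \<Rightarrow> real \<Rightarrow> real"
    and b0 :: "real \<Rightarrow> 'a \<Rightarrow> real" and b :: "nat \<Rightarrow> real \<Rightarrow> 'a \<Rightarrow> real"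
    and c :: "nat \<Rightarrow> 'a \<Rightarrow> real" and U :: "nat \<Rightarrow> real \<Rightarrow> 'a \<Rightarrow> real"
  assumes "prob_space M" and "T > 0" and "N \<ge> 2"
    and "is_filtration M F T" and "usual_conditions M F T"
    and "admissible M F T b0" and "\<forall>i\<in>{1..N}. admissible M F T (b i)"
    and "\<forall>i\<in>{1..N}. integrable M (c i)"
    and "admissible_kernel T A1" and "admissible_kernel T A3" and "admissible_kernel T A2h"
    and "lam > 0"
    and "nash_equilibrium M F N T A1 lam A2h A3 b0 b c U"
  shows "(\<forall>t\<in>{0..T}. op_invertible T (Dbar N T A1 lam A2h A3 t))
    \<and> op_invertible T (\<lambda>f r. f r - kop T (Bbar N T A1 lam A2h A3) f r)
    \<and> (\<forall>abar :: real \<Rightarrow> 'a \<Rightarrow> real.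
         (\<lambda>(t,\<omega>). abar t \<omega>) \<in> borel_measurable (restrict_space lborel {0..T} \<Otimes>\<^sub>M M)
         \<and> (\<forall>t\<in>{0..T}. AE \<omega> in M. abar t \<omega> = abar_formula M F N T A1 lam A2h A3 b0 b t \<omega>)
         \<longrightarrow> (AE \<omega> in M. AE t in lborel. t \<in> {0..T} \<longrightarrow>
               avg N U t \<omega> = op_inv T (\<lambda>f r. f r - kop T (Bbar N T A1 lam A2h A3) f r)
                                (\<lambda>s. abar s \<omega>) t))"
proof -
  obtain C1 where C1: "volterra_kernel T C1 A1"
    using volterra_kernel_of_admissible[OF assms(9,2)] by auto
  obtain C3 where C3: "volterra_kernel T C3 A3"
    using volterra_kernel_of_admissible[OF assms(10,2)] by auto
  obtain C2 where C2: "volterra_kernel T C2 A2h"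
    using volterra_kernel_of_admissible[OF assms(11,2)] by auto
  interpret stochastic_game M F T N A1 A2h A3 lam C1 C2 C3 b0 b c U
  proof (intro stochastic_game.intro filtered_prob_space.intro filtered_prob_space_axioms.intro
      stochastic_game_axioms.intro)
    show "is_filtration M F T" "0 < T" "0 < lam" "admissible M F T b0"
      "nash_equilibrium M F N T A1 lam A2h A3 b0 b c U"
      by fact+
    show "0 < N" using assms(3) by linarith
    show "admissible M F T (b i)" if "i \<in> {1..N}" for i using assms(7) that by (rule bspec)
    show "integrable M (c i)" if "i \<in> {1..N}" for i using assms(8) that by (rule bspec)
  qed (fact assms(1) C1 C2 C3)+
  obtain C where K: "volterra_kernel T C (Kbar N A1 A2h A3)" using volterra_K by auto
  show ?thesis
  proof (intro conjI ballI allI impI)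
    show "op_invertible T (Dbar N T A1 lam A2h A3 t)" for t by (rule op_invertible_Dbar[OF K])
    show "op_invertible T (\<lambda>f r. f r - kop T (Bbar N T A1 lam A2h A3) f r)"
      by (rule op_invertible_Bbar[OF K])
  qed (elim conjE, rule mean_equilibrium[OF K])
qed

end
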